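(* Let $(\mathcal{C},J)$ be a small-generated site. Then an internal locale in $\mathbf{Sh}(\mathcal{C},J)$ is precisely a functor $L:\mathcal{C}^{\mathrm{op}}\to\mathbf{CAT}$ taking values in the subcategory of frames and frame homomorphisms which is a $J$-sheaf and which, when considered as a fibred site (by endowing each frame $L(c)$ with its canonical topology), is existential; i.e. each $L(a):L(E')\to L(E)$ ($a:E\to E'$ in $\mathcal{C}$) has a left adjoint $\exists_a:L(E)\to L(E')$ and the following conditions are satisfied: (i) (relative Beck–Chevalley condition) for any arrows $c:V\to Z$ and $d:W\to Z$ in $\mathcal{C}$ with common codomain and any $l\in L(V)$, $$L(d)(\exists_c(l))=\bigvee_{(a,b)\in B_{(c,d)}}\exists_b(L(a)(l)),$$ where $B_{(c,d)}$ is the collection of spans $(a:U\to V,\ b:U\to W)$ in $\mathcal{C}$ such that $c\circ a=d\circ b$; (ii) (Frobenius reciprocity condition) for any $a:E\to E'$ in $\mathcal{C}$, $l\in L(E)$ and $l'\in L(E')$, $\exists_a(L(a)(l')\wedge l)=\exists_a(l)\wedge l'$.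
   Context: A small-generated site is a site $(\mathcal{C},J)$ with $\mathcal{C}$ locally small and admitting a small $J$-dense full subcategory. Let $l_J:\mathcal{C}\to\mathcal{E}:=\mathbf{Sh}(\mathcal{C},J)$ be the canonical functor. An internal locale in a Grothendieck topos $\mathcal{E}$ is a functor $M:\mathcal{E}^{\mathrm{op}}\to\mathbf{CAT}$ such that: each $M(E)$ is a frame and for each $e:E\to E'$, $M(e):M(E')\to M(E)$ is a frame homomorphism having a left adjoint $\exists_e$; the underlying set-valued functor is a sheaf for the canonical topology on $\mathcal{E}$; (Beck–Chevalley) for every pullback square with $a:U\to V$, $b:U\to W$, $c:V\to Z$, $d:W\to Z$, $c\circ a=d\circ b$, one has $\exists_b\circ M(a)=M(d)\circ\exists_c$; (Frobenius) for any $a:E\to E'$, $l\in M(E)$, $l'\in M(E')$, $\exists_a(M(a)(l')\wedge l)=\exists_a(l)\wedge l'$. Via the equivalence between sheaves on $\mathcal{E}$ for the canonical topology and $J$-sheaves on $\mathcal{C}$ (given by composition with $l_J$), an internal locale $M$ in $\mathbf{Sh}(\mathcal{C},J)$ is identified with the functor $M\circ l_J^{\mathrm{op}}:\mathcal{C}^{\mathrm{op}}\to\mathbf{CAT}$; thus $L:\mathcal{C}^{\mathrm{op}}\to\mathbf{CAT}$ "is an internal locale in $\mathbf{Sh}(\mathcal{C},J)$" if it is isomorphic to one of this form. *)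

theory Defs
  imports "HOL-Library.Equipollence" "HOL-Algebra.Galois_Connection"
begin

section \<open>Size\<close>

text \<open>
  "Small" is relative to a type \<open>'u\<close> playing the role of a Grothendieck universe: the small sets
  are those of cardinality less than that of \<open>'u\<close>, and the category of (small) sets is
  represented by the small subsets of \<open>'u\<close>. The predicate \<open>universe\<close> says that the cardinality
  of \<open>'u\<close> is infinite, regular and a strong limit. It is strongly inaccessible if in addition
  \<open>'u\<close> is uncountable; this is not required, so \<open>'u = nat\<close> (small = finite) is also allowed.
\<close>

definition small :: "'u itself \<Rightarrow> 's set \<Rightarrow> bool" where
  "small U A \<longleftrightarrow> A \<prec> (UNIV :: 'u set)"

definition universe :: "'u itself \<Rightarrow> bool" where
  "universe U \<longleftrightarrow>
     infinite (UNIV :: 'u set) \<and>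
     (\<forall>A :: 'u set. small U A \<longrightarrow> small U (Pow A)) \<and>
     (\<forall>F :: 'u set set. small U F \<and> (\<forall>A\<in>F. small U A) \<longrightarrow> small U (\<Union>F))"

section \<open>Categories\<close>

record ('o, 'a) cat =
  Ob :: "'o set"
  Arr :: "'a set"
  Dom :: "'a \<Rightarrow> 'o"
  Cod :: "'a \<Rightarrow> 'o"
  Id :: "'o \<Rightarrow> 'a"
  Comp :: "'a \<Rightarrow> 'a \<Rightarrow> 'a"  (infixl \<open>\<cdot>\<index>\<close> 75)

definition Hom :: "('o, 'a) cat \<Rightarrow> 'o \<Rightarrow> 'o \<Rightarrow> 'a set" where
  "Hom C x y = {f \<in> Arr C. Dom C f = x \<and> Cod C f = y}"

locale category =
  fixes C :: "('o, 'a) cat" (structure)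
  assumes Dom_in: "f \<in> Arr C \<Longrightarrow> Dom C f \<in> Ob C"
    and Cod_in: "f \<in> Arr C \<Longrightarrow> Cod C f \<in> Ob C"
    and Id_in: "x \<in> Ob C \<Longrightarrow> Id C x \<in> Hom C x x"
    and Comp_in: "\<lbrakk>f \<in> Hom C x y; g \<in> Hom C y z\<rbrakk> \<Longrightarrow> g \<cdot> f \<in> Hom C x z"
    and Id_left: "f \<in> Hom C x y \<Longrightarrow> Id C y \<cdot> f = f"
    and Id_right: "f \<in> Hom C x y \<Longrightarrow> f \<cdot> Id C x = f"
    and assoc: "\<lbrakk>f \<in> Hom C w x; g \<in> Hom C x y; h \<in> Hom C y z\<rbrakk> \<Longrightarrow> h \<cdot> (g \<cdot> f) = (h \<cdot> g) \<cdot> f"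

definition locally_small :: "'u itself \<Rightarrow> ('o, 'a) cat \<Rightarrow> bool" where
  "locally_small U C \<longleftrightarrow> (\<forall>x\<in>Ob C. \<forall>y\<in>Ob C. small U (Hom C x y))"

record ('o, 'a, 'p, 'b) func =
  FOb :: "'o \<Rightarrow> 'p"
  FArr :: "'a \<Rightarrow> 'b"

definition is_functor :: "('o, 'a) cat \<Rightarrow> ('p, 'b) cat \<Rightarrow> ('o, 'a, 'p, 'b) func \<Rightarrow> bool" where
  "is_functor C D F \<longleftrightarrow>
     (\<forall>x\<in>Ob C. FOb F x \<in> Ob D) \<and>
     (\<forall>f\<in>Arr C. FArr F f \<in> Hom D (FOb F (Dom C f)) (FOb F (Cod C f))) \<and>
     (\<forall>x\<in>Ob C. FArr F (Id C x) = Id D (FOb F x)) \<and>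
     (\<forall>f\<in>Arr C. \<forall>g\<in>Arr C. Cod C f = Dom C g \<longrightarrow>
        FArr F (g \<cdot>\<^bsub>C\<^esub> f) = FArr F g \<cdot>\<^bsub>D\<^esub> FArr F f)"

definition spans :: "('o, 'a) cat \<Rightarrow> 'a \<Rightarrow> 'a \<Rightarrow> ('a \<times> 'a) set" where
  "spans C c d = {(a, b). a \<in> Arr C \<and> b \<in> Arr C \<and> Dom C a = Dom C b \<and>
     Cod C a = Dom C c \<and> Cod C b = Dom C d \<and> c \<cdot>\<^bsub>C\<^esub> a = d \<cdot>\<^bsub>C\<^esub> b}"

definition is_pullback :: "('o, 'a) cat \<Rightarrow> 'a \<Rightarrow> 'a \<Rightarrow> 'a \<Rightarrow> 'a \<Rightarrow> bool" where
  "is_pullback C a b c d \<longleftrightarrow>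
     c \<in> Arr C \<and> d \<in> Arr C \<and> Cod C c = Cod C d \<and> (a, b) \<in> spans C c d \<and>
     (\<forall>(p, q)\<in>spans C c d.
        \<exists>!u. u \<in> Hom C (Dom C p) (Dom C a) \<and> a \<cdot>\<^bsub>C\<^esub> u = p \<and> b \<cdot>\<^bsub>C\<^esub> u = q)"

section \<open>Sites\<close>

definition sieve :: "('o, 'a) cat \<Rightarrow> 'o \<Rightarrow> 'a set \<Rightarrow> bool" where
  "sieve C c S \<longleftrightarrow> S \<subseteq> Arr C \<and>
     (\<forall>f\<in>S. Cod C f = c \<and> (\<forall>g\<in>Arr C. Cod C g = Dom C f \<longrightarrow> f \<cdot>\<^bsub>C\<^esub> g \<in> S))"

definition pull_sieve :: "('o, 'a) cat \<Rightarrow> 'a \<Rightarrow> 'a set \<Rightarrow> 'a set" where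
  "pull_sieve C h S = {g \<in> Arr C. Cod C g = Dom C h \<and> h \<cdot>\<^bsub>C\<^esub> g \<in> S}"

definition gen_sieve :: "('o, 'a) cat \<Rightarrow> 'a set \<Rightarrow> 'a set" where
  "gen_sieve C R = {f \<cdot>\<^bsub>C\<^esub> g | f g. f \<in> R \<and> g \<in> Arr C \<and> Cod C g = Dom C f}"

definition grothendieck_topology :: "('o, 'a) cat \<Rightarrow> ('o \<Rightarrow> 'a set set) \<Rightarrow> bool" where
  "grothendieck_topology C J \<longleftrightarrow>
     (\<forall>c\<in>Ob C. \<forall>S\<in>J c. sieve C c S) \<and>
     (\<forall>c\<in>Ob C. {f \<in> Arr C. Cod C f = c} \<in> J c) \<and>
     (\<forall>h\<in>Arr C. \<forall>S\<in>J (Cod C h). pull_sieve C h S \<in> J (Dom C h)) \<and>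
     (\<forall>c\<in>Ob C. \<forall>S\<in>J c. \<forall>R. sieve C c R \<and> (\<forall>f\<in>S. pull_sieve C f R \<in> J (Dom C f)) \<longrightarrow> R \<in> J c)"

definition J_dense :: "('o, 'a) cat \<Rightarrow> ('o \<Rightarrow> 'a set set) \<Rightarrow> 'o set \<Rightarrow> bool" where
  "J_dense C J D \<longleftrightarrow> D \<subseteq> Ob C \<and>
     (\<forall>c\<in>Ob C. \<exists>R \<subseteq> {f \<in> Arr C. Dom C f \<in> D \<and> Cod C f = c}. gen_sieve C R \<in> J c)"

text \<open>A full subcategory is given by its set of objects; it is small as soon as this set is,
  the hom-sets being small by local smallness.\<close>

definition small_generated_site ::
    "'u itself \<Rightarrow> ('o, 'a) cat \<Rightarrow> ('o \<Rightarrow> 'a set set) \<Rightarrow> bool" where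
  "small_generated_site U C J \<longleftrightarrow>
     category C \<and> grothendieck_topology C J \<and> locally_small U C \<and>
     (\<exists>D. small U D \<and> J_dense C J D)"

section \<open>Presheaves and sheaves\<close>

record ('o, 'a, 's) psh =
  Sec :: "'o \<Rightarrow> 's set"
  Rst :: "'a \<Rightarrow> 's \<Rightarrow> 's"

definition presheaf :: "('o, 'a) cat \<Rightarrow> ('o, 'a, 's) psh \<Rightarrow> bool" where
  "presheaf C P \<longleftrightarrow>
     (\<forall>f\<in>Arr C. Rst P f \<in> Sec P (Cod C f) \<rightarrow> Sec P (Dom C f)) \<and>
     (\<forall>c\<in>Ob C. \<forall>x\<in>Sec P c. Rst P (Id C c) x = x) \<and>
     (\<forall>f\<in>Arr C. \<forall>g\<in>Arr C. Cod C g = Dom C f \<longrightarrow>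
        (\<forall>x\<in>Sec P (Cod C f). Rst P (f \<cdot>\<^bsub>C\<^esub> g) x = Rst P g (Rst P f x)))"

definition matching_family ::
    "('o, 'a) cat \<Rightarrow> ('o, 'a, 's) psh \<Rightarrow> 'a set \<Rightarrow> ('a \<Rightarrow> 's) \<Rightarrow> bool" where
  "matching_family C P S x \<longleftrightarrow>
     (\<forall>f\<in>S. x f \<in> Sec P (Dom C f) \<and>
        (\<forall>g\<in>Arr C. Cod C g = Dom C f \<longrightarrow> x (f \<cdot>\<^bsub>C\<^esub> g) = Rst P g (x f)))"

definition sheaf ::
    "('o, 'a) cat \<Rightarrow> ('o \<Rightarrow> 'a set set) \<Rightarrow> ('o, 'a, 's) psh \<Rightarrow> bool" where
  "sheaf C J P \<longleftrightarrow> presheaf C P \<and>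
     (\<forall>c\<in>Ob C. \<forall>S\<in>J c. \<forall>x. matching_family C P S x \<longrightarrow>
        (\<exists>!t. t \<in> Sec P c \<and> (\<forall>f\<in>S. Rst P f t = x f)))"

definition nat_trans ::
    "('o, 'a) cat \<Rightarrow> ('o, 'a, 's) psh \<Rightarrow> ('o, 'a, 't) psh \<Rightarrow> ('o \<Rightarrow> 's \<Rightarrow> 't) \<Rightarrow> bool" where
  "nat_trans C P Q \<alpha> \<longleftrightarrow>
     (\<forall>c\<in>Ob C. \<alpha> c \<in> Sec P c \<rightarrow> Sec Q c) \<and>
     (\<forall>f\<in>Arr C. \<forall>x\<in>Sec P (Cod C f). \<alpha> (Dom C f) (Rst P f x) = Rst Q f (\<alpha> (Cod C f) x))"

definition yo :: "('o, 'a) cat \<Rightarrow> 'o \<Rightarrow> ('o, 'a, 'a) psh" where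
  "yo C c = \<lparr>Sec = (\<lambda>d. Hom C d c), Rst = (\<lambda>f g. g \<cdot>\<^bsub>C\<^esub> f)\<rparr>"

definition subcanonical :: "('o, 'a) cat \<Rightarrow> ('o \<Rightarrow> 'a set set) \<Rightarrow> bool" where
  "subcanonical C J \<longleftrightarrow> (\<forall>c\<in>Ob C. sheaf C J (yo C c))"

text \<open>The canonical topology is the finest subcanonical one. Since a finest one exists, it is the
  union of all of them.\<close>

definition canonical_topology :: "('o, 'a) cat \<Rightarrow> 'o \<Rightarrow> 'a set set" where
  "canonical_topology C c = \<Union>{K c | K. grothendieck_topology C K \<and> subcanonical C K}"

section \<open>The topos of sheaves and the canonical functor\<close>

text \<open>Objects and arrows are normalised outside their domains (\<open>extensional\<close>), so that equality
  in HOL is equality of sheaves and of natural transformations.\<close>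

type_synonym ('o, 'a, 'u) sh_arr =
  "('o, 'a, 'u) psh \<times> ('o \<Rightarrow> 'u \<Rightarrow> 'u) \<times> ('o, 'a, 'u) psh"

definition sh_objects ::
    "('o, 'a) cat \<Rightarrow> ('o \<Rightarrow> 'a set set) \<Rightarrow> ('o, 'a, 'u) psh set" where
  "sh_objects C J = {F. sheaf C J F \<and> (\<forall>c\<in>Ob C. small TYPE('u) (Sec F c)) \<and>
     Sec F \<in> extensional (Ob C) \<and> Rst F \<in> extensional (Arr C) \<and>
     (\<forall>f\<in>Arr C. Rst F f \<in> extensional (Sec F (Cod C f)))}"

definition sh_arrows ::
    "('o, 'a) cat \<Rightarrow> ('o \<Rightarrow> 'a set set) \<Rightarrow> ('o, 'a, 'u) sh_arr set" where
  "sh_arrows C J = {(F, \<alpha>, G). F \<in> sh_objects C J \<and> G \<in> sh_objects C J \<and> nat_trans C F G \<alpha> \<and>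
     \<alpha> \<in> extensional (Ob C) \<and> (\<forall>c\<in>Ob C. \<alpha> c \<in> extensional (Sec F c))}"

abbreviation (input) component :: "('o, 'a, 'u) sh_arr \<Rightarrow> 'o \<Rightarrow> 'u \<Rightarrow> 'u" where
  "component s \<equiv> fst (snd s)"

definition Sh ::
    "('o, 'a) cat \<Rightarrow> ('o \<Rightarrow> 'a set set) \<Rightarrow> (('o, 'a, 'u) psh, ('o, 'a, 'u) sh_arr) cat" where
  "Sh C J = \<lparr>
     Ob = sh_objects C J,
     Arr = sh_arrows C J,
     Dom = (\<lambda>s. fst s),
     Cod = (\<lambda>s. snd (snd s)),
     Id = (\<lambda>F. (F, (\<lambda>c\<in>Ob C. \<lambda>x\<in>Sec F c. x), F)),
     Comp = (\<lambda>t s. (fst s,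
               (\<lambda>c\<in>Ob C. compose (Sec (fst s) c) (component t c) (component s c)),
               snd (snd t)))\<rparr>"

definition sheafification ::
    "('o, 'a) cat \<Rightarrow> ('o \<Rightarrow> 'a set set) \<Rightarrow> ('o, 'a, 's) psh \<Rightarrow> ('o, 'a, 'u) psh \<Rightarrow>
     ('o \<Rightarrow> 's \<Rightarrow> 'u) \<Rightarrow> bool" where
  "sheafification C J P F \<eta> \<longleftrightarrow> F \<in> Ob (Sh C J) \<and> nat_trans C P F \<eta> \<and>
     (\<forall>G\<in>Ob (Sh C J). \<forall>\<alpha>. nat_trans C P G \<alpha> \<longrightarrow>
        (\<exists>!s. s \<in> Hom (Sh C J) F G \<and>
           (\<forall>d\<in>Ob C. \<forall>x\<in>Sec P d. component s d (\<eta> d x) = \<alpha> d x)))"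

text \<open>The canonical functor is the Yoneda embedding followed by sheafification. Like
  sheafification, it is determined up to isomorphism only, and \<open>l_functor\<close> is a choice.\<close>

definition canonical_functor ::
    "('o, 'a) cat \<Rightarrow> ('o \<Rightarrow> 'a set set) \<Rightarrow>
     ('o, 'a, ('o, 'a, 'u) psh, ('o, 'a, 'u) sh_arr) func \<Rightarrow> bool" where
  "canonical_functor C J l \<longleftrightarrow> is_functor C (Sh C J) l \<and>
     (\<exists>\<eta>. (\<forall>c\<in>Ob C. sheafification C J (yo C c) (FOb l c) (\<eta> c)) \<and>
          (\<forall>h\<in>Arr C. \<forall>d\<in>Ob C. \<forall>g\<in>Hom C d (Dom C h).
             component (FArr l h) d (\<eta> (Dom C h) d g) = \<eta> (Cod C h) d (h \<cdot>\<^bsub>C\<^esub> g)))"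

definition l_functor ::
    "('o, 'a) cat \<Rightarrow> ('o \<Rightarrow> 'a set set) \<Rightarrow>
     ('o, 'a, ('o, 'a, 'u) psh, ('o, 'a, 'u) sh_arr) func" where
  "l_functor C J = (SOME l. canonical_functor C J l)"

section \<open>Frames\<close>

definition frame :: "'v gorder \<Rightarrow> bool" where
  "frame X \<longleftrightarrow> complete_lattice X \<and>
     (\<forall>x\<in>carrier X. \<forall>A \<subseteq> carrier X. x \<sqinter>\<^bsub>X\<^esub> (\<Squnion>\<^bsub>X\<^esub> A) = \<Squnion>\<^bsub>X\<^esub> ((\<lambda>a. x \<sqinter>\<^bsub>X\<^esub> a) ` A))"

definition frame_hom :: "'v gorder \<Rightarrow> 'w gorder \<Rightarrow> ('v \<Rightarrow> 'w) \<Rightarrow> bool" where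
  "frame_hom X Y h \<longleftrightarrow> h \<in> carrier X \<rightarrow> carrier Y \<and>
     sup_pres X Y h \<and> meet_pres X Y h \<and> h \<top>\<^bsub>X\<^esub> = \<top>\<^bsub>Y\<^esub>"

text \<open>Contravariant functors into posets, regarded as thin skeletal categories, so that functors
  between them are monotone maps and isomorphisms of categories are order isomorphisms.\<close>

record ('o, 'a, 'v) pos_psh =
  Fib :: "'o \<Rightarrow> 'v gorder"
  Tr :: "'a \<Rightarrow> 'v \<Rightarrow> 'v"

definition underlying :: "('o, 'a, 'v) pos_psh \<Rightarrow> ('o, 'a, 'v) psh" where
  "underlying L = \<lparr>Sec = (\<lambda>c. carrier (Fib L c)), Rst = Tr L\<rparr>"

definition pos_functor :: "('o, 'a) cat \<Rightarrow> ('o, 'a, 'v) pos_psh \<Rightarrow> bool" where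
  "pos_functor C L \<longleftrightarrow> presheaf C (underlying L) \<and>
     (\<forall>c\<in>Ob C. partial_order (Fib L c)) \<and>
     (\<forall>f\<in>Arr C. isotone (Fib L (Cod C f)) (Fib L (Dom C f)) (Tr L f))"

definition pos_functor_iso ::
    "('o, 'a) cat \<Rightarrow> ('o, 'a, 'v) pos_psh \<Rightarrow> ('o, 'a, 'w) pos_psh \<Rightarrow> bool" where
  "pos_functor_iso C L L' \<longleftrightarrow> pos_functor C L \<and> pos_functor C L' \<and>
     (\<exists>\<phi>. nat_trans C (underlying L) (underlying L') \<phi> \<and>
        (\<forall>c\<in>Ob C. bij_betw (\<phi> c) (carrier (Fib L c)) (carrier (Fib L' c)) \<and>
                  order_emb (Fib L c) (Fib L' c) (\<phi> c)))"

definition frame_functor :: "('o, 'a) cat \<Rightarrow> ('o, 'a, 'v) pos_psh \<Rightarrow> bool" where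
  "frame_functor C L \<longleftrightarrow> pos_functor C L \<and>
     (\<forall>c\<in>Ob C. frame (Fib L c) \<and> small TYPE('v) (carrier (Fib L c))) \<and>
     (\<forall>f\<in>Arr C. frame_hom (Fib L (Cod C f)) (Fib L (Dom C f)) (Tr L f))"

definition precompose ::
    "('p, 'b, 'v) pos_psh \<Rightarrow> ('o, 'a, 'p, 'b) func \<Rightarrow> ('o, 'a, 'v) pos_psh" where
  "precompose M F = \<lparr>Fib = (\<lambda>c. Fib M (FOb F c)), Tr = (\<lambda>f. Tr M (FArr F f))\<rparr>"

section \<open>Internal locales and existential fibred sites\<close>

text \<open>\<open>ex\<close> assigns to each arrow \<open>a\<close> the left adjoint of \<open>Tr L a\<close>; left adjoints of maps
  between posets are unique.\<close>

definition left_adjoints ::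
    "('o, 'a) cat \<Rightarrow> ('o, 'a, 'v) pos_psh \<Rightarrow> ('a \<Rightarrow> 'v \<Rightarrow> 'v) \<Rightarrow> bool" where
  "left_adjoints C L ex \<longleftrightarrow> (\<forall>a\<in>Arr C. galois_connection
     \<lparr>orderA = Fib L (Dom C a), orderB = Fib L (Cod C a), lower = ex a, upper = Tr L a\<rparr>)"

definition frobenius ::
    "('o, 'a) cat \<Rightarrow> ('o, 'a, 'v) pos_psh \<Rightarrow> ('a \<Rightarrow> 'v \<Rightarrow> 'v) \<Rightarrow> bool" where
  "frobenius C L ex \<longleftrightarrow>
     (\<forall>a\<in>Arr C. \<forall>l\<in>carrier (Fib L (Dom C a)). \<forall>l'\<in>carrier (Fib L (Cod C a)).
        ex a (Tr L a l' \<sqinter>\<^bsub>Fib L (Dom C a)\<^esub> l) = ex a l \<sqinter>\<^bsub>Fib L (Cod C a)\<^esub> l')"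

definition beck_chevalley ::
    "('o, 'a) cat \<Rightarrow> ('o, 'a, 'v) pos_psh \<Rightarrow> ('a \<Rightarrow> 'v \<Rightarrow> 'v) \<Rightarrow> bool" where
  "beck_chevalley C M ex \<longleftrightarrow>
     (\<forall>a b c d. is_pullback C a b c d \<longrightarrow>
        (\<forall>l\<in>carrier (Fib M (Dom C c)). ex b (Tr M a l) = Tr M d (ex c l)))"

definition relative_beck_chevalley ::
    "('o, 'a) cat \<Rightarrow> ('o, 'a, 'v) pos_psh \<Rightarrow> ('a \<Rightarrow> 'v \<Rightarrow> 'v) \<Rightarrow> bool" where
  "relative_beck_chevalley C L ex \<longleftrightarrow>
     (\<forall>c\<in>Arr C. \<forall>d\<in>Arr C. Cod C c = Cod C d \<longrightarrow>
        (\<forall>l\<in>carrier (Fib L (Dom C c)).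
           Tr L d (ex c l) =
             \<Squnion>\<^bsub>Fib L (Dom C d)\<^esub> ((\<lambda>(a, b). ex b (Tr L a l)) ` spans C c d)))"

definition internal_locale :: "('o, 'a) cat \<Rightarrow> ('o, 'a, 'v) pos_psh \<Rightarrow> bool" where
  "internal_locale E M \<longleftrightarrow> frame_functor E M \<and>
     sheaf E (canonical_topology E) (underlying M) \<and>
     (\<exists>ex. left_adjoints E M ex \<and> beck_chevalley E M ex \<and> frobenius E M ex)"

definition internal_locale_in_Sh ::
    "('o, 'a) cat \<Rightarrow> ('o \<Rightarrow> 'a set set) \<Rightarrow> ('o, 'a, 'u) pos_psh \<Rightarrow> bool" where
  "internal_locale_in_Sh C J L \<longleftrightarrow>
     (\<exists>M :: (('o, 'a, 'u) psh, ('o, 'a, 'u) sh_arr, 'u) pos_psh.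
        internal_locale (Sh C J) M \<and> pos_functor_iso C L (precompose M (l_functor C J)))"

definition existential :: "('o, 'a) cat \<Rightarrow> ('o, 'a, 'v) pos_psh \<Rightarrow> bool" where
  "existential C L \<longleftrightarrow>
     (\<exists>ex. left_adjoints C L ex \<and> relative_beck_chevalley C L ex \<and> frobenius C L ex)"

end

theory Submission
  imports Defs
begin

text \<open>
  Write \<open>E\<close> for the topos of sheaves on \<open>(C, J)\<close> and \<open>l\<close> for the canonical functor from \<open>C\<close> to \<open>E\<close>. Two
  facts about \<open>l\<close> carry the proof. First, arrows \<open>l c \<rightarrow> F\<close> are the same as sections of \<open>F\<close> at \<open>c\<close>
  (\<open>point\<close>). Second, every section of \<open>l c\<close> is locally an arrow of \<open>C\<close>, and two arrows of \<open>C\<close> with the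
  same image agree locally. Consequently a commutative square in \<open>E\<close> over two arrows \<open>l f\<close> and \<open>l g\<close> is,
  locally, made of spans over \<open>f\<close> and \<open>g\<close> in \<open>C\<close> (\<open>locally_spanned\<close>). This is the reason why the
  Beck--Chevalley condition, which speaks of pullbacks in \<open>E\<close>, becomes a condition on joins over all
  spans in \<open>C\<close>, which need not have pullbacks.

  The first fact is the Yoneda lemma. The second holds for any sheafification because it holds for a
  particular one. That one is built from saturated relations between arrows and sections
  (\<open>sheaf_germs\<close>), and its sections form small sets since such a relation is determined on the small
  dense subcategory (\<open>small_germs\<close>).

  From an internal locale \<open>M\<close> to \<open>L = M \<circ> l\<close>: the jointly epimorphic sieves of \<open>E\<close> form a subcanonical
  topology (\<open>epi_topology_subcanonical\<close>), so that \<open>M\<close> is a sheaf for it, and \<open>l\<close> turns \<open>J\<close>-covers into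
  jointly epimorphic families. Hence \<open>L\<close> is a \<open>J\<close>-sheaf (\<open>sheaf_restrict_along\<close>). The adjoints and the
  Frobenius condition restrict along \<open>l\<close>. For the relative Beck--Chevalley condition, the pullback of
  \<open>l c\<close> and \<open>l d\<close> is covered by the spans over \<open>c\<close> and \<open>d\<close>, and an inequality between elements of \<open>M\<close>
  may be checked on a cover (\<open>relative_beck_chevalley_precompose\<close>).

  From an existential sheaf \<open>L\<close> to an internal locale: the extension is the representable
  \<open>N F = Hom E F L\<close> with the pointwise order. It is a sheaf for every subcanonical topology by
  definition, a frame because the transition maps of \<open>L\<close> preserve joins and finite meets, and it
  restricts to \<open>L\<close> along \<open>l\<close> by the Yoneda lemma (\<open>N_restrict\<close>). The left adjoint of restriction along
  \<open>e\<close> is given by a Kan extension formula: its value at a section \<open>y\<close> is the join of all \<open>\<exists>\<^sub>g (s x)\<close>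
  where \<open>g\<close> is an arrow of \<open>C\<close> and \<open>x\<close> a section with \<open>e x = y \<cdot> g\<close>. The relative Beck--Chevalley
  condition for \<open>L\<close> makes this natural in \<open>y\<close> (\<open>lifts_natural\<close>). Pullbacks in \<open>E\<close> being computed
  sectionwise, the Beck--Chevalley condition for \<open>N\<close> is then immediate from the formula, and
  Frobenius reciprocity follows from that of \<open>L\<close> by distributivity.
\<close>


section \<open>Small sets\<close>

unbundle cardinal_syntax

lemma small_inj_on:
  assumes "inj_on f A" "f ` A \<subseteq> B" "small U B"
  shows "small U A"
  using assms unfolding small_def lepoll_def [symmetric] by (meson lepoll_def lesspoll_trans1)

lemma small_subset: "small U B \<Longrightarrow> A \<subseteq> B \<Longrightarrow> small U A"
  by (rule small_inj_on[of id]) auto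

lemma small_image: "small U A \<Longrightarrow> small U (f ` A)"
  unfolding small_def by (meson image_lepoll lesspoll_trans1)

lemma small_embedding:
  assumes "small TYPE('u) A"
  obtains f :: "'s \<Rightarrow> 'u" where "inj_on f A"
  using assms unfolding small_def by (meson lepoll_def lesspoll_imp_lepoll)

lemma universe_pairing:
  assumes "universe TYPE('u)"
  obtains p :: "'u \<times> 'u \<Rightarrow> 'u" where "inj p"
proof -
  have "|(UNIV :: 'u set) \<times> (UNIV :: 'u set)| =o |UNIV :: 'u set|"
    using assms unfolding universe_def by (intro card_of_Times_same_infinite) auto
  then obtain p where "bij_betw p ((UNIV :: 'u set) \<times> (UNIV :: 'u set)) (UNIV :: 'u set)"
    using card_of_ordIso by blast
  then have "inj p"
    by (simp add: bij_betw_def)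
  then show thesis ..
qed

lemma small_Pow:
  assumes "universe TYPE('u)" "small TYPE('u) A"
  shows "small TYPE('u) (Pow A)"
proof -
  obtain f :: "'a \<Rightarrow> 'u" where f: "inj_on f A"
    using assms(2) by (rule small_embedding)
  have "small TYPE('u) (Pow (f ` A))"
    using assms small_image unfolding universe_def by blast
  moreover have "inj_on (image f) (Pow A)"
    using f by (rule inj_on_image_Pow)
  ultimately show ?thesis
    by (rule small_inj_on[rotated 2]) auto
qed

text \<open>Regularity of the universe speaks of unions of subsets of \<open>'u\<close> only. A pairing function on the
  infinite type \<open>'u\<close> spreads the summands of an abstract sum out into such subsets.\<close>

lemma small_Sigma:
  assumes "universe TYPE('u)" "small TYPE('u) I" "\<And>i. i \<in> I \<Longrightarrow> small TYPE('u) (A i)"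
  shows "small TYPE('u) (Sigma I A)"
proof -
  obtain p :: "'u \<times> 'u \<Rightarrow> 'u" where p: "inj p"
    using assms(1) by (rule universe_pairing)
  obtain f :: "'a \<Rightarrow> 'u" where f: "inj_on f I"
    using assms(2) by (rule small_embedding)
  have "\<forall>i\<in>I. \<exists>g :: 'b \<Rightarrow> 'u. inj_on g (A i)"
    using assms(3) by (meson small_embedding)
  then obtain g :: "'a \<Rightarrow> 'b \<Rightarrow> 'u" where g: "\<And>i. i \<in> I \<Longrightarrow> inj_on (g i) (A i)"
    by metis
  define F where "F = (\<lambda>i. (\<lambda>x. p (f i, g i x)) ` A i) ` I"
  have "small TYPE('u) F"
    unfolding F_def using assms(2) by (rule small_image)
  moreover have "small TYPE('u) X" if "X \<in> F" for X
    using that assms(3) small_image unfolding F_def by blast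
  ultimately have "small TYPE('u) (\<Union>F)"
    using assms(1) unfolding universe_def by blast
  moreover have "inj_on (\<lambda>(i, x). p (f i, g i x)) (Sigma I A)"
  proof (rule inj_onI)
    fix y z assume "y \<in> Sigma I A" "z \<in> Sigma I A"
      and eq: "(\<lambda>(i, x). p (f i, g i x)) y = (\<lambda>(i, x). p (f i, g i x)) z"
    then obtain i x j w where yz: "y = (i, x)" "z = (j, w)" "i \<in> I" "x \<in> A i" "j \<in> I" "w \<in> A j"
      by blast
    then have "f i = f j" "g i x = g j w"
      using eq p by (auto dest: injD)
    then show "y = z"
      using yz f g by (metis inj_onD)
  qed
  ultimately show ?thesis
    by (rule small_inj_on[rotated 2]) (auto simp: F_def)
qed

section \<open>Local truth in a site\<close>

context category
begin

lemma Dom_Ob [simp]: "f \<in> Arr C \<Longrightarrow> Dom C f \<in> Ob C"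
  and Cod_Ob [simp]: "f \<in> Arr C \<Longrightarrow> Cod C f \<in> Ob C"
  by (simp_all add: Dom_in Cod_in)

lemma Comp_Arr [simp]:
  assumes "f \<in> Arr C" "g \<in> Arr C" "Cod C g = Dom C f"
  shows "f \<cdot> g \<in> Arr C" "Dom C (f \<cdot> g) = Dom C g" "Cod C (f \<cdot> g) = Cod C f"
  using Comp_in[of g "Dom C g" "Dom C f" f "Cod C f"] assms by (auto simp: Hom_def)

lemma Id_Arr [simp]:
  assumes "c \<in> Ob C"
  shows "Id C c \<in> Arr C" "Dom C (Id C c) = c" "Cod C (Id C c) = c"
  using Id_in[OF assms] by (auto simp: Hom_def)

lemma Comp_Id [simp]:
  assumes "f \<in> Arr C"
  shows "Cod C f = c \<Longrightarrow> Id C c \<cdot> f = f" "Dom C f = c \<Longrightarrow> f \<cdot> Id C c = f"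
  using Id_left[of f] Id_right[of f] assms by (auto simp: Hom_def)

lemma Comp_assoc:
  assumes "f \<in> Arr C" "g \<in> Arr C" "h \<in> Arr C" "Cod C h = Dom C g" "Cod C g = Dom C f"
  shows "(f \<cdot> g) \<cdot> h = f \<cdot> (g \<cdot> h)"
  using assoc[of h "Dom C h" "Dom C g" g "Dom C f" f "Cod C f"] assms by (auto simp: Hom_def)

lemma presheaf_yo: "presheaf C (yo C c)"
  by (auto simp: presheaf_def yo_def Hom_def Comp_assoc)

end

lemma presheaf_closed:
  "presheaf C P \<Longrightarrow> f \<in> Arr C \<Longrightarrow> x \<in> Sec P (Cod C f) \<Longrightarrow> Rst P f x \<in> Sec P (Dom C f)"
  unfolding presheaf_def by blast

lemma presheaf_Id: "presheaf C P \<Longrightarrow> c \<in> Ob C \<Longrightarrow> x \<in> Sec P c \<Longrightarrow> Rst P (Id C c) x = x"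
  unfolding presheaf_def by blast

lemma presheaf_Comp:
  "presheaf C P \<Longrightarrow> f \<in> Arr C \<Longrightarrow> g \<in> Arr C \<Longrightarrow> Cod C g = Dom C f \<Longrightarrow> x \<in> Sec P (Cod C f) \<Longrightarrow>
    Rst P (f \<cdot>\<^bsub>C\<^esub> g) x = Rst P g (Rst P f x)"
  unfolding presheaf_def by blast

lemma nat_trans_closed: "nat_trans C P Q \<alpha> \<Longrightarrow> c \<in> Ob C \<Longrightarrow> x \<in> Sec P c \<Longrightarrow> \<alpha> c x \<in> Sec Q c"
  unfolding nat_trans_def by blast

lemma nat_trans_natural:
  "nat_trans C P Q \<alpha> \<Longrightarrow> f \<in> Arr C \<Longrightarrow> x \<in> Sec P (Cod C f) \<Longrightarrow>
    \<alpha> (Dom C f) (Rst P f x) = Rst Q f (\<alpha> (Cod C f) x)"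
  unfolding nat_trans_def by blast

text \<open>The modality of a topology: \<open>Q\<close> holds locally at \<open>c\<close> if it holds on some covering sieve. Arguing
  with it, by the rules below, takes the place of manipulating sieves.\<close>

definition locally :: "('o \<Rightarrow> 'a set set) \<Rightarrow> 'o \<Rightarrow> ('a \<Rightarrow> bool) \<Rightarrow> bool" where
  "locally J c Q \<longleftrightarrow> (\<exists>S\<in>J c. \<forall>f\<in>S. Q f)"

locale site = category C for C :: "('o, 'a) cat" (structure) +
  fixes J :: "'o \<Rightarrow> 'a set set"
  assumes topology: "grothendieck_topology C J"
begin

lemma cover_sieve: "c \<in> Ob C \<Longrightarrow> S \<in> J c \<Longrightarrow> sieve C c S"
  using topology unfolding grothendieck_topology_def by blast

lemma cover_arr: "c \<in> Ob C \<Longrightarrow> S \<in> J c \<Longrightarrow> f \<in> S \<Longrightarrow> f \<in> Arr C \<and> Cod C f = c"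
  using cover_sieve unfolding sieve_def by blast

lemma cover_comp:
  "c \<in> Ob C \<Longrightarrow> S \<in> J c \<Longrightarrow> f \<in> S \<Longrightarrow> g \<in> Arr C \<Longrightarrow> Cod C g = Dom C f \<Longrightarrow> f \<cdot> g \<in> S"
  using cover_sieve unfolding sieve_def by blast

lemma cover_max: "c \<in> Ob C \<Longrightarrow> {f \<in> Arr C. Cod C f = c} \<in> J c"
  using topology unfolding grothendieck_topology_def by blast

lemma cover_pull: "h \<in> Arr C \<Longrightarrow> S \<in> J (Cod C h) \<Longrightarrow> pull_sieve C h S \<in> J (Dom C h)"
  using topology unfolding grothendieck_topology_def by blast

lemma cover_trans:
  "c \<in> Ob C \<Longrightarrow> S \<in> J c \<Longrightarrow> sieve C c R \<Longrightarrow> (\<And>f. f \<in> S \<Longrightarrow> pull_sieve C f R \<in> J (Dom C f)) \<Longrightarrow> R \<in> J c"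
  using topology unfolding grothendieck_topology_def by blast

lemma sieve_pull: "h \<in> Arr C \<Longrightarrow> sieve C (Cod C h) S \<Longrightarrow> sieve C (Dom C h) (pull_sieve C h S)"
  unfolding sieve_def pull_sieve_def by (auto simp flip: Comp_assoc)

lemma cover_upward:
  assumes "c \<in> Ob C" "S \<in> J c" "sieve C c R" "S \<subseteq> R"
  shows "R \<in> J c"
proof (rule cover_trans[OF assms(1-3)])
  fix f assume f: "f \<in> S"
  then have "pull_sieve C f R = {g \<in> Arr C. Cod C g = Dom C f}"
    using assms unfolding pull_sieve_def sieve_def by blast
  then show "pull_sieve C f R \<in> J (Dom C f)"
    using cover_max[of "Dom C f"] cover_arr[OF assms(1,2) f] by simp
qed

lemma cover_Int:
  assumes "c \<in> Ob C" "S \<in> J c" "T \<in> J c"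
  shows "S \<inter> T \<in> J c"
proof (rule cover_trans[OF assms(1,2)])
  show "sieve C c (S \<inter> T)"
    using cover_sieve[OF assms(1,2)] cover_sieve[OF assms(1,3)] unfolding sieve_def by blast
next
  fix f assume f: "f \<in> S"
  have "pull_sieve C f (S \<inter> T) = pull_sieve C f T"
    using cover_comp[OF assms(1,2) f] unfolding pull_sieve_def by blast
  then show "pull_sieve C f (S \<inter> T) \<in> J (Dom C f)"
    using cover_pull cover_arr[OF assms(1,2) f] assms(3) by auto
qed

lemma locally_mono:
  assumes "locally J c Q" "c \<in> Ob C" "\<And>f. f \<in> Arr C \<Longrightarrow> Cod C f = c \<Longrightarrow> Q f \<Longrightarrow> Q' f"
  shows "locally J c Q'"
proof -
  obtain S where "S \<in> J c" "\<forall>f\<in>S. Q f"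
    using assms(1) unfolding locally_def by blast
  then show ?thesis
    unfolding locally_def using cover_arr[OF assms(2)] assms(3) by (intro bexI[of _ S]) auto
qed

lemma locally_everywhere:
  assumes "c \<in> Ob C" "\<And>f. f \<in> Arr C \<Longrightarrow> Cod C f = c \<Longrightarrow> Q f"
  shows "locally J c Q"
  unfolding locally_def using assms cover_max by (intro bexI[of _ "{f \<in> Arr C. Cod C f = c}"]) auto

lemma locally_conj:
  assumes "locally J c Q" "locally J c Q'" "c \<in> Ob C"
  shows "locally J c (\<lambda>f. Q f \<and> Q' f)"
proof -
  obtain S T where "S \<in> J c" "\<forall>f\<in>S. Q f" "T \<in> J c" "\<forall>f\<in>T. Q' f"
    using assms(1,2) unfolding locally_def by blast
  then show ?thesis
    unfolding locally_def using cover_Int[OF assms(3)] by (intro bexI[of _ "S \<inter> T"]) auto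
qed

lemma locally_pull:
  assumes "locally J (Cod C h) Q" "h \<in> Arr C"
  shows "locally J (Dom C h) (\<lambda>g. Q (h \<cdot> g))"
proof -
  obtain S where S: "S \<in> J (Cod C h)" "\<forall>f\<in>S. Q f"
    using assms(1) unfolding locally_def by blast
  then show ?thesis
    unfolding locally_def using cover_pull[OF assms(2) S(1)]
    by (intro bexI[of _ "pull_sieve C h S"]) (auto simp: pull_sieve_def)
qed

lemma locally_pull':
  assumes "locally J c Q" "h \<in> Arr C" "Cod C h = c" "Dom C h = d"
  shows "locally J d (\<lambda>g. Q (h \<cdot> g))"
  using assms locally_pull by blast

text \<open>The transitivity axiom of a topology: what holds locally on each member of a cover holds
  locally.\<close>

lemma locally_bind:
  assumes "locally J c Q" "c \<in> Ob C"
    and *: "\<And>f. f \<in> Arr C \<Longrightarrow> Cod C f = c \<Longrightarrow> Q f \<Longrightarrow> locally J (Dom C f) (\<lambda>g. Q' (f \<cdot> g))"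
  shows "locally J c Q'"
proof -
  obtain S where S: "S \<in> J c" "\<And>f. f \<in> S \<Longrightarrow> Q f"
    using assms(1) unfolding locally_def by blast
  have "\<forall>f\<in>S. \<exists>T. T \<in> J (Dom C f) \<and> (\<forall>g\<in>T. Q' (f \<cdot> g))"
    using * S cover_arr[OF assms(2) S(1)] unfolding locally_def by blast
  then obtain T where T: "\<And>f. f \<in> S \<Longrightarrow> T f \<in> J (Dom C f)"
      "\<And>f g. f \<in> S \<Longrightarrow> g \<in> T f \<Longrightarrow> Q' (f \<cdot> g)"
    by metis
  define R where "R = {f \<cdot> g | f g. f \<in> S \<and> g \<in> T f}"
  have S_arr: "f \<in> Arr C \<and> Cod C f = c" if "f \<in> S" for f
    using cover_arr[OF assms(2) S(1) that] .
  have T_arr: "g \<in> Arr C \<and> Cod C g = Dom C f" if "f \<in> S" "g \<in> T f" for f g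
    using cover_arr[OF _ T(1)[OF that(1)] that(2)] S_arr[OF that(1)] by simp
  have sR: "sieve C c R"
    unfolding sieve_def
  proof (intro conjI ballI subsetI impI)
    fix r assume "r \<in> R"
    then obtain f g where r: "r = f \<cdot> g" "f \<in> S" "g \<in> T f"
      unfolding R_def by blast
    show "r \<in> Arr C" "Cod C r = c"
      using r S_arr T_arr by auto
    fix k assume k: "k \<in> Arr C" "Cod C k = Dom C r"
    have "g \<cdot> k \<in> T f"
      using cover_comp[OF _ T(1)[OF r(2)] r(3)] k r S_arr T_arr by simp
    moreover have "r \<cdot> k = f \<cdot> (g \<cdot> k)"
      using r k S_arr T_arr by (simp add: Comp_assoc)
    ultimately show "r \<cdot> k \<in> R"
      unfolding R_def using r(2) by blast
  qed
  have "R \<in> J c"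
  proof (rule cover_trans[OF assms(2) S(1) sR])
    fix f assume f: "f \<in> S"
    have "T f \<subseteq> pull_sieve C f R"
      unfolding pull_sieve_def R_def using f T_arr by blast
    moreover have "sieve C (Dom C f) (pull_sieve C f R)"
      using sieve_pull S_arr[OF f] sR by simp
    ultimately show "pull_sieve C f R \<in> J (Dom C f)"
      using cover_upward[OF _ T(1)[OF f]] S_arr[OF f] by simp
  qed
  moreover have "\<forall>r\<in>R. Q' r"
    unfolding R_def using T(2) by blast
  ultimately show ?thesis
    unfolding locally_def by blast
qed

section \<open>Gluing\<close>

lemma sheaf_separated:
  assumes "sheaf C J P" "c \<in> Ob C" "x \<in> Sec P c" "y \<in> Sec P c"
    and "locally J c (\<lambda>f. Rst P f x = Rst P f y)"
  shows "x = y"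
proof -
  obtain S where S: "S \<in> J c" "\<And>f. f \<in> S \<Longrightarrow> Rst P f x = Rst P f y"
    using assms(5) unfolding locally_def by blast
  have pre: "presheaf C P"
    using assms(1) unfolding sheaf_def by blast
  have "matching_family C P S (\<lambda>f. Rst P f x)"
    unfolding matching_family_def
    using cover_arr[OF assms(2) S(1)] presheaf_closed[OF pre] presheaf_Comp[OF pre] assms(3)
    by metis
  then have "\<exists>!t. t \<in> Sec P c \<and> (\<forall>f\<in>S. Rst P f t = Rst P f x)"
    using assms(1,2) S(1) unfolding sheaf_def by blast
  then show ?thesis
    using assms(3,4) S(2) by metis
qed

text \<open>A section may be prescribed by a single-valued relation that is stable under restriction and
  locally total; no choice of a covering sieve or of representatives is involved.\<close>

lemma sheaf_glue:
  assumes "sheaf C J P" "c \<in> Ob C"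
    and sec: "\<And>f t. f \<in> Arr C \<Longrightarrow> Cod C f = c \<Longrightarrow> V f t \<Longrightarrow> t \<in> Sec P (Dom C f)"
    and single: "\<And>f t t'. f \<in> Arr C \<Longrightarrow> Cod C f = c \<Longrightarrow> V f t \<Longrightarrow> V f t' \<Longrightarrow> t = t'"
    and stable: "\<And>f g t. f \<in> Arr C \<Longrightarrow> Cod C f = c \<Longrightarrow> g \<in> Arr C \<Longrightarrow> Cod C g = Dom C f \<Longrightarrow> V f t \<Longrightarrow>
      V (f \<cdot> g) (Rst P g t)"
    and total: "locally J c (\<lambda>f. \<exists>t. V f t)"
  obtains x where "x \<in> Sec P c" "\<And>f t. f \<in> Arr C \<Longrightarrow> Cod C f = c \<Longrightarrow> V f t \<Longrightarrow> Rst P f x = t"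
proof -
  have pre: "presheaf C P"
    using assms(1) unfolding sheaf_def by blast
  obtain S where S: "S \<in> J c" "\<And>f. f \<in> S \<Longrightarrow> \<exists>t. V f t"
    using total unfolding locally_def by blast
  have S_arr: "f \<in> Arr C \<and> Cod C f = c" if "f \<in> S" for f
    using cover_arr[OF assms(2) S(1) that] .
  obtain v where v: "\<And>f. f \<in> S \<Longrightarrow> V f (v f)"
    using S(2) by metis
  have "matching_family C P S v"
    unfolding matching_family_def
  proof (intro ballI conjI impI)
    fix f assume f: "f \<in> S"
    show "v f \<in> Sec P (Dom C f)"
      using sec v f S_arr by blast
    fix g assume g: "g \<in> Arr C" "Cod C g = Dom C f"
    have "f \<cdot> g \<in> S"
      using cover_comp[OF assms(2) S(1) f g] .
    then show "v (f \<cdot> g) = Rst P g (v f)"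
      using single[of "f \<cdot> g"] stable[of f g "v f"] v f g S_arr by blast
  qed
  then obtain x where x: "x \<in> Sec P c" "\<And>f. f \<in> S \<Longrightarrow> Rst P f x = v f"
    using assms(1,2) S(1) unfolding sheaf_def by blast
  have "Rst P f x = t" if f: "f \<in> Arr C" "Cod C f = c" "V f t" for f t
  proof (rule sheaf_separated[OF assms(1)])
    show "Dom C f \<in> Ob C" "Rst P f x \<in> Sec P (Dom C f)" "t \<in> Sec P (Dom C f)"
      using f x(1) sec presheaf_closed[OF pre] by auto
    have "locally J c (\<lambda>f. f \<in> S)"
      using S(1) unfolding locally_def by blast
    then have "locally J (Dom C f) (\<lambda>g. f \<cdot> g \<in> S)"
      using f by (intro locally_pull'[where h=f]) auto
    then show "locally J (Dom C f) (\<lambda>g. Rst P g (Rst P f x) = Rst P g t)"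
    proof (rule locally_mono)
      fix g assume g: "g \<in> Arr C" "Cod C g = Dom C f" "f \<cdot> g \<in> S"
      have "Rst P g (Rst P f x) = Rst P (f \<cdot> g) x"
        using presheaf_Comp[OF pre] f g x(1) by auto
      also have "\<dots> = Rst P g t"
        using x(2)[OF g(3)] v[OF g(3)] stable[OF f(1,2) g(1,2) f(3)] single[of "f \<cdot> g"] f g by auto
      finally show "Rst P g (Rst P f x) = Rst P g t" .
    qed (use f in auto)
  qed
  then show thesis
    using x(1) that by blast
qed

lemma sheafI:
  assumes "presheaf C P"
    and sep: "\<And>c x y. c \<in> Ob C \<Longrightarrow> x \<in> Sec P c \<Longrightarrow> y \<in> Sec P c \<Longrightarrow>
      locally J c (\<lambda>f. Rst P f x = Rst P f y) \<Longrightarrow> x = y"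
    and glue: "\<And>c S x. c \<in> Ob C \<Longrightarrow> S \<in> J c \<Longrightarrow> matching_family C P S x \<Longrightarrow>
      \<exists>t\<in>Sec P c. \<forall>f\<in>S. Rst P f t = x f"
  shows "sheaf C J P"
  unfolding sheaf_def
proof (intro conjI ballI allI impI assms(1))
  fix c S x assume c: "c \<in> Ob C" "S \<in> J c" "matching_family C P S x"
  obtain t where t: "t \<in> Sec P c" "\<forall>f\<in>S. Rst P f t = x f"
    using glue[OF c] by blast
  moreover have "t' = t" if "t' \<in> Sec P c" "\<forall>f\<in>S. Rst P f t' = x f" for t'
    by (rule sep[OF c(1) that(1) t(1)]) (use c(2) that(2) t(2)
      in \<open>auto simp: locally_def intro!: bexI[of _ S]\<close>)
  ultimately show "\<exists>!t. t \<in> Sec P c \<and> (\<forall>f\<in>S. Rst P f t = x f)"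
    by blast
qed

text \<open>The same principle for transformations: prescribing the values on a locally generating part,
  consistently and compatibly with restriction, defines one. Both sheafification and the
  subcanonicity of the topology on the topos are instances.\<close>

lemma glue_nat_trans:
  assumes "presheaf C P" "sheaf C J Q"
    and sec: "\<And>d y t. d \<in> Ob C \<Longrightarrow> y \<in> Sec P d \<Longrightarrow> V d y t \<Longrightarrow> t \<in> Sec Q d"
    and single: "\<And>d y t t'. d \<in> Ob C \<Longrightarrow> y \<in> Sec P d \<Longrightarrow> V d y t \<Longrightarrow> V d y t' \<Longrightarrow> t = t'"
    and stable: "\<And>f y t. f \<in> Arr C \<Longrightarrow> y \<in> Sec P (Cod C f) \<Longrightarrow> V (Cod C f) y t \<Longrightarrow>
      V (Dom C f) (Rst P f y) (Rst Q f t)"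
    and total: "\<And>c x. c \<in> Ob C \<Longrightarrow> x \<in> Sec P c \<Longrightarrow> locally J c (\<lambda>f. \<exists>t. V (Dom C f) (Rst P f x) t)"
  obtains \<alpha> where "nat_trans C P Q \<alpha>" "\<And>d y t. d \<in> Ob C \<Longrightarrow> y \<in> Sec P d \<Longrightarrow> V d y t \<Longrightarrow> \<alpha> d y = t"
proof -
  have preQ: "presheaf C Q"
    using assms(2) unfolding sheaf_def by blast
  have "\<exists>v. v \<in> Sec Q c \<and> (\<forall>f t. f \<in> Arr C \<and> Cod C f = c \<and>
    V (Dom C f) (Rst P f x) t \<longrightarrow> Rst Q f v = t)"
    if x: "c \<in> Ob C" "x \<in> Sec P c" for c x
  proof -
    obtain v where "v \<in> Sec Q c"
      "\<And>f t. f \<in> Arr C \<Longrightarrow> Cod C f = c \<Longrightarrow> V (Dom C f) (Rst P f x) t \<Longrightarrow> Rst Q f v = t"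
    proof (rule sheaf_glue[OF assms(2) x(1), of "\<lambda>f t. V (Dom C f) (Rst P f x) t"])
      fix f assume f: "f \<in> Arr C" "Cod C f = c"
      have xf: "Rst P f x \<in> Sec P (Dom C f)"
        using presheaf_closed[OF assms(1)] f x by blast
      show "t \<in> Sec Q (Dom C f)" if "V (Dom C f) (Rst P f x) t" for t
        using sec that xf f by auto
      show "t = t'" if "V (Dom C f) (Rst P f x) t" "V (Dom C f) (Rst P f x) t'" for t t'
        using single[OF _ xf that] f by auto
      show "V (Dom C (f \<cdot> g)) (Rst P (f \<cdot> g) x) (Rst Q g t)"
        if "g \<in> Arr C" "Cod C g = Dom C f" "V (Dom C f) (Rst P f x) t" for g t
        using stable[of g "Rst P f x" t] that f x xf presheaf_Comp[OF assms(1)] by auto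
    qed (use total x in auto)
    then show ?thesis by blast
  qed
  then obtain \<alpha> where \<alpha>: "\<And>c x. c \<in> Ob C \<Longrightarrow> x \<in> Sec P c \<Longrightarrow> \<alpha> c x \<in> Sec Q c"
      "\<And>c x f t. c \<in> Ob C \<Longrightarrow> x \<in> Sec P c \<Longrightarrow> f \<in> Arr C \<Longrightarrow> Cod C f = c \<Longrightarrow> V (Dom C f) (Rst P f x) t \<Longrightarrow>
        Rst Q f (\<alpha> c x) = t"
    by metis
  have val: "\<alpha> d y = t" if "d \<in> Ob C" "y \<in> Sec P d" "V d y t" for d y t
    using \<alpha>(2)[of d y "Id C d" t] \<alpha>(1)[of d y] that presheaf_Id[OF assms(1)] presheaf_Id[OF preQ]
    by auto
  have "nat_trans C P Q \<alpha>"
    unfolding nat_trans_def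
  proof (intro conjI ballI)
    fix f x assume f: "f \<in> Arr C" and x: "x \<in> Sec P (Cod C f)"
    have xf: "Rst P f x \<in> Sec P (Dom C f)"
      using presheaf_closed[OF assms(1)] f x by blast
    show "\<alpha> (Dom C f) (Rst P f x) = Rst Q f (\<alpha> (Cod C f) x)"
    proof (rule sheaf_separated[OF assms(2)])
      show "locally J (Dom C f) (\<lambda>g. Rst Q g (\<alpha> (Dom C f) (Rst P f x))
        = Rst Q g (Rst Q f (\<alpha> (Cod C f) x)))"
      proof (rule locally_mono[OF total[of "Dom C f" "Rst P f x"]])
        fix g assume g: "g \<in> Arr C" "Cod C g = Dom C f" "\<exists>t. V (Dom C g) (Rst P g (Rst P f x)) t"
        then obtain t where t: "V (Dom C g) (Rst P g (Rst P f x)) t" by blast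
        have "Rst Q g (\<alpha> (Dom C f) (Rst P f x)) = t"
          using \<alpha>(2)[of "Dom C f" "Rst P f x" g t] xf f g t by auto
        moreover have "Rst Q (f \<cdot> g) (\<alpha> (Cod C f) x) = t"
          using \<alpha>(2)[of "Cod C f" x "f \<cdot> g" t] f g x t presheaf_Comp[OF assms(1)] by auto
        moreover have "Rst Q (f \<cdot> g) (\<alpha> (Cod C f) x) = Rst Q g (Rst Q f (\<alpha> (Cod C f) x))"
          using f g x \<alpha>(1) by (intro presheaf_Comp[OF preQ]) auto
        ultimately show "Rst Q g (\<alpha> (Dom C f) (Rst P f x)) = Rst Q g (Rst Q f (\<alpha> (Cod C f) x))"
          by simp
      qed (use f xf in auto)
    qed (use f x xf \<alpha>(1) presheaf_closed[OF preQ] in auto)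
  qed (use \<alpha>(1) in auto)
  then show thesis
    using val that by blast
qed

text \<open>The corresponding uniqueness principle.\<close>

lemma nat_trans_eqI:
  assumes "presheaf C P" "sheaf C J Q" "nat_trans C P Q \<alpha>" "nat_trans C P Q \<beta>"
    and "locally J c (\<lambda>f. \<alpha> (Dom C f) (Rst P f x) = \<beta> (Dom C f) (Rst P f x))"
    and x: "c \<in> Ob C" "x \<in> Sec P c"
  shows "\<alpha> c x = \<beta> c x"
proof (rule sheaf_separated[OF assms(2) x(1)])
  show "locally J c (\<lambda>f. Rst Q f (\<alpha> c x) = Rst Q f (\<beta> c x))"
    using assms(5) x(1)
    by (rule locally_mono) (use x nat_trans_natural[OF assms(3)] nat_trans_natural[OF assms(4)]
      in auto)
qed (use x nat_trans_closed[OF assms(3)] nat_trans_closed[OF assms(4)] in auto)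

end

section \<open>Replacing a sheaf by an isomorphic one\<close>

lemma nat_trans_inverse:
  assumes "nat_trans C P Q \<phi>" "category C" "presheaf C P"
    and bij: "\<And>c. c \<in> Ob C \<Longrightarrow> bij_betw (\<phi> c) (Sec P c) (Sec Q c)"
  shows "nat_trans C Q P (\<lambda>c. inv_into (Sec P c) (\<phi> c))"
  unfolding nat_trans_def
proof (intro conjI ballI Pi_I)
  interpret category C by fact
  fix c y assume "c \<in> Ob C" "y \<in> Sec Q c"
  then show "inv_into (Sec P c) (\<phi> c) y \<in> Sec P c"
    using bij bij_betw_imp_surj_on inv_into_into by metis
next
  interpret category C by fact
  fix f y assume f: "f \<in> Arr C" and y: "y \<in> Sec Q (Cod C f)"
  obtain x where x: "x \<in> Sec P (Cod C f)" "y = \<phi> (Cod C f) x"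
    using bij[of "Cod C f"] y f by (auto simp: bij_betw_def)
  then have "Rst Q f y = \<phi> (Dom C f) (Rst P f x)"
    using nat_trans_natural[OF assms(1) f x(1)] by simp
  then show "inv_into (Sec P (Dom C f)) (\<phi> (Dom C f)) (Rst Q f y)
      = Rst P f (inv_into (Sec P (Cod C f)) (\<phi> (Cod C f)) y)"
    using x f bij_betw_inv_into_left[OF bij] presheaf_closed[OF assms(3)] by simp
qed

context site
begin

lemma presheaf_transport:
  assumes "presheaf C P" "nat_trans C P Q \<phi>"
    and bij: "\<And>c. c \<in> Ob C \<Longrightarrow> bij_betw (\<phi> c) (Sec P c) (Sec Q c)"
  shows "presheaf C Q"
proof -
  have pre: "\<exists>x\<in>Sec P c. y = \<phi> c x" if "c \<in> Ob C" "y \<in> Sec Q c" for c y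
    using bij[OF that(1)] that(2) by (auto simp: bij_betw_def)
  note nat = nat_trans_natural[OF assms(2), symmetric] and cl = nat_trans_closed[OF assms(2)]
  note P = presheaf_closed[OF assms(1)] presheaf_Id[OF assms(1)] presheaf_Comp[OF assms(1)]
  show ?thesis
    unfolding presheaf_def
  proof (intro conjI ballI impI Pi_I)
    fix f y assume f: "f \<in> Arr C" and "y \<in> Sec Q (Cod C f)"
    then obtain x where "x \<in> Sec P (Cod C f)" "y = \<phi> (Cod C f) x"
      using pre[of "Cod C f" y] by auto
    then show "Rst Q f y \<in> Sec Q (Dom C f)"
      using f nat P cl by simp
  next
    fix c y assume c: "c \<in> Ob C" and "y \<in> Sec Q c"
    then obtain x where "x \<in> Sec P c" "y = \<phi> c x"
      using pre[of c y] by auto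
    then show "Rst Q (Id C c) y = y"
      using c nat[of "Id C c" x] P by simp
  next
    fix f g y assume fg: "f \<in> Arr C" "g \<in> Arr C" "Cod C g = Dom C f" and "y \<in> Sec Q (Cod C f)"
    then obtain x where x: "x \<in> Sec P (Cod C f)" "y = \<phi> (Cod C f) x"
      using pre[of "Cod C f" y] by auto
    then show "Rst Q (f \<cdot> g) y = Rst Q g (Rst Q f y)"
      using fg nat[of f x] nat[of g "Rst P f x"] nat[of "f \<cdot> g" x] P by simp
  qed
qed

lemma sheaf_transport:
  assumes "sheaf C J P" "nat_trans C P Q \<phi>"
    and bij: "\<And>c. c \<in> Ob C \<Longrightarrow> bij_betw (\<phi> c) (Sec P c) (Sec Q c)"
  shows "sheaf C J Q"
proof (rule sheafI)
  have preP: "presheaf C P"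
    using assms(1) unfolding sheaf_def by blast
  show preQ: "presheaf C Q"
    using presheaf_transport[OF preP assms(2) bij] .
  define \<psi> where "\<psi> = (\<lambda>c. inv_into (Sec P c) (\<phi> c))"
  have \<psi>: "nat_trans C Q P \<psi>"
    unfolding \<psi>_def using nat_trans_inverse[OF assms(2) category_axioms preP bij] .
  have \<phi>\<psi>: "\<phi> c (\<psi> c y) = y" if "c \<in> Ob C" "y \<in> Sec Q c" for c y
    unfolding \<psi>_def using bij_betw_inv_into_right[OF bij] that by blast
  show "x = y" if c: "c \<in> Ob C" and xy: "x \<in> Sec Q c" "y \<in> Sec Q c"
      and loc: "locally J c (\<lambda>f. Rst Q f x = Rst Q f y)" for c x y
  proof -
    have "\<psi> c x = \<psi> c y"
    proof (rule sheaf_separated[OF assms(1) c])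
      show "locally J c (\<lambda>f. Rst P f (\<psi> c x) = Rst P f (\<psi> c y))"
        by (rule locally_mono[OF loc c]) (use xy nat_trans_natural[OF \<psi>, symmetric] in auto)
    qed (use c xy nat_trans_closed[OF \<psi>] in auto)
    then show ?thesis
      using \<phi>\<psi> c xy by metis
  qed
  show "\<exists>t\<in>Sec Q c. \<forall>f\<in>S. Rst Q f t = x f"
    if c: "c \<in> Ob C" and S: "S \<in> J c" and x: "matching_family C Q S x" for c S x
  proof -
    have S_arr: "f \<in> Arr C" "Cod C f = c" "x f \<in> Sec Q (Dom C f)" if "f \<in> S" for f
      using cover_arr[OF c S that] x that unfolding matching_family_def by auto
    have "matching_family C P S (\<lambda>f. \<psi> (Dom C f) (x f))"
      unfolding matching_family_def
    proof (intro conjI ballI impI)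
      fix f assume f: "f \<in> S"
      show "\<psi> (Dom C f) (x f) \<in> Sec P (Dom C f)"
        using S_arr[OF f] nat_trans_closed[OF \<psi>] by simp
      fix g assume g: "g \<in> Arr C" "Cod C g = Dom C f"
      then have "x (f \<cdot> g) = Rst Q g (x f)"
        using x f unfolding matching_family_def by blast
      then show "\<psi> (Dom C (f \<cdot> g)) (x (f \<cdot> g)) = Rst P g (\<psi> (Dom C f) (x f))"
        using S_arr[OF f] g nat_trans_natural[OF \<psi>, of g "x f"] by simp
    qed
    then obtain t where t: "t \<in> Sec P c" "\<And>f. f \<in> S \<Longrightarrow> Rst P f t = \<psi> (Dom C f) (x f)"
      using assms(1) c S unfolding sheaf_def by blast
    have "Rst Q f (\<phi> c t) = x f" if "f \<in> S" for f
      using nat_trans_natural[OF assms(2), of f t] t S_arr[OF that] \<phi>\<psi> that by simp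
    then show ?thesis
      using nat_trans_closed[OF assms(2) c t(1)] by blast
  qed
qed

end

text \<open>A presheaf with values in \<open>'u\<close> becomes an object of the topos once its data outside their
  domains are forgotten.\<close>

definition normalise :: "('o, 'a) cat \<Rightarrow> ('o, 'a, 's) psh \<Rightarrow> ('o, 'a, 's) psh" where
  "normalise C P = \<lparr>Sec = restrict (Sec P) (Ob C),
     Rst = (\<lambda>f\<in>Arr C. restrict (Rst P f) (Sec P (Cod C f)))\<rparr>"

context site
begin

lemma Sec_normalise [simp]: "c \<in> Ob C \<Longrightarrow> Sec (normalise C P) c = Sec P c"
  and Rst_normalise [simp]:
    "f \<in> Arr C \<Longrightarrow> x \<in> Sec P (Cod C f) \<Longrightarrow> Rst (normalise C P) f x = Rst P f x"
  by (simp_all add: normalise_def)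

lemma normalise_object:
  fixes P :: "('o, 'a, 'u) psh"
  assumes "sheaf C J P" "\<And>c. c \<in> Ob C \<Longrightarrow> small TYPE('u) (Sec P c)"
  shows "normalise C P \<in> sh_objects C J"
proof -
  have "sheaf C J (normalise C P)"
    by (rule sheaf_transport[OF assms(1), where \<phi> = "\<lambda>c x. x"])
      (auto simp: nat_trans_def bij_betw_def inj_on_def)
  then show ?thesis
    using assms(2) by (auto simp: sh_objects_def) (auto simp: normalise_def)
qed

text \<open>The sections of an object of the topos are elements of \<open>'u\<close>, whereas the constructions below
  produce sets, pairs and relations. Any sheaf with small sections can be encoded.\<close>

lemma object_representing:
  fixes P :: "('o, 'a, 's) psh"
  assumes "sheaf C J P" "\<And>c. c \<in> Ob C \<Longrightarrow> small TYPE('u) (Sec P c)"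
  obtains F :: "('o, 'a, 'u) psh" and \<phi> where "F \<in> sh_objects C J" "nat_trans C P F \<phi>"
    "\<And>c. c \<in> Ob C \<Longrightarrow> bij_betw (\<phi> c) (Sec P c) (Sec F c)"
proof -
  have preP: "presheaf C P"
    using assms(1) unfolding sheaf_def by blast
  have "\<forall>c\<in>Ob C. \<exists>g :: 's \<Rightarrow> 'u. inj_on g (Sec P c)"
    using small_embedding[OF assms(2)] by metis
  then obtain \<epsilon> :: "'o \<Rightarrow> 's \<Rightarrow> 'u" where \<epsilon>: "\<And>c. c \<in> Ob C \<Longrightarrow> inj_on (\<epsilon> c) (Sec P c)"
    by metis
  define Q where "Q = \<lparr>Sec = (\<lambda>c. \<epsilon> c ` Sec P c),
    Rst = (\<lambda>f y. \<epsilon> (Dom C f) (Rst P f (inv_into (Sec P (Cod C f)) (\<epsilon> (Cod C f)) y)))\<rparr>"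
  have nat: "nat_trans C P Q \<epsilon>"
    using \<epsilon> by (auto simp: nat_trans_def Q_def)
  have bij: "bij_betw (\<epsilon> c) (Sec P c) (Sec Q c)" if "c \<in> Ob C" for c
    using \<epsilon>[OF that] by (auto simp: bij_betw_def Q_def)
  have "sheaf C J Q"
    by (rule sheaf_transport[OF assms(1) nat bij])
  moreover have "small TYPE('u) (Sec Q c)" if "c \<in> Ob C" for c
    using small_image[OF assms(2)[OF that]] by (simp add: Q_def)
  ultimately have "normalise C Q \<in> sh_objects C J"
    by (rule normalise_object)
  moreover have "nat_trans C P (normalise C Q) \<epsilon>"
    unfolding nat_trans_def
    using nat_trans_closed[OF nat] nat_trans_natural[OF nat] by auto
  ultimately show thesis
    using bij that by simp
qed

end

section \<open>The sheaf of germ relations\<close>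

text \<open>A section of the associated sheaf is a family of sections of \<open>P\<close> given locally and up to local
  equality. Taking all the pairs \<open>(f, x)\<close> such that \<open>x\<close> may serve as its value along \<open>f\<close> turns the
  equivalence class of such families into a single saturated relation, so that the associated sheaf
  is obtained in one step and without quotients.\<close>

definition germ_relation ::
    "('o, 'a) cat \<Rightarrow> ('o \<Rightarrow> 'a set set) \<Rightarrow> ('o, 'a, 's) psh \<Rightarrow> 'o \<Rightarrow> ('a \<times> 's) set \<Rightarrow> bool" where
  "germ_relation C J P c R \<longleftrightarrow>
     (\<forall>f x. (f, x) \<in> R \<longrightarrow> f \<in> Arr C \<and> Cod C f = c \<and> x \<in> Sec P (Dom C f)) \<and>
     (\<forall>f x g. (f, x) \<in> R \<and> g \<in> Arr C \<and> Cod C g = Dom C f \<longrightarrow> (f \<cdot>\<^bsub>C\<^esub> g, Rst P g x) \<in> R) \<and>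
     (\<forall>f x y. (f, x) \<in> R \<and> (f, y) \<in> R \<longrightarrow> locally J (Dom C f) (\<lambda>g. Rst P g x = Rst P g y)) \<and>
     locally J c (\<lambda>f. \<exists>x. (f, x) \<in> R) \<and>
     (\<forall>f x. f \<in> Arr C \<and> Cod C f = c \<and> x \<in> Sec P (Dom C f) \<and>
        locally J (Dom C f) (\<lambda>g. (f \<cdot>\<^bsub>C\<^esub> g, Rst P g x) \<in> R) \<longrightarrow> (f, x) \<in> R)"

definition germs ::
    "('o, 'a) cat \<Rightarrow> ('o \<Rightarrow> 'a set set) \<Rightarrow> ('o, 'a, 's) psh \<Rightarrow> ('o, 'a, ('a \<times> 's) set) psh" where
  "germs C J P = \<lparr>Sec = (\<lambda>c. {R. germ_relation C J P c R}),
     Rst = (\<lambda>h R. {(g, x). g \<in> Arr C \<and> Cod C g = Dom C h \<and> (h \<cdot>\<^bsub>C\<^esub> g, x) \<in> R})\<rparr>"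

definition germ_of ::
    "('o, 'a) cat \<Rightarrow> ('o \<Rightarrow> 'a set set) \<Rightarrow> ('o, 'a, 's) psh \<Rightarrow> 'o \<Rightarrow> 's \<Rightarrow> ('a \<times> 's) set" where
  "germ_of C J P c x = {(f, y). f \<in> Arr C \<and> Cod C f = c \<and> y \<in> Sec P (Dom C f) \<and>
     locally J (Dom C f) (\<lambda>g. Rst P g y = Rst P (f \<cdot>\<^bsub>C\<^esub> g) x)}"

context site
begin

context
  fixes P :: "('o, 'a, 's) psh"
  assumes P: "presheaf C P"
begin

lemma germ_arr:
  "germ_relation C J P c R \<Longrightarrow> (f, x) \<in> R \<Longrightarrow> f \<in> Arr C \<and> Cod C f = c \<and> x \<in> Sec P (Dom C f)"
  unfolding germ_relation_def by blast

lemma germ_stable: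
  "germ_relation C J P c R \<Longrightarrow> (f, x) \<in> R \<Longrightarrow> g \<in> Arr C \<Longrightarrow> Cod C g = Dom C f \<Longrightarrow>
    (f \<cdot> g, Rst P g x) \<in> R"
  unfolding germ_relation_def by blast

lemma germ_single:
  "germ_relation C J P c R \<Longrightarrow> (f, x) \<in> R \<Longrightarrow> (f, y) \<in> R \<Longrightarrow>
    locally J (Dom C f) (\<lambda>g. Rst P g x = Rst P g y)"
  unfolding germ_relation_def by blast

lemma germ_total: "germ_relation C J P c R \<Longrightarrow> locally J c (\<lambda>f. \<exists>x. (f, x) \<in> R)"
  unfolding germ_relation_def by blast

lemma germ_saturated:
  "germ_relation C J P c R \<Longrightarrow> f \<in> Arr C \<Longrightarrow> Cod C f = c \<Longrightarrow> x \<in> Sec P (Dom C f) \<Longrightarrow>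
    locally J (Dom C f) (\<lambda>g. (f \<cdot> g, Rst P g x) \<in> R) \<Longrightarrow> (f, x) \<in> R"
  unfolding germ_relation_def by blast

lemma germ_restrict:
  assumes R: "germ_relation C J P (Cod C h) R" and h: "h \<in> Arr C"
  shows "germ_relation C J P (Dom C h) (Rst (germs C J P) h R)"
  unfolding germ_relation_def
proof (intro conjI allI impI)
  let ?R = "Rst (germs C J P) h R"
  have iff: "(g, x) \<in> ?R \<longleftrightarrow> g \<in> Arr C \<and> Cod C g = Dom C h \<and> (h \<cdot> g, x) \<in> R" for g x
    by (simp add: germs_def)
  show "f \<in> Arr C" "Cod C f = Dom C h" "x \<in> Sec P (Dom C f)" if "(f, x) \<in> ?R" for f x
    using that germ_arr[OF R, of "h \<cdot> f" x] h by (auto simp: iff)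
  show "(f \<cdot> g, Rst P g x) \<in> ?R" if "(f, x) \<in> ?R \<and> g \<in> Arr C \<and> Cod C g = Dom C f" for f x g
    using that germ_stable[OF R, of "h \<cdot> f" x g] h by (simp add: iff Comp_assoc)
  show "locally J (Dom C f) (\<lambda>g. Rst P g x = Rst P g y)" if "(f, x) \<in> ?R \<and> (f, y) \<in> ?R" for f x y
    using that germ_single[OF R, of "h \<cdot> f" x y] h by (auto simp: iff)
  show "locally J (Dom C h) (\<lambda>f. \<exists>x. (f, x) \<in> ?R)"
    by (rule locally_mono[OF locally_pull[OF germ_total[OF R] h]]) (use h in \<open>auto simp: iff\<close>)
  show "(f, x) \<in> ?R" if *: "f \<in> Arr C \<and> Cod C f = Dom C h \<and> x \<in> Sec P (Dom C f) \<and>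
      locally J (Dom C f) (\<lambda>g. (f \<cdot> g, Rst P g x) \<in> ?R)" for f x
  proof -
    have "locally J (Dom C f) (\<lambda>g. (h \<cdot> f \<cdot> g, Rst P g x) \<in> R)"
      using * by (elim conjE locally_mono) (use h in \<open>auto simp: iff Comp_assoc\<close>)
    then show ?thesis
      using germ_saturated[OF R, of "h \<cdot> f" x] * h by (simp add: iff)
  qed
qed

lemma germ_of_relation:
  assumes c: "c \<in> Ob C" and x: "x \<in> Sec P c"
  shows "germ_relation C J P c (germ_of C J P c x)"
  unfolding germ_relation_def
proof (intro conjI allI impI)
  let ?R = "germ_of C J P c x"
  have iff: "(f, y) \<in> ?R \<longleftrightarrow> f \<in> Arr C \<and> Cod C f = c \<and> y \<in> Sec P (Dom C f) \<and>
     locally J (Dom C f) (\<lambda>g. Rst P g y = Rst P (f \<cdot> g) x)" for f y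
    by (simp add: germ_of_def)
  show "f \<in> Arr C" "Cod C f = c" "y \<in> Sec P (Dom C f)" if "(f, y) \<in> ?R" for f y
    using that by (auto simp: iff)
  show "(f \<cdot> g, Rst P g y) \<in> ?R" if *: "(f, y) \<in> ?R \<and> g \<in> Arr C \<and> Cod C g = Dom C f" for f y g
  proof -
    have "locally J (Dom C g) (\<lambda>k. Rst P (g \<cdot> k) y = Rst P (f \<cdot> (g \<cdot> k)) x)"
      by (rule locally_pull'[of "Cod C g"]) (use * in \<open>auto simp: iff\<close>)
    then have "locally J (Dom C g) (\<lambda>k. Rst P k (Rst P g y) = Rst P (f \<cdot> g \<cdot> k) x)"
      by (rule locally_mono) (use * presheaf_Comp[OF P] in \<open>auto simp: iff Comp_assoc\<close>)
    then show ?thesis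
      using * presheaf_closed[OF P, of g y] by (simp add: iff)
  qed
  show "locally J (Dom C f) (\<lambda>g. Rst P g y = Rst P g z)" if "(f, y) \<in> ?R \<and> (f, z) \<in> ?R" for f y z
  proof -
    have "locally J (Dom C f) (\<lambda>g. Rst P g y = Rst P (f \<cdot> g) x \<and> Rst P g z = Rst P (f \<cdot> g) x)"
      using that by (intro locally_conj) (auto simp: iff)
    then show ?thesis
      by (rule locally_mono) (use that in \<open>auto simp: iff\<close>)
  qed
  show "locally J c (\<lambda>f. \<exists>y. (f, y) \<in> ?R)"
  proof (rule locally_everywhere[OF c])
    fix f assume f: "f \<in> Arr C" "Cod C f = c"
    have "locally J (Dom C f) (\<lambda>g. Rst P g (Rst P f x) = Rst P (f \<cdot> g) x)"
      by (rule locally_everywhere) (use f x presheaf_Comp[OF P] in auto)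
    then show "\<exists>y. (f, y) \<in> ?R"
      using f x presheaf_closed[OF P, of f x] unfolding iff by blast
  qed
  show "(f, y) \<in> ?R" if *: "f \<in> Arr C \<and> Cod C f = c \<and> y \<in> Sec P (Dom C f) \<and>
      locally J (Dom C f) (\<lambda>g. (f \<cdot> g, Rst P g y) \<in> ?R)" for f y
  proof -
    have "locally J (Dom C f) (\<lambda>g. Rst P g y = Rst P (f \<cdot> g) x)"
    proof (rule locally_bind)
      show "locally J (Dom C f) (\<lambda>g. (f \<cdot> g, Rst P g y) \<in> ?R)"
        using * by blast
      fix g assume g: "g \<in> Arr C" "Cod C g = Dom C f" "(f \<cdot> g, Rst P g y) \<in> ?R"
      then have "locally J (Dom C g) (\<lambda>k. Rst P k (Rst P g y) = Rst P (f \<cdot> g \<cdot> k) x)"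
        using * by (simp add: iff)
      then show "locally J (Dom C g) (\<lambda>k. Rst P (g \<cdot> k) y = Rst P (f \<cdot> (g \<cdot> k)) x)"
        by (rule locally_mono) (use * g presheaf_Comp[OF P] in \<open>auto simp: Comp_assoc\<close>)
    qed (use * in auto)
    then show ?thesis
      using * by (simp add: iff)
  qed
qed

text \<open>Along an arrow where a germ relation has the value \<open>x\<close>, it is the germ of \<open>x\<close>: any other value
  there agrees locally with \<open>x\<close> by single-valuedness, and saturation gives the converse.\<close>

lemma germ_restrict_eq_germ_of:
  assumes R: "germ_relation C J P c R" and fx: "(f, x) \<in> R"
  shows "Rst (germs C J P) f R = germ_of C J P (Dom C f) x"
proof (intro equalityI subrelI)
  note f = germ_arr[OF R fx, THEN conjunct1] germ_arr[OF R fx, THEN conjunct2, THEN conjunct1]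
    germ_arr[OF R fx, THEN conjunct2, THEN conjunct2]
  {
    fix g y assume "(g, y) \<in> Rst (germs C J P) f R"
    then have g: "g \<in> Arr C" "Cod C g = Dom C f" "(f \<cdot> g, y) \<in> R"
      by (simp_all add: germs_def)
    have "locally J (Dom C (f \<cdot> g)) (\<lambda>k. Rst P k y = Rst P k (Rst P g x))"
      using germ_single[OF R g(3) germ_stable[OF R fx g(1,2)]] .
    then have "locally J (Dom C g) (\<lambda>k. Rst P k y = Rst P (g \<cdot> k) x)"
      using f g by (auto elim!: locally_mono simp: presheaf_Comp[OF P])
    then show "(g, y) \<in> germ_of C J P (Dom C f) x"
      using f g germ_arr[OF R g(3)] by (simp add: germ_of_def)
  next
    fix g y assume "(g, y) \<in> germ_of C J P (Dom C f) x"
    then have g: "g \<in> Arr C" "Cod C g = Dom C f" "y \<in> Sec P (Dom C g)"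
        "locally J (Dom C g) (\<lambda>k. Rst P k y = Rst P (g \<cdot> k) x)"
      by (simp_all add: germ_of_def)
    have "locally J (Dom C (f \<cdot> g)) (\<lambda>k. (f \<cdot> g \<cdot> k, Rst P k y) \<in> R)"
      using g(4) f g germ_stable[OF R fx]
      by (auto elim!: locally_mono simp: Comp_assoc)
    then have "(f \<cdot> g, y) \<in> R"
      using f g by (intro germ_saturated[OF R]) auto
    then show "(g, y) \<in> Rst (germs C J P) f R"
      using f g by (simp add: germs_def)
  }
qed

lemma germ_of_restrict:
  assumes f: "f \<in> Arr C" and x: "x \<in> Sec P (Cod C f)"
  shows "Rst (germs C J P) f (germ_of C J P (Cod C f) x) = germ_of C J P (Dom C f) (Rst P f x)"
proof (rule germ_restrict_eq_germ_of)
  show "germ_relation C J P (Cod C f) (germ_of C J P (Cod C f) x)"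
    using f x by (simp add: germ_of_relation)
  have "locally J (Dom C f) (\<lambda>g. Rst P g (Rst P f x) = Rst P (f \<cdot> g) x)"
    by (rule locally_everywhere) (use f x presheaf_Comp[OF P] in auto)
  then show "(f, Rst P f x) \<in> germ_of C J P (Cod C f) x"
    using f x presheaf_closed[OF P] by (simp add: germ_of_def)
qed

lemma germ_of_locally_injective:
  assumes c: "c \<in> Ob C" and xy: "x \<in> Sec P c" "y \<in> Sec P c"
    and eq: "germ_of C J P c x = germ_of C J P c y"
  shows "locally J c (\<lambda>f. Rst P f x = Rst P f y)"
proof -
  have "locally J c (\<lambda>g. Rst P g x = Rst P (Id C c \<cdot> g) x)"
    by (rule locally_everywhere[OF c]) (use c in auto)
  then have "(Id C c, x) \<in> germ_of C J P c x"
    using c xy by (simp add: germ_of_def)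
  then have "locally J c (\<lambda>g. Rst P g x = Rst P (Id C c \<cdot> g) y)"
    using c unfolding eq by (simp add: germ_of_def)
  then show ?thesis
    by (rule locally_mono) (use c in auto)
qed

lemma germ_of_locally_surjective:
  assumes R: "germ_relation C J P c R" and c: "c \<in> Ob C"
  shows "locally J c (\<lambda>f. \<exists>x\<in>Sec P (Dom C f). Rst (germs C J P) f R = germ_of C J P (Dom C f) x)"
proof (rule locally_mono[OF germ_total[OF R] c])
  fix f assume "\<exists>x. (f, x) \<in> R"
  then obtain x where "(f, x) \<in> R" ..
  then show "\<exists>x\<in>Sec P (Dom C f). Rst (germs C J P) f R = germ_of C J P (Dom C f) x"
    using germ_restrict_eq_germ_of[OF R] germ_arr[OF R] by (intro bexI[of _ x]) simp_all
qed

lemma presheaf_germs: "presheaf C (germs C J P)"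
  unfolding presheaf_def
proof (intro conjI ballI impI Pi_I)
  fix f R assume "f \<in> Arr C" "R \<in> Sec (germs C J P) (Cod C f)"
  then show "Rst (germs C J P) f R \<in> Sec (germs C J P) (Dom C f)"
    using germ_restrict by (simp add: germs_def)
next
  fix c R assume c: "c \<in> Ob C" and "R \<in> Sec (germs C J P) c"
  then have "germ_relation C J P c R"
    by (simp add: germs_def)
  then have "(g, x) \<in> R \<longleftrightarrow> g \<in> Arr C \<and> Cod C g = c \<and> (Id C c \<cdot> g, x) \<in> R" for g x
    using germ_arr[of c R g x] by (metis Comp_Id(1))
  then have "{(g, x). g \<in> Arr C \<and> Cod C g = c \<and> (Id C c \<cdot> g, x) \<in> R} = R"
    by blast
  then show "Rst (germs C J P) (Id C c) R = R"
    using c by (simp add: germs_def)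
next
  fix f g R assume "f \<in> Arr C" "g \<in> Arr C" "Cod C g = Dom C f" "R \<in> Sec (germs C J P) (Cod C f)"
  then show "Rst (germs C J P) (f \<cdot> g) R = Rst (germs C J P) g (Rst (germs C J P) f R)"
    by (auto simp: germs_def Comp_assoc)
qed

lemma germs_eqI:
  assumes R: "germ_relation C J P c R" and R': "germ_relation C J P c R'" and c: "c \<in> Ob C"
    and loc: "locally J c (\<lambda>f. \<forall>x. (f, x) \<in> R \<longrightarrow> (f, x) \<in> R')"
  shows "R \<subseteq> R'"
proof clarify
  fix f x assume fx: "(f, x) \<in> R"
  note f = germ_arr[OF R fx]
  have "locally J (Dom C f) (\<lambda>g. \<forall>x. (f \<cdot> g, x) \<in> R \<longrightarrow> (f \<cdot> g, x) \<in> R')"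
    using locally_pull'[OF loc] f by blast
  then have "locally J (Dom C f) (\<lambda>g. (f \<cdot> g, Rst P g x) \<in> R')"
    by (rule locally_mono) (use f germ_stable[OF R fx] in auto)
  then show "(f, x) \<in> R'"
    using germ_saturated[OF R'] f by blast
qed

lemma germ_restrict_subset:
  assumes R: "germ_relation C J P c R" and f: "(f, x) \<in> R"
    and eq: "Rst (germs C J P) f R = Rst (germs C J P) f R'"
  shows "(f, x) \<in> R'"
proof -
  have f': "f \<in> Arr C" "Cod C f = c"
    using germ_arr[OF R f] by auto
  then have "(Id C (Dom C f), x) \<in> Rst (germs C J P) f R"
    using f by (simp add: germs_def)
  then show ?thesis
    using f' unfolding eq by (simp add: germs_def)
qed

text \<open>Given a matching family \<open>\<rho>\<close> of germ relations on \<open>S\<close>, an element \<open>x\<close> of \<open>P\<close> is a value along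
  \<open>f \<in> S\<close> (\<open>val f x\<close> in the proof) if the relation \<open>\<rho> f\<close> relates the identity to \<open>x\<close>. The glued
  relation consists of the pairs that become values locally.\<close>

lemma sheaf_germs: "sheaf C J (germs C J P)"
proof (rule sheafI[OF presheaf_germs])
  fix c R R' assume c: "c \<in> Ob C" and "R \<in> Sec (germs C J P) c" "R' \<in> Sec (germs C J P) c"
    and loc: "locally J c (\<lambda>f. Rst (germs C J P) f R = Rst (germs C J P) f R')"
  then have R: "germ_relation C J P c R" "germ_relation C J P c R'"
    by (simp_all add: germs_def)
  show "R = R'"
  proof (rule equalityI)
    show "R \<subseteq> R'"
      by (rule germs_eqI[OF R c locally_mono[OF loc c]]) (use germ_restrict_subset[OF R(1)]
        in blast)
    show "R' \<subseteq> R"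
      by (rule germs_eqI[OF R(2,1) c locally_mono[OF loc c]])
        (use germ_restrict_subset[OF R(2)] in blast)
  qed
next
  fix c S \<rho> assume c: "c \<in> Ob C" and S: "S \<in> J c" and \<rho>: "matching_family C (germs C J P) S \<rho>"
  have S_arr: "f \<in> Arr C" "Cod C f = c" "germ_relation C J P (Dom C f) (\<rho> f)" if "f \<in> S" for f
    using that cover_arr[OF c S that] \<rho> by (auto simp: matching_family_def germs_def)
  have \<rho>_comp: "f \<cdot> g \<in> S \<and> ((h, x) \<in> \<rho> (f \<cdot> g) \<longleftrightarrow> h \<in> Arr C \<and> Cod C h = Dom C g \<and> (g \<cdot> h, x) \<in> \<rho> f)"
    if "f \<in> S" "g \<in> Arr C" "Cod C g = Dom C f" for f g h x
    using \<rho> that cover_comp[OF c S] by (simp add: matching_family_def germs_def)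
  define val where "val f x \<longleftrightarrow> f \<in> S \<and> (Id C (Dom C f), x) \<in> \<rho> f" for f x
  have val_comp: "val (f \<cdot> g) x \<longleftrightarrow> (g, x) \<in> \<rho> f" if "f \<in> S" "g \<in> Arr C" "Cod C g = Dom C f" for f g x
    using \<rho>_comp[OF that] that S_arr by (simp add: val_def)
  have val_stable: "val (f \<cdot> g) (Rst P g x)" if "val f x" "g \<in> Arr C" "Cod C g = Dom C f" for f g x
    using that val_comp[of f g "Rst P g x"] S_arr[of f]
      germ_stable[of "Dom C f" "\<rho> f" "Id C (Dom C f)" x g]
    by (simp add: val_def)
  have val_saturated: "val f x"
    if "f \<in> S" "x \<in> Sec P (Dom C f)" "locally J (Dom C f) (\<lambda>g. val (f \<cdot> g) (Rst P g x))" for f x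
  proof -
    have "locally J (Dom C f) (\<lambda>g. (Id C (Dom C f) \<cdot> g, Rst P g x) \<in> \<rho> f)"
      using that(3) by (rule locally_mono) (use that S_arr val_comp in auto)
    then show ?thesis
      using germ_saturated[of "Dom C f" "\<rho> f" "Id C (Dom C f)" x] that S_arr by (simp add: val_def)
  qed
  define R where "R = {(g, x). g \<in> Arr C \<and> Cod C g = c \<and> x \<in> Sec P (Dom C g) \<and>
    locally J (Dom C g) (\<lambda>k. val (g \<cdot> k) (Rst P k x))}"
  have locS: "locally J c (\<lambda>f. f \<in> S)"
    using S by (auto simp: locally_def)
  have R_on_S: "(f, x) \<in> R \<longleftrightarrow> x \<in> Sec P (Dom C f) \<and> val f x" if "f \<in> S" for f x
  proof
    assume "(f, x) \<in> R"
    then show "x \<in> Sec P (Dom C f) \<and> val f x"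
      using val_saturated that by (simp add: R_def)
  next
    assume x: "x \<in> Sec P (Dom C f) \<and> val f x"
    have "locally J (Dom C f) (\<lambda>k. val (f \<cdot> k) (Rst P k x))"
      by (rule locally_everywhere) (use x that S_arr val_stable in auto)
    then show "(f, x) \<in> R"
      using x that S_arr by (simp add: R_def)
  qed
  have "germ_relation C J P c R"
    unfolding germ_relation_def
  proof (intro conjI allI impI)
    show "g \<in> Arr C" "Cod C g = c" "x \<in> Sec P (Dom C g)" if "(g, x) \<in> R" for g x
      using that by (auto simp: R_def)
    show "(g \<cdot> h, Rst P h x) \<in> R" if *: "(g, x) \<in> R \<and> h \<in> Arr C \<and> Cod C h = Dom C g" for g x h
    proof -
      have "locally J (Dom C h) (\<lambda>k. val (g \<cdot> (h \<cdot> k)) (Rst P (h \<cdot> k) x))"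
        by (rule locally_pull'[of "Cod C h"]) (use * in \<open>auto simp: R_def\<close>)
      then have "locally J (Dom C h) (\<lambda>k. val (g \<cdot> h \<cdot> k) (Rst P k (Rst P h x)))"
        by (rule locally_mono) (use * in \<open>auto simp: R_def Comp_assoc presheaf_Comp[OF P]\<close>)
      then show ?thesis
        using * presheaf_closed[OF P, of h x] by (simp add: R_def)
    qed
    show "locally J (Dom C g) (\<lambda>h. Rst P h x = Rst P h y)" if *: "(g, x) \<in> R \<and> (g, y) \<in> R" for g x y
    proof (rule locally_bind)
      show "locally J (Dom C g) (\<lambda>k. val (g \<cdot> k) (Rst P k x) \<and> val (g \<cdot> k) (Rst P k y))"
        using * by (intro locally_conj) (auto simp: R_def)
      fix k assume k: "k \<in> Arr C" "Cod C k = Dom C g" "val (g \<cdot> k) (Rst P k x) \<and>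
        val (g \<cdot> k) (Rst P k y)"
      then have "locally J (Dom C k) (\<lambda>h. Rst P h (Rst P k x) = Rst P h (Rst P k y))"
        using * S_arr[of "g \<cdot> k"] germ_single[of "Dom C (g \<cdot> k)" "\<rho> (g \<cdot> k)" "Id C (Dom C (g \<cdot> k))"]
        by (auto simp: val_def R_def)
      then show "locally J (Dom C k) (\<lambda>h. Rst P (k \<cdot> h) x = Rst P (k \<cdot> h) y)"
        by (rule locally_mono) (use * k in \<open>auto simp: R_def presheaf_Comp[OF P]\<close>)
    qed (use * in \<open>auto simp: R_def\<close>)
    show "locally J c (\<lambda>f. \<exists>x. (f, x) \<in> R)"
    proof (rule locally_bind[OF locS c])
      fix f assume f: "f \<in> Arr C" "Cod C f = c" "f \<in> S"
      show "locally J (Dom C f) (\<lambda>g. \<exists>x. (f \<cdot> g, x) \<in> R)"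
      proof (rule locally_mono[OF germ_total[OF S_arr(3)[OF f(3)]]])
        fix g assume g: "g \<in> Arr C" "Cod C g = Dom C f" "\<exists>x. (g, x) \<in> \<rho> f"
        then obtain x where x: "(g, x) \<in> \<rho> f" by blast
        then have "(f \<cdot> g, x) \<in> R"
          using R_on_S[of "f \<cdot> g" x] \<rho>_comp[OF f(3) g(1,2)] val_comp[OF f(3) g(1,2)] f g
            germ_arr[OF S_arr(3)[OF f(3)] x]
          by simp
        then show "\<exists>x. (f \<cdot> g, x) \<in> R" ..
      qed (use f in auto)
    qed
    show "(g, x) \<in> R" if *: "g \<in> Arr C \<and> Cod C g = c \<and> x \<in> Sec P (Dom C g) \<and>
        locally J (Dom C g) (\<lambda>h. (g \<cdot> h, Rst P h x) \<in> R)" for g x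
    proof -
      have "locally J (Dom C g) (\<lambda>k. val (g \<cdot> k) (Rst P k x))"
      proof (rule locally_bind)
        show "locally J (Dom C g) (\<lambda>h. (g \<cdot> h, Rst P h x) \<in> R)"
          using * by blast
        fix h assume h: "h \<in> Arr C" "Cod C h = Dom C g" "(g \<cdot> h, Rst P h x) \<in> R"
        then have "locally J (Dom C h) (\<lambda>k. val (g \<cdot> h \<cdot> k) (Rst P k (Rst P h x)))"
          using * by (simp add: R_def)
        then show "locally J (Dom C h) (\<lambda>k. val (g \<cdot> (h \<cdot> k)) (Rst P (h \<cdot> k) x))"
          by (rule locally_mono) (use * h in \<open>auto simp: presheaf_Comp[OF P] Comp_assoc\<close>)
      qed (use * in auto)
      then show ?thesis
        using * by (simp add: R_def)
    qed
  qed
  moreover have "Rst (germs C J P) f R = \<rho> f" if f: "f \<in> S" for f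
  proof -
    have "(g, x) \<in> Rst (germs C J P) f R \<longleftrightarrow> (g, x) \<in> \<rho> f" for g x
      using R_on_S[of "f \<cdot> g" x] \<rho>_comp[OF f, of g] val_comp[OF f, of g x] S_arr[OF f]
        germ_arr[OF S_arr(3)[OF f], of g x]
      by (auto simp: germs_def)
    then show ?thesis
      by auto
  qed
  moreover have "R \<in> Sec (germs C J P) c" if "germ_relation C J P c R"
    using that by (simp add: germs_def)
  ultimately show "\<exists>R\<in>Sec (germs C J P) c. \<forall>f\<in>S. Rst (germs C J P) f R = \<rho> f"
    by blast
qed

end

end

section \<open>The category of sheaves\<close>

lemma Sh_simps [simp]:
  "Ob (Sh C J) = sh_objects C J" "Arr (Sh C J) = sh_arrows C J"
  by (simp_all add: Sh_def)

lemma sheaf_object: "F \<in> sh_objects C J \<Longrightarrow> sheaf C J F"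
  and small_object:
    "(F :: ('o, 'a, 'u) psh) \<in> sh_objects C J \<Longrightarrow> c \<in> Ob C \<Longrightarrow> small TYPE('u) (Sec F c)"
  by (simp_all add: sh_objects_def)

lemma presheaf_object: "F \<in> sh_objects C J \<Longrightarrow> presheaf C F"
  using sheaf_object unfolding sheaf_def by blast

lemma arrow_nat_trans:
  "s \<in> sh_arrows C J \<Longrightarrow> nat_trans C (Dom (Sh C J) s) (Cod (Sh C J) s) (component s)"
  by (auto simp: sh_arrows_def Sh_def)

lemma arrow_Dom: "s \<in> sh_arrows C J \<Longrightarrow> Dom (Sh C J) s \<in> sh_objects C J"
  and arrow_Cod: "s \<in> sh_arrows C J \<Longrightarrow> Cod (Sh C J) s \<in> sh_objects C J"
  by (auto simp: sh_arrows_def Sh_def)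

lemma arrow_closed:
  "s \<in> sh_arrows C J \<Longrightarrow> c \<in> Ob C \<Longrightarrow> x \<in> Sec (Dom (Sh C J) s) c \<Longrightarrow>
    component s c x \<in> Sec (Cod (Sh C J) s) c"
  using nat_trans_closed[OF arrow_nat_trans] .

lemma arrow_natural:
  "s \<in> sh_arrows C J \<Longrightarrow> f \<in> Arr C \<Longrightarrow> x \<in> Sec (Dom (Sh C J) s) (Cod C f) \<Longrightarrow>
    component s (Dom C f) (Rst (Dom (Sh C J) s) f x)
      = Rst (Cod (Sh C J) s) f (component s (Cod C f) x)"
  using nat_trans_natural[OF arrow_nat_trans] .

lemma Hom_Sh:
  assumes "s \<in> Hom (Sh C J) F G"
  shows "s \<in> sh_arrows C J" "Dom (Sh C J) s = F" "Cod (Sh C J) s = G"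
    "F \<in> sh_objects C J" "G \<in> sh_objects C J" "nat_trans C F G (component s)"
  using assms arrow_Dom[of s C J] arrow_Cod[of s C J] arrow_nat_trans[of s C J]
  by (auto simp: Hom_def)

lemma arrow_eqI:
  assumes "s \<in> sh_arrows C J" "t \<in> sh_arrows C J"
    and "Dom (Sh C J) s = Dom (Sh C J) t" "Cod (Sh C J) s = Cod (Sh C J) t"
    and "\<And>c x. c \<in> Ob C \<Longrightarrow> x \<in> Sec (Dom (Sh C J) s) c \<Longrightarrow> component s c x = component t c x"
  shows "s = t"
proof -
  have "component s c = component t c" if "c \<in> Ob C" for c
    using assms that by (intro extensionalityI[where A = "Sec (fst s) c"])
      (auto simp: sh_arrows_def Sh_def)
  then have "component s = component t"
    using assms by (intro extensionalityI[where A = "Ob C"]) (auto simp: sh_arrows_def)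
  then show ?thesis
    using assms(3,4) by (simp add: Sh_def prod_eq_iff)
qed

definition sh_arrow ::
    "('o, 'a) cat \<Rightarrow> ('o, 'a, 'u) psh \<Rightarrow> ('o, 'a, 'u) psh \<Rightarrow> ('o \<Rightarrow> 'u \<Rightarrow> 'u) \<Rightarrow>
      ('o, 'a, 'u) sh_arr" where
  "sh_arrow C F G \<alpha> = (F, (\<lambda>c\<in>Ob C. \<lambda>x\<in>Sec F c. \<alpha> c x), G)"

lemma component_sh_arrow [simp]:
  "c \<in> Ob C \<Longrightarrow> x \<in> Sec F c \<Longrightarrow> component (sh_arrow C F G \<alpha>) c x = \<alpha> c x"
  by (simp add: sh_arrow_def)

lemma sh_arrow_Hom:
  assumes "category C" "F \<in> sh_objects C J" "G \<in> sh_objects C J" "nat_trans C F G \<alpha>"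
  shows "sh_arrow C F G \<alpha> \<in> Hom (Sh C J) F G"
proof -
  interpret category C by fact
  show ?thesis
    using assms presheaf_closed[OF presheaf_object[OF assms(2)]]
    by (auto simp: sh_arrow_def Hom_def sh_arrows_def nat_trans_def)
      (auto simp: Sh_def)
qed

lemma component_Comp:
  assumes "c \<in> Ob C" "x \<in> Sec (Dom (Sh C J) s) c"
  shows "component (t \<cdot>\<^bsub>Sh C J\<^esub> s) c x = component t c (component s c x)"
  using assms by (simp add: Sh_def compose_def)

lemma component_Id:
  "c \<in> Ob C \<Longrightarrow> x \<in> Sec F c \<Longrightarrow> component (Id (Sh C J) F) c x = x"
  by (simp add: Sh_def)

lemma category_Sh:
  assumes "category C"
  shows "category (Sh C J)"
proof -
  interpret category C by fact
  have comp: "g \<cdot>\<^bsub>Sh C J\<^esub> f \<in> Hom (Sh C J) x z" if f: "f \<in> Hom (Sh C J) x y"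
    and g: "g \<in> Hom (Sh C J) y z"
    for f g x y z
  proof -
    have "nat_trans C x y (component f)" "nat_trans C y z (component g)"
      "x \<in> sh_objects C J" "z \<in> sh_objects C J"
      using Hom_Sh[OF f] Hom_Sh[OF g] by auto
    then have "sh_arrow C x z (\<lambda>c y. component g c (component f c y)) \<in> Hom (Sh C J) x z"
      by (intro sh_arrow_Hom[OF assms]) (auto simp: nat_trans_def Pi_iff)
    also have "sh_arrow C x z (\<lambda>c y. component g c (component f c y)) = g \<cdot>\<^bsub>Sh C J\<^esub> f"
      using f g by (auto simp: sh_arrow_def Sh_def Hom_def compose_def)
    finally show ?thesis .
  qed
  have id: "Id (Sh C J) F \<in> Hom (Sh C J) F F" if "F \<in> sh_objects C J" for F
  proof -
    have "sh_arrow C F F (\<lambda>c x. x) \<in> Hom (Sh C J) F F"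
      using that by (intro sh_arrow_Hom[OF assms]) (auto simp: nat_trans_def)
    then show ?thesis
      by (simp add: sh_arrow_def Sh_def)
  qed
  show ?thesis
  proof
    show "Id (Sh C J) F \<in> Hom (Sh C J) F F" if "F \<in> Ob (Sh C J)" for F
      using id that by simp
    show "g \<cdot>\<^bsub>Sh C J\<^esub> f \<in> Hom (Sh C J) x z" if "f \<in> Hom (Sh C J) x y"
      "g \<in> Hom (Sh C J) y z" for f g x y z
      using comp that by blast
    show "Id (Sh C J) y \<cdot>\<^bsub>Sh C J\<^esub> f = f" if f: "f \<in> Hom (Sh C J) x y" for f x y
    proof -
      have "y \<in> sh_objects C J"
        using Hom_Sh[OF f] by auto
      from comp[OF f id[OF this]] show ?thesis
        using f arrow_closed[of f C J]
        by (intro arrow_eqI[of _ C J]) (auto simp: Hom_def component_Comp component_Id)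
    qed
    show "f \<cdot>\<^bsub>Sh C J\<^esub> Id (Sh C J) x = f" if f: "f \<in> Hom (Sh C J) x y" for f x y
    proof -
      have x: "x \<in> sh_objects C J"
        using Hom_Sh[OF f] by auto
      from comp[OF id[OF this] f] show ?thesis
        using f id[OF x] arrow_closed[of f C J]
        by (intro arrow_eqI[of _ C J]) (auto simp: Hom_def component_Comp component_Id)
    qed
    show "h \<cdot>\<^bsub>Sh C J\<^esub> (g \<cdot>\<^bsub>Sh C J\<^esub> f) = (h \<cdot>\<^bsub>Sh C J\<^esub> g) \<cdot>\<^bsub>Sh C J\<^esub> f"
      if fgh: "f \<in> Hom (Sh C J) w x" "g \<in> Hom (Sh C J) x y" "h \<in> Hom (Sh C J) y z" for f g h w x y z
      using comp[OF comp[OF fgh(1,2)] fgh(3)] comp[OF fgh(1) comp[OF fgh(2,3)]] comp[OF fgh(1,2)]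
        fgh
        arrow_closed[of f C J]
      by (intro arrow_eqI[of _ C J]) (auto simp: Hom_def component_Comp)
  qed (auto simp: arrow_Dom arrow_Cod)
qed

section \<open>Sheafification\<close>

context site
begin

text \<open>A map to a sheaf that is locally injective and locally surjective is a sheafification: the
  value of the extension at a section of \<open>F\<close> is forced locally, where the section comes from \<open>P\<close>.\<close>

lemma sheafificationI:
  fixes F :: "('o, 'a, 'u) psh"
  assumes P: "presheaf C P" and F: "F \<in> sh_objects C J" and \<eta>: "nat_trans C P F \<eta>"
    and inj: "\<And>c x y. c \<in> Ob C \<Longrightarrow> x \<in> Sec P c \<Longrightarrow> y \<in> Sec P c \<Longrightarrow> \<eta> c x = \<eta> c y \<Longrightarrow>
      locally J c (\<lambda>f. Rst P f x = Rst P f y)"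
    and surj: "\<And>c x. c \<in> Ob C \<Longrightarrow> x \<in> Sec F c \<Longrightarrow>
      locally J c (\<lambda>f. \<exists>y\<in>Sec P (Dom C f). Rst F f x = \<eta> (Dom C f) y)"
  shows "sheafification C J P F \<eta>"
  unfolding sheafification_def
proof (intro conjI ballI allI impI)
  show "F \<in> Ob (Sh C J)" "nat_trans C P F \<eta>"
    using F \<eta> by auto
  fix G :: "('o, 'a, 'u) psh" and \<alpha>
  assume "G \<in> Ob (Sh C J)" and \<alpha>: "nat_trans C P G \<alpha>"
  then have G: "G \<in> sh_objects C J"
    by simp
  define V where "V d r t \<longleftrightarrow> (\<exists>y\<in>Sec P d. r = \<eta> d y \<and> t = \<alpha> d y)" for d r t
  obtain \<beta> where \<beta>: "nat_trans C F G \<beta>"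
    "\<And>d r t. d \<in> Ob C \<Longrightarrow> r \<in> Sec F d \<Longrightarrow> V d r t \<Longrightarrow> \<beta> d r = t"
  proof (rule glue_nat_trans[OF presheaf_object[OF F] sheaf_object[OF G], of V])
    show "t \<in> Sec G d" if "d \<in> Ob C" "V d r t" for d r t
      using that nat_trans_closed[OF \<alpha>] by (auto simp: V_def)
    show "t = t'" if d: "d \<in> Ob C" and v: "V d r t" "V d r t'" for d r t t'
    proof -
      obtain y y' where y: "y \<in> Sec P d" "y' \<in> Sec P d" "\<eta> d y = \<eta> d y'" "t = \<alpha> d y" "t' = \<alpha> d y'"
        using v unfolding V_def by metis
      show ?thesis
      proof (rule sheaf_separated[OF sheaf_object[OF G] d])
        show "locally J d (\<lambda>f. Rst G f t = Rst G f t')"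
          by (rule locally_mono[OF inj[OF d y(1-3)] d])
            (use y nat_trans_natural[OF \<alpha>, symmetric] in auto)
      qed (use y d nat_trans_closed[OF \<alpha>] in auto)
    qed
    show "V (Dom C f) (Rst F f r) (Rst G f t)" if "f \<in> Arr C" "V (Cod C f) r t" for f r t
      using that nat_trans_natural[OF \<eta>] nat_trans_natural[OF \<alpha>] presheaf_closed[OF P]
      unfolding V_def by metis
    show "locally J c (\<lambda>f. \<exists>t. V (Dom C f) (Rst F f x) t)" if "c \<in> Ob C" "x \<in> Sec F c" for c x
      by (rule locally_mono[OF surj[OF that] that(1)]) (auto simp: V_def)
  qed blast
  have \<beta>\<eta>: "\<beta> d (\<eta> d x) = \<alpha> d x" if "d \<in> Ob C" "x \<in> Sec P d" for d x
    using \<beta>(2)[of d "\<eta> d x" "\<alpha> d x"] that nat_trans_closed[OF \<eta>] by (auto simp: V_def)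
  show "\<exists>!s. s \<in> Hom (Sh C J) F G \<and> (\<forall>d\<in>Ob C. \<forall>x\<in>Sec P d. component s d (\<eta> d x) = \<alpha> d x)"
  proof (rule ex1I[of _ "sh_arrow C F G \<beta>"])
    show *: "sh_arrow C F G \<beta> \<in> Hom (Sh C J) F G \<and>
        (\<forall>d\<in>Ob C. \<forall>x\<in>Sec P d. component (sh_arrow C F G \<beta>) d (\<eta> d x) = \<alpha> d x)"
      using sh_arrow_Hom[OF category_axioms F G \<beta>(1)] \<beta>\<eta> nat_trans_closed[OF \<eta>] by simp
    fix s assume s: "s \<in> Hom (Sh C J) F G \<and> (\<forall>d\<in>Ob C. \<forall>x\<in>Sec P d. component s d (\<eta> d x) = \<alpha> d x)"
    then have sFG: "s \<in> sh_arrows C J" "Dom (Sh C J) s = F" "Cod (Sh C J) s = G"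
      by (auto simp: Hom_def)
    show "s = sh_arrow C F G \<beta>"
    proof (rule arrow_eqI[OF sFG(1)])
      fix c x assume c: "c \<in> Ob C" and "x \<in> Sec (Dom (Sh C J) s) c"
      then have x: "x \<in> Sec F c"
        using sFG by simp
      have "component s c x = \<beta> c x"
      proof (rule nat_trans_eqI[OF presheaf_object[OF F] sheaf_object[OF G] _ \<beta>(1) _ c x])
        show "nat_trans C F G (component s)"
          using arrow_nat_trans[OF sFG(1)] sFG by simp
        show "locally J c (\<lambda>f. component s (Dom C f) (Rst F f x) = \<beta> (Dom C f) (Rst F f x))"
          by (rule locally_mono[OF surj[OF c x] c]) (use s \<beta>\<eta> in auto)
      qed
      then show "component s c x = component (sh_arrow C F G \<beta>) c x"
        using c x by simp
    qed (use * sFG in \<open>auto simp: Hom_def\<close>)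
  qed
qed

end

locale small_site = site C J for C :: "('o, 'a) cat" (structure) and J +
  fixes U :: "'u itself" and D :: "'o set"
  assumes universe: "universe TYPE('u)"
    and locally_small: "locally_small TYPE('u) C"
    and small_D: "small TYPE('u) D"
    and dense: "J_dense C J D"
begin

abbreviation through_D :: "'o \<Rightarrow> 'a \<Rightarrow> bool" where
  "through_D c f \<equiv> \<exists>r g. f = r \<cdot> g \<and> r \<in> Arr C \<and> Cod C r = c \<and> Dom C r \<in> D \<and>
     g \<in> Arr C \<and> Cod C g = Dom C r"

lemma locally_dense:
  assumes "c \<in> Ob C"
  shows "locally J c (through_D c)"
proof -
  obtain R where R: "R \<subseteq> {f \<in> Arr C. Dom C f \<in> D \<and> Cod C f = c}" "gen_sieve C R \<in> J c"
    using dense assms unfolding J_dense_def by blast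
  show ?thesis
    unfolding locally_def by (rule bexI[OF _ R(2)]) (use R(1) in \<open>auto simp: gen_sieve_def\<close>)
qed

lemma D_Ob: "d \<in> D \<Longrightarrow> d \<in> Ob C"
  using dense unfolding J_dense_def by blast

text \<open>A germ relation is determined by the pairs over the objects of the small dense \<open>D\<close>.\<close>

lemma small_germs:
  assumes P: "presheaf C P" and small_P: "\<And>c. c \<in> Ob C \<Longrightarrow> small TYPE('u) (Sec P c)" and c: "c \<in> Ob C"
  shows "small TYPE('u) (Sec (germs C J P) c)"
proof -
  let ?H = "snd ` (SIGMA d:D. Hom C d c)"
  let ?B = "SIGMA f:?H. Sec P (Dom C f)"
  have "small TYPE('u) (SIGMA d:D. Hom C d c)"
    using locally_small c D_Ob by (intro small_Sigma[OF universe small_D]) (auto simp: locally_small_def)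
  then have "small TYPE('u) ?H"
    by (rule small_image)
  then have "small TYPE('u) ?B"
    using small_P D_Ob by (intro small_Sigma[OF universe]) (auto simp: Hom_def)
  then have "small TYPE('u) (Pow ?B)"
    by (rule small_Pow[OF universe])
  moreover have "inj_on (\<lambda>R. R \<inter> ?B) (Sec (germs C J P) c)"
  proof (rule inj_onI)
    fix R R' assume "R \<in> Sec (germs C J P) c" "R' \<in> Sec (germs C J P) c"
      and eq: "R \<inter> ?B = R' \<inter> ?B"
    then have R: "germ_relation C J P c R" "germ_relation C J P c R'"
      by (simp_all add: germs_def)
    have sub: "R1 \<subseteq> R2" if R1: "germ_relation C J P c R1" and R2: "germ_relation C J P c R2"
      and eq: "R1 \<inter> ?B = R2 \<inter> ?B" for R1 R2
    proof clarify
      fix f x assume fx: "(f, x) \<in> R1"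
      have f: "f \<in> Arr C" "Cod C f = c" "x \<in> Sec P (Dom C f)"
        using germ_arr[OF P R1 fx] by auto
      show "(f, x) \<in> R2"
      proof (rule germ_saturated[OF P R2 f])
        show "locally J (Dom C f) (\<lambda>g. (f \<cdot> g, Rst P g x) \<in> R2)"
        proof (rule locally_mono[OF locally_dense])
          fix h assume "through_D (Dom C f) h"
          then obtain r g where h: "h = r \<cdot> g" "r \<in> Arr C" "Cod C r = Dom C f" "Dom C r \<in> D"
              "g \<in> Arr C" "Cod C g = Dom C r"
            by blast
          have "(f \<cdot> r, Rst P r x) \<in> R1"
            using germ_stable[OF P R1 fx] h by simp
          moreover have "(f \<cdot> r, Rst P r x) \<in> ?B"
            using f h presheaf_closed[OF P, of r x] by (force simp: Hom_def)
          ultimately have "(f \<cdot> r, Rst P r x) \<in> R2"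
            using eq by blast
          then have "(f \<cdot> r \<cdot> g, Rst P g (Rst P r x)) \<in> R2"
            using germ_stable[OF P R2, of "f \<cdot> r"] f h by simp
          then show "(f \<cdot> h, Rst P h x) \<in> R2"
            using f h presheaf_Comp[OF P] by (simp add: Comp_assoc)
        qed (use f in auto)
      qed
    qed
    show "R = R'"
      using sub[OF R eq] sub[OF R(2,1) eq[symmetric]] by blast
  qed
  ultimately show ?thesis
    by (rule small_inj_on[rotated 2]) auto
qed

text \<open>The germ relations form a sheaf with small sections, hence are represented in the topos.\<close>

lemma sheafification_exists:
  assumes P: "presheaf C P" and small_P: "\<And>c. c \<in> Ob C \<Longrightarrow> small TYPE('u) (Sec P c)"
  obtains F :: "('o, 'a, 'u) psh" and \<eta> where "sheafification C J P F \<eta>"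
    "\<And>c x y. c \<in> Ob C \<Longrightarrow> x \<in> Sec P c \<Longrightarrow> y \<in> Sec P c \<Longrightarrow> \<eta> c x = \<eta> c y \<Longrightarrow>
      locally J c (\<lambda>f. Rst P f x = Rst P f y)"
    "\<And>c x. c \<in> Ob C \<Longrightarrow> x \<in> Sec F c \<Longrightarrow>
      locally J c (\<lambda>f. \<exists>y\<in>Sec P (Dom C f). Rst F f x = \<eta> (Dom C f) y)"
proof -
  obtain F :: "('o, 'a, 'u) psh" and \<phi> where F: "F \<in> sh_objects C J" "nat_trans C (germs C J P) F \<phi>"
    "\<And>c. c \<in> Ob C \<Longrightarrow> bij_betw (\<phi> c) (Sec (germs C J P) c) (Sec F c)"
    using object_representing[OF sheaf_germs[OF P] small_germs[OF P small_P]] by blast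
  define \<eta> where "\<eta> = (\<lambda>c x. \<phi> c (germ_of C J P c x))"
  have germ: "germ_of C J P c x \<in> Sec (germs C J P) c" if "c \<in> Ob C" "x \<in> Sec P c" for c x
    using germ_of_relation[OF P that] by (simp add: germs_def)
  have \<eta>: "nat_trans C P F \<eta>"
    unfolding nat_trans_def
    using germ nat_trans_closed[OF F(2)] nat_trans_natural[OF F(2), symmetric]
    by (auto simp: \<eta>_def germ_of_restrict[OF P])
  have inj: "locally J c (\<lambda>f. Rst P f x = Rst P f y)"
    if "c \<in> Ob C" "x \<in> Sec P c" "y \<in> Sec P c" "\<eta> c x = \<eta> c y" for c x y
    using germ_of_locally_injective[OF P that(1-3)] that germ F(3)[OF that(1)]
    by (auto simp: \<eta>_def bij_betw_def inj_on_def)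
  have surj: "locally J c (\<lambda>f. \<exists>y\<in>Sec P (Dom C f). Rst F f x = \<eta> (Dom C f) y)"
    if c: "c \<in> Ob C" and x: "x \<in> Sec F c" for c x
  proof -
    obtain R where R: "R \<in> Sec (germs C J P) c" "x = \<phi> c R"
      using F(3)[OF c] x by (auto simp: bij_betw_def)
    then have "germ_relation C J P c R"
      by (simp add: germs_def)
    from germ_of_locally_surjective[OF P this c] c show ?thesis
      by (rule locally_mono) (use R nat_trans_natural[OF F(2), symmetric] in \<open>auto simp: \<eta>_def\<close>)
  qed
  have "sheafification C J P F \<eta>"
    by (rule sheafificationI[OF P F(1) \<eta> inj surj])
  from that[OF this inj surj] show thesis .
qed

lemma sheafification_extend:
  fixes F G :: "('o, 'a, 'u) psh"
  assumes "sheafification C J P F \<eta>" "G \<in> sh_objects C J" "nat_trans C P G \<alpha>"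
  obtains s where "s \<in> Hom (Sh C J) F G" "\<And>d x. d \<in> Ob C \<Longrightarrow> x \<in> Sec P d \<Longrightarrow>
    component s d (\<eta> d x) = \<alpha> d x"
proof -
  have "\<exists>!s. s \<in> Hom (Sh C J) F G \<and> (\<forall>d\<in>Ob C. \<forall>x\<in>Sec P d. component s d (\<eta> d x) = \<alpha> d x)"
    using assms unfolding sheafification_def by simp
  then show thesis
    using that by blast
qed

lemma sheafification_unique:
  fixes F G :: "('o, 'a, 'u) psh"
  assumes "sheafification C J P F \<eta>" "s \<in> Hom (Sh C J) F G" "t \<in> Hom (Sh C J) F G"
    "\<And>d x. d \<in> Ob C \<Longrightarrow> x \<in> Sec P d \<Longrightarrow> component s d (\<eta> d x) = component t d (\<eta> d x)"
  shows "s = t"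
proof -
  have \<eta>: "nat_trans C P F \<eta>" and G: "G \<in> Ob (Sh C J)"
    using assms(1) Hom_Sh[OF assms(2)] by (auto simp: sheafification_def)
  have "nat_trans C P G (\<lambda>d x. component s d (\<eta> d x))"
    using \<eta> Hom_Sh(6)[OF assms(2)] by (simp add: nat_trans_def Pi_iff)
  then have "\<exists>!s'. s' \<in> Hom (Sh C J) F G \<and>
      (\<forall>d\<in>Ob C. \<forall>x\<in>Sec P d. component s' d (\<eta> d x) = component s d (\<eta> d x))"
    using assms(1) G unfolding sheafification_def by blast
  moreover have "t \<in> Hom (Sh C J) F G \<and>
      (\<forall>d\<in>Ob C. \<forall>x\<in>Sec P d. component t d (\<eta> d x) = component s d (\<eta> d x))"
    using assms(3,4) by simp
  ultimately show ?thesis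
    using assms(2) by blast
qed

text \<open>By universality, any two sheafifications are isomorphic under the presheaf, and the one obtained
  from germ relations has these properties.\<close>

lemma sheafification_locally_bijective:
  fixes F :: "('o, 'a, 'u) psh"
  assumes P: "presheaf C P" and small_P: "\<And>c. c \<in> Ob C \<Longrightarrow> small TYPE('u) (Sec P c)"
    and F: "sheafification C J P F \<eta>"
  shows "\<And>c x y. c \<in> Ob C \<Longrightarrow> x \<in> Sec P c \<Longrightarrow> y \<in> Sec P c \<Longrightarrow> \<eta> c x = \<eta> c y \<Longrightarrow>
      locally J c (\<lambda>f. Rst P f x = Rst P f y)"
    and "\<And>c x. c \<in> Ob C \<Longrightarrow> x \<in> Sec F c \<Longrightarrow>
      locally J c (\<lambda>f. \<exists>y\<in>Sec P (Dom C f). Rst F f x = \<eta> (Dom C f) y)"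
proof -
  interpret Sh: category "Sh C J :: (('o, 'a, 'u) psh, ('o, 'a, 'u) sh_arr) cat"
    using category_Sh[OF category_axioms] .
  obtain F' :: "('o, 'a, 'u) psh" and \<eta>' where F': "sheafification C J P F' \<eta>'"
    and inj: "\<And>c x y. c \<in> Ob C \<Longrightarrow> x \<in> Sec P c \<Longrightarrow> y \<in> Sec P c \<Longrightarrow> \<eta>' c x = \<eta>' c y \<Longrightarrow>
      locally J c (\<lambda>f. Rst P f x = Rst P f y)"
    and surj: "\<And>c x. c \<in> Ob C \<Longrightarrow> x \<in> Sec F' c \<Longrightarrow>
      locally J c (\<lambda>f. \<exists>y\<in>Sec P (Dom C f). Rst F' f x = \<eta>' (Dom C f) y)"
    using sheafification_exists[OF P small_P] by blast
  have obj: "F \<in> sh_objects C J" "F' \<in> sh_objects C J" "nat_trans C P F \<eta>" "nat_trans C P F' \<eta>'"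
    using F F' by (simp_all add: sheafification_def)
  obtain s where s: "s \<in> Hom (Sh C J) F F'"
      "\<And>d x. d \<in> Ob C \<Longrightarrow> x \<in> Sec P d \<Longrightarrow> component s d (\<eta> d x) = \<eta>' d x"
    using sheafification_extend[OF F obj(2,4)] by blast
  obtain t where t: "t \<in> Hom (Sh C J) F' F"
      "\<And>d x. d \<in> Ob C \<Longrightarrow> x \<in> Sec P d \<Longrightarrow> component t d (\<eta>' d x) = \<eta> d x"
    using sheafification_extend[OF F' obj(1,3)] by blast
  note s' = s(1)[unfolded Hom_def, simplified]
  note t' = t(1)[unfolded Hom_def, simplified]
  have "t \<cdot>\<^bsub>Sh C J\<^esub> s = Id (Sh C J) F"
    by (rule sheafification_unique[OF F Sh.Comp_in[OF s(1) t(1)]])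
      (use obj s t s' Sh.Id_in[of F] nat_trans_closed[OF obj(3)]
        in \<open>auto simp: component_Comp component_Id\<close>)
  then have ts: "component t c (component s c x) = x" if "c \<in> Ob C" "x \<in> Sec F c" for c x
    using component_Comp[of c C x J s t] component_Id[of c C x F J] that s' by simp
  show "locally J c (\<lambda>f. Rst P f x = Rst P f y)"
    if "c \<in> Ob C" "x \<in> Sec P c" "y \<in> Sec P c" "\<eta> c x = \<eta> c y" for c x y
    using inj[OF that(1-3)] s(2)[OF that(1,2)] s(2)[OF that(1,3)] that(4) by simp
  show "locally J c (\<lambda>f. \<exists>y\<in>Sec P (Dom C f). Rst F f x = \<eta> (Dom C f) y)"
    if c: "c \<in> Ob C" and x: "x \<in> Sec F c" for c x
  proof (rule locally_mono[OF surj[of c "component s c x"] c])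
    show "component s c x \<in> Sec F' c"
      using arrow_closed[of s C J c x] s' c x by simp
    fix f assume f: "f \<in> Arr C" "Cod C f = c"
      and "\<exists>y\<in>Sec P (Dom C f). Rst F' f (component s c x) = \<eta>' (Dom C f) y"
    then obtain y where y: "y \<in> Sec P (Dom C f)" "Rst F' f (component s c x) = \<eta>' (Dom C f) y"
      by blast
    have "Rst F f x = component t (Dom C f) (component s (Dom C f) (Rst F f x))"
      using ts f x presheaf_closed[OF presheaf_object[OF obj(1)], of f x] by simp
    also have "\<dots> = \<eta> (Dom C f) y"
      using arrow_natural[of s C J f x] s' f x y t(2)[of "Dom C f" y] by simp
    finally show "\<exists>y\<in>Sec P (Dom C f). Rst F f x = \<eta> (Dom C f) y"
      using y(1) by blast
  qed (use c in auto)
qed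

section \<open>The canonical functor\<close>

lemma small_yo: "c \<in> Ob C \<Longrightarrow> d \<in> Ob C \<Longrightarrow> small TYPE('u) (Sec (yo C c) d)"
  using locally_small by (simp add: locally_small_def yo_def)

text \<open>All choices are made objectwise; functoriality follows from the uniqueness of extensions.\<close>

lemma canonical_functor_exists:
  "\<exists>l :: ('o, 'a, ('o, 'a, 'u) psh, ('o, 'a, 'u) sh_arr) func. canonical_functor C J l"
proof -
  interpret Sh: category "Sh C J :: (('o, 'a, 'u) psh, ('o, 'a, 'u) sh_arr) cat"
    using category_Sh[OF category_axioms] .
  have "\<exists>(F :: ('o, 'a, 'u) psh) \<eta>. sheafification C J (yo C c) F \<eta>" if "c \<in> Ob C" for c
    using sheafification_exists[OF presheaf_yo small_yo[OF that]] by metis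
  then obtain F :: "'o \<Rightarrow> ('o, 'a, 'u) psh" and \<eta> where
    F: "\<And>c. c \<in> Ob C \<Longrightarrow> sheafification C J (yo C c) (F c) (\<eta> c)"
    by metis
  then have obj: "F c \<in> sh_objects C J" "nat_trans C (yo C c) (F c) (\<eta> c)" if "c \<in> Ob C" for c
    using that by (auto simp: sheafification_def)
  have "\<exists>s. s \<in> Hom (Sh C J) (F (Dom C h)) (F (Cod C h)) \<and>
      (\<forall>d\<in>Ob C. \<forall>g\<in>Hom C d (Dom C h). component s d (\<eta> (Dom C h) d g) = \<eta> (Cod C h) d (h \<cdot> g))"
    if h: "h \<in> Arr C" for h
  proof -
    have "nat_trans C (yo C (Dom C h)) (F (Cod C h)) (\<lambda>d g. \<eta> (Cod C h) d (h \<cdot> g))"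
      unfolding nat_trans_def
    proof (intro conjI ballI Pi_I)
      fix c g assume "c \<in> Ob C" "g \<in> Sec (yo C (Dom C h)) c"
      then show "\<eta> (Cod C h) c (h \<cdot> g) \<in> Sec (F (Cod C h)) c"
        using h by (intro nat_trans_closed[OF obj(2)]) (auto simp: yo_def Hom_def)
    next
      fix f g assume "f \<in> Arr C" "g \<in> Sec (yo C (Dom C h)) (Cod C f)"
      then show "\<eta> (Cod C h) (Dom C f) (h \<cdot> Rst (yo C (Dom C h)) f g)
          = Rst (F (Cod C h)) f (\<eta> (Cod C h) (Cod C f) (h \<cdot> g))"
        using h nat_trans_natural[OF obj(2), of "Cod C h" f "h \<cdot> g"]
        by (auto simp: yo_def Hom_def Comp_assoc)
    qed
    from sheafification_extend[OF F[OF Dom_Ob[OF h]] obj(1)[OF Cod_Ob[OF h]] this]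
    obtain s where "s \<in> Hom (Sh C J) (F (Dom C h)) (F (Cod C h))"
      "\<And>d g. d \<in> Ob C \<Longrightarrow> g \<in> Sec (yo C (Dom C h)) d \<Longrightarrow>
        component s d (\<eta> (Dom C h) d g) = \<eta> (Cod C h) d (h \<cdot> g)"
      by blast
    then show ?thesis
      by (intro exI[of _ s]) (simp add: yo_def)
  qed
  then obtain S where S: "\<And>h. h \<in> Arr C \<Longrightarrow> S h \<in> Hom (Sh C J) (F (Dom C h)) (F (Cod C h))"
      "\<And>h d g. h \<in> Arr C \<Longrightarrow> d \<in> Ob C \<Longrightarrow> g \<in> Hom C d (Dom C h) \<Longrightarrow>
        component (S h) d (\<eta> (Dom C h) d g) = \<eta> (Cod C h) d (h \<cdot> g)"
    by metis
  have \<eta>_closed: "\<eta> c d g \<in> Sec (F c) d" if "c \<in> Ob C" "d \<in> Ob C" "g \<in> Hom C d c" for c d g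
    using nat_trans_closed[OF obj(2)[OF that(1)] that(2)] that(3) by (simp add: yo_def)
  have "is_functor C (Sh C J) \<lparr>FOb = F, FArr = S\<rparr>"
    unfolding is_functor_def
  proof (intro conjI ballI impI)
    fix c assume c: "c \<in> Ob C"
    have "S (Id C c) = Id (Sh C J) (F c)"
      by (rule sheafification_unique[OF F[OF c]])
        (use c S(1)[of "Id C c"] S(2)[of "Id C c"] Sh.Id_in[of "F c"] obj \<eta>_closed in
          \<open>auto simp: component_Id yo_def Hom_def\<close>)
    then show "FArr \<lparr>FOb = F, FArr = S\<rparr> (Id C c) = Id (Sh C J) (FOb \<lparr>FOb = F, FArr = S\<rparr> c)"
      by simp
  next
    fix f g assume fg: "f \<in> Arr C" "g \<in> Arr C" "Cod C f = Dom C g"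
    have "S (g \<cdot> f) = S g \<cdot>\<^bsub>Sh C J\<^esub> S f"
    proof (rule sheafification_unique[OF F[of "Dom C f"]])
      show "S g \<cdot>\<^bsub>Sh C J\<^esub> S f \<in> Hom (Sh C J) (F (Dom C f)) (F (Cod C g))"
        using S(1)[OF fg(1)] S(1)[OF fg(2)] fg(3) by (intro Sh.Comp_in) auto
      fix d k assume d: "d \<in> Ob C" and "k \<in> Sec (yo C (Dom C f)) d"
      then have k: "k \<in> Arr C" "Dom C k = d" "Cod C k = Dom C f"
        by (auto simp: yo_def Hom_def)
      have "Dom (Sh C J) (S f) = F (Dom C f)"
        using S(1)[OF fg(1)] by (simp add: Hom_def)
      then show "component (S (g \<cdot> f)) d (\<eta> (Dom C f) d k)
        = component (S g \<cdot>\<^bsub>Sh C J\<^esub> S f) d (\<eta> (Dom C f) d k)"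
        using S(2)[of "g \<cdot> f" d k] S(2)[of f d k] S(2)[of g d "f \<cdot> k"]
          fg d k \<eta>_closed[of "Dom C f" d k]
        by (simp add: component_Comp Hom_def Comp_assoc)
    qed (use fg S(1)[of "g \<cdot> f"] in auto)
    then show "FArr \<lparr>FOb = F, FArr = S\<rparr> (g \<cdot> f)
        = FArr \<lparr>FOb = F, FArr = S\<rparr> g \<cdot>\<^bsub>Sh C J\<^esub> FArr \<lparr>FOb = F, FArr = S\<rparr> f"
      by simp
  qed (use obj S(1) in auto)
  then have "canonical_functor C J \<lparr>FOb = F, FArr = S\<rparr>"
    unfolding canonical_functor_def using F S(2) by (intro conjI exI[of _ \<eta>]) simp_all
  then show ?thesis ..
qed

end

lemma sheaf_subtopology:
  assumes "sheaf C J P" "\<And>c. c \<in> Ob C \<Longrightarrow> K c \<subseteq> J c"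
  shows "sheaf C K P"
  using assms unfolding sheaf_def by blast

lemma (in site) object_closed [simp]:
  "F \<in> sh_objects C J \<Longrightarrow> f \<in> Arr C \<Longrightarrow> x \<in> Sec F (Cod C f) \<Longrightarrow> Rst F f x \<in> Sec F (Dom C f)"
  using presheaf_closed[OF presheaf_object] .

section \<open>Jointly epimorphic families of sheaves\<close>

abbreviation reached ::
    "('o, 'a) cat \<Rightarrow> ('o \<Rightarrow> 'a set set) \<Rightarrow> ('o, 'a, 'u) sh_arr set \<Rightarrow> 'o \<Rightarrow> 'u \<Rightarrow> bool" where
  "reached C J A d x \<equiv> \<exists>s\<in>A. \<exists>y\<in>Sec (Dom (Sh C J) s) d. component s d y = x"

text \<open>Surjectivity up to covers, which is what epimorphy amounts to for a family of sheaf maps.\<close>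

definition jointly_epi ::
    "('o, 'a) cat \<Rightarrow> ('o \<Rightarrow> 'a set set) \<Rightarrow> ('o, 'a, 'u) sh_arr set \<Rightarrow> ('o, 'a, 'u) psh \<Rightarrow> bool" where
  "jointly_epi C J A F \<longleftrightarrow>
     (\<forall>c\<in>Ob C. \<forall>x\<in>Sec F c. locally J c (\<lambda>f. reached C J A (Dom C f) (Rst F f x)))"

definition epi_topology ::
    "('o, 'a) cat \<Rightarrow> ('o \<Rightarrow> 'a set set) \<Rightarrow> ('o, 'a, 'u) psh \<Rightarrow> ('o, 'a, 'u) sh_arr set set" where
  "epi_topology C J F = {S. sieve (Sh C J) F S \<and> jointly_epi C J S F}"

text \<open>The canonical functor is an arbitrary choice among isomorphic ones, so that it is known only
  through its defining properties, which are assumed here.\<close>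

locale canonical_site = small_site C J U D
  for C :: "('o, 'a) cat" (structure) and J and U :: "'u itself" and D +
  fixes l :: "('o, 'a, ('o, 'a, 'u) psh, ('o, 'a, 'u) sh_arr) func"
    and \<eta> :: "'o \<Rightarrow> 'o \<Rightarrow> 'a \<Rightarrow> 'u"
  assumes l_functor: "is_functor C (Sh C J) l"
    and l_sheafification: "c \<in> Ob C \<Longrightarrow> sheafification C J (yo C c) (FOb l c) (\<eta> c)"
    and l_\<eta>: "h \<in> Arr C \<Longrightarrow> d \<in> Ob C \<Longrightarrow> g \<in> Hom C d (Dom C h) \<Longrightarrow>
      component (FArr l h) d (\<eta> (Dom C h) d g) = \<eta> (Cod C h) d (h \<cdot> g)"
begin

abbreviation E :: "(('o, 'a, 'u) psh, ('o, 'a, 'u) sh_arr) cat" where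
  "E \<equiv> Sh C J"

sublocale E: category E
  using category_Sh[OF category_axioms] .

lemmas E_Comp [simp] = E.Comp_Arr[simplified]
lemmas E_assoc = E.Comp_assoc[simplified]
lemmas E_Dom [simp] = E.Dom_Ob[simplified]
lemmas E_Cod [simp] = E.Cod_Ob[simplified]
lemmas E_Id [simp] = E.Id_Arr[simplified]
lemmas E_Comp_Id [simp] = E.Comp_Id[simplified]

lemma l_obj [simp]: "c \<in> Ob C \<Longrightarrow> FOb l c \<in> sh_objects C J"
  using l_functor by (simp add: is_functor_def)

lemma l_arr [simp]:
  assumes "h \<in> Arr C"
  shows "FArr l h \<in> sh_arrows C J" "Dom E (FArr l h) = FOb l (Dom C h)"
    "Cod E (FArr l h) = FOb l (Cod C h)"
  using l_functor assms by (auto simp: is_functor_def Hom_def)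

lemma l_Id: "c \<in> Ob C \<Longrightarrow> FArr l (Id C c) = Id E (FOb l c)"
  using l_functor by (simp add: is_functor_def)

lemma l_Comp: "f \<in> Arr C \<Longrightarrow> g \<in> Arr C \<Longrightarrow> Cod C g = Dom C f \<Longrightarrow> FArr l (f \<cdot> g) = FArr l f \<cdot>\<^bsub>E\<^esub> FArr l g"
  using l_functor by (simp add: is_functor_def)

lemma \<eta>_nat: "c \<in> Ob C \<Longrightarrow> nat_trans C (yo C c) (FOb l c) (\<eta> c)"
  using l_sheafification by (simp add: sheafification_def)

lemma \<eta>_closed [simp]: "g \<in> Arr C \<Longrightarrow> Cod C g = c \<Longrightarrow> Dom C g = d \<Longrightarrow> \<eta> c d g \<in> Sec (FOb l c) d"
  using nat_trans_closed[OF \<eta>_nat, of c d g] by (auto simp: yo_def Hom_def)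

lemma \<eta>_restrict:
  "g \<in> Arr C \<Longrightarrow> Cod C g = c \<Longrightarrow> Dom C g = d \<Longrightarrow> k \<in> Arr C \<Longrightarrow> Cod C k = d \<Longrightarrow>
    Rst (FOb l c) k (\<eta> c d g) = \<eta> c (Dom C k) (g \<cdot> k)"
  using nat_trans_natural[OF \<eta>_nat, of c k g] by (auto simp: yo_def Hom_def)

lemma l_\<eta>':
  "h \<in> Arr C \<Longrightarrow> g \<in> Arr C \<Longrightarrow> Cod C g = Dom C h \<Longrightarrow> Dom C g = d \<Longrightarrow> Cod C h = c \<Longrightarrow> Dom C h = b \<Longrightarrow>
    component (FArr l h) d (\<eta> b d g) = \<eta> c d (h \<cdot> g)"
  using l_\<eta>[of h d g] by (auto simp: Hom_def)

lemma \<eta>_locally_injective: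
  assumes "g \<in> Arr C" "g' \<in> Arr C" "Cod C g = c" "Cod C g' = c" "Dom C g = d" "Dom C g' = d"
    "\<eta> c d g = \<eta> c d g'"
  shows "locally J d (\<lambda>k. g \<cdot> k = g' \<cdot> k)"
proof -
  have c: "c \<in> Ob C" "d \<in> Ob C"
    using assms by auto
  have "locally J d (\<lambda>k. Rst (yo C c) k g = Rst (yo C c) k g')"
    by (rule sheafification_locally_bijective(1)[OF presheaf_yo small_yo[OF c(1)]
      l_sheafification[OF c(1)] c(2)])
      (use assms in \<open>auto simp: yo_def Hom_def\<close>)
  then show ?thesis
    by (simp add: yo_def)
qed

lemma \<eta>_locally_surjective:
  assumes "c \<in> Ob C" "d \<in> Ob C" "x \<in> Sec (FOb l c) d"
  shows "locally J d (\<lambda>f. \<exists>g. g \<in> Arr C \<and> Cod C g = c \<and> Dom C g = Dom C f \<and>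
    Rst (FOb l c) f x = \<eta> c (Dom C f) g)"
  using sheafification_locally_bijective(2)
    [OF presheaf_yo small_yo[OF assms(1)] l_sheafification[OF assms(1)] assms(2,3)] assms(2)
  by (rule locally_mono) (auto simp: yo_def Hom_def)

section \<open>Sections as arrows from representables\<close>

text \<open>The arrow \<open>l c \<rightarrow> F\<close> that corresponds to a section of \<open>F\<close> at \<open>c\<close> by the Yoneda lemma and the
  universal property of sheafification.\<close>

definition point :: "('o, 'a, 'u) psh \<Rightarrow> 'o \<Rightarrow> 'u \<Rightarrow> ('o, 'a, 'u) sh_arr" where
  "point F c x = (SOME s. s \<in> Hom E (FOb l c) F \<and>
     (\<forall>d\<in>Ob C. \<forall>g\<in>Hom C d c. component s d (\<eta> c d g) = Rst F g x))"

lemma point_spec: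
  assumes "F \<in> sh_objects C J" "c \<in> Ob C" "x \<in> Sec F c"
  shows "point F c x \<in> Hom E (FOb l c) F \<and>
     (\<forall>d\<in>Ob C. \<forall>g\<in>Hom C d c. component (point F c x) d (\<eta> c d g) = Rst F g x)"
proof -
  have "nat_trans C (yo C c) F (\<lambda>d g. Rst F g x)"
    using presheaf_closed[OF presheaf_object[OF assms(1)]]
      presheaf_Comp[OF presheaf_object[OF assms(1)]]
      assms(3)
    by (auto simp: nat_trans_def yo_def Hom_def)
  from sheafification_extend[OF l_sheafification[OF assms(2)] assms(1) this]
  obtain s where "s \<in> Hom E (FOb l c) F"
    "\<And>d g. d \<in> Ob C \<Longrightarrow> g \<in> Sec (yo C c) d \<Longrightarrow> component s d (\<eta> c d g) = Rst F g x"
    by blast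
  then have "s \<in> Hom E (FOb l c) F \<and> (\<forall>d\<in>Ob C. \<forall>g\<in>Hom C d c. component s d (\<eta> c d g) = Rst F g x)"
    by (simp add: yo_def)
  then show ?thesis
    unfolding point_def by (rule someI)
qed

lemma point_arrow [simp]:
  assumes "F \<in> sh_objects C J" "c \<in> Ob C" "x \<in> Sec F c"
  shows "point F c x \<in> sh_arrows C J" "Dom E (point F c x) = FOb l c" "Cod E (point F c x) = F"
  using point_spec[OF assms] by (auto simp: Hom_def)

lemma component_point:
  assumes "F \<in> sh_objects C J" "c \<in> Ob C" "x \<in> Sec F c" "g \<in> Arr C" "Cod C g = c" "Dom C g = d"
  shows "component (point F c x) d (\<eta> c d g) = Rst F g x"
proof -
  have "d \<in> Ob C" "g \<in> Hom C d c"
    using assms by (auto simp: Hom_def)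
  then show ?thesis
    using point_spec[OF assms(1-3)] by blast
qed

lemma component_point_Id:
  assumes "F \<in> sh_objects C J" "c \<in> Ob C" "x \<in> Sec F c"
  shows "component (point F c x) c (\<eta> c c (Id C c)) = x"
  using component_point[OF assms, of "Id C c" c] presheaf_Id[OF presheaf_object] assms by simp

lemma point_unique:
  assumes s: "s \<in> sh_arrows C J" "Dom E s = FOb l c" "Cod E s = F" and c: "c \<in> Ob C"
    and x: "component s c (\<eta> c c (Id C c)) = x"
  shows "s = point F c x"
proof -
  have F: "F \<in> sh_objects C J"
    using s E_Cod by blast
  have xF: "x \<in> Sec F c"
    using arrow_closed[OF s(1) c, of "\<eta> c c (Id C c)"] s c x by simp
  show ?thesis
  proof (rule sheafification_unique[OF l_sheafification[OF c]])
    show "s \<in> Hom E (FOb l c) F" "point F c x \<in> Hom E (FOb l c) F"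
      using s point_spec[OF F c xF] by (auto simp: Hom_def)
    fix d g assume "d \<in> Ob C" "g \<in> Sec (yo C c) d"
    then have g: "g \<in> Arr C" "Cod C g = c" "Dom C g = d"
      by (auto simp: yo_def Hom_def)
    have "\<eta> c d g = Rst (FOb l c) g (\<eta> c c (Id C c))"
      using g c by (simp add: \<eta>_restrict)
    then have "component s d (\<eta> c d g) = Rst F g x"
      using arrow_natural[OF s(1) g(1), of "\<eta> c c (Id C c)"] s g c x by simp
    then show "component s d (\<eta> c d g) = component (point F c x) d (\<eta> c d g)"
      using component_point[OF F c xF g] by simp
  qed
qed

lemma Comp_point:
  assumes "t \<in> sh_arrows C J" "c \<in> Ob C" "x \<in> Sec (Dom E t) c"
  shows "t \<cdot>\<^bsub>E\<^esub> point (Dom E t) c x = point (Cod E t) c (component t c x)"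
  using assms by (intro point_unique) (simp_all add: component_Comp component_point_Id)

lemma point_\<eta>:
  assumes "h \<in> Arr C" "Cod C h = c" "Dom C h = d"
  shows "point (FOb l c) d (\<eta> c d h) = FArr l h"
proof -
  have "d \<in> Ob C" "c \<in> Ob C"
    using assms by auto
  then show ?thesis
    using assms l_\<eta>'[of h "Id C d" d c d] by (intro point_unique[symmetric]) simp_all
qed

lemma point_restrict:
  assumes "F \<in> sh_objects C J" "h \<in> Arr C" "x \<in> Sec F (Cod C h)"
  shows "point F (Cod C h) x \<cdot>\<^bsub>E\<^esub> FArr l h = point F (Dom C h) (Rst F h x)"
proof -
  have "component (FArr l h) (Dom C h) (\<eta> (Dom C h) (Dom C h) (Id C (Dom C h)))
    = \<eta> (Cod C h) (Dom C h) h"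
    using l_\<eta>'[of h "Id C (Dom C h)"] assms by simp
  then show ?thesis
    using assms by (intro point_unique) (simp_all add: component_Comp component_point)
qed

section \<open>The topology of jointly epimorphic families\<close>

text \<open>Stability under pullback needs arrows into the domain of \<open>h\<close> that lie in the pulled back sieve. The
  points of sections whose image under \<open>h\<close> is reached by the sieve are such.\<close>

lemma epi_topology_grothendieck: "grothendieck_topology E (epi_topology C J)"
  unfolding grothendieck_topology_def
proof (intro conjI ballI allI impI)
  fix F S assume "F \<in> Ob E" "S \<in> epi_topology C J F"
  then show "sieve E F S"
    by (simp add: epi_topology_def)
next
  fix F assume F: "F \<in> Ob E"
  have "locally J c (\<lambda>f. reached C J {f \<in> Arr E. Cod E f = F} (Dom C f) (Rst F f x))"
    if "c \<in> Ob C" "x \<in> Sec F c" for c x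
  proof (rule locally_everywhere[OF that(1)])
    fix f assume f: "f \<in> Arr C" "Cod C f = c"
    have "Rst F f x \<in> Sec F (Dom C f)"
      using F f that object_closed by simp
    then show "reached C J {f \<in> Arr E. Cod E f = F} (Dom C f) (Rst F f x)"
      using F f by (intro bexI[of _ "Id E F"] bexI[of _ "Rst F f x"]) (simp_all add: component_Id)
  qed
  moreover have "sieve E F {f \<in> Arr E. Cod E f = F}"
    by (auto simp: sieve_def)
  ultimately show "{f \<in> Arr E. Cod E f = F} \<in> epi_topology C J F"
    by (simp add: epi_topology_def jointly_epi_def)
next
  fix h S assume h: "h \<in> Arr E" and S: "S \<in> epi_topology C J (Cod E h)"
  have sieve: "sieve E (Cod E h) S"
    using S by (simp add: epi_topology_def)
  have "locally J c (\<lambda>f. reached C J (pull_sieve E h S) (Dom C f) (Rst (Dom E h) f x))"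
    if c: "c \<in> Ob C" and x: "x \<in> Sec (Dom E h) c" for c x
  proof (rule locally_mono)
    show "locally J c (\<lambda>f. reached C J S (Dom C f) (Rst (Cod E h) f (component h c x)))"
      using S c arrow_closed[of h C J c x] h x by (simp add: epi_topology_def jointly_epi_def)
    fix f assume f: "f \<in> Arr C" "Cod C f = c"
      and "reached C J S (Dom C f) (Rst (Cod E h) f (component h c x))"
    then obtain s y where s: "s \<in> S" "y \<in> Sec (Dom E s) (Dom C f)"
        "component s (Dom C f) y = Rst (Cod E h) f (component h c x)"
      by blast
    have s': "s \<in> sh_arrows C J" "Cod E s = Cod E h"
      using sieve s by (auto simp: sieve_def)
    have xf: "Rst (Dom E h) f x \<in> Sec (Dom E h) (Dom C f)"
      using h f x object_closed by simp
    have "h \<cdot>\<^bsub>E\<^esub> point (Dom E h) (Dom C f) (Rst (Dom E h) f x) = s \<cdot>\<^bsub>E\<^esub> point (Dom E s) (Dom C f) y"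
      using Comp_point[of h "Dom C f"] Comp_point[of s "Dom C f"] arrow_natural[of h C J f x]
        xf h s s' f x
      by simp
    also have "\<dots> \<in> S"
      using sieve s s' f by (auto simp: sieve_def)
    finally have "point (Dom E h) (Dom C f) (Rst (Dom E h) f x) \<in> pull_sieve E h S"
      using h xf f by (simp add: pull_sieve_def)
    then show "reached C J (pull_sieve E h S) (Dom C f) (Rst (Dom E h) f x)"
      using h xf f component_point_Id[of "Dom E h" "Dom C f" "Rst (Dom E h) f x"]
      by (intro bexI[of _ "point (Dom E h) (Dom C f) (Rst (Dom E h) f x)"]
          bexI[of _ "\<eta> (Dom C f) (Dom C f) (Id C (Dom C f))"]) simp_all
  qed (use c in auto)
  moreover have "sieve E (Dom E h) (pull_sieve E h S)"
    using sieve h by (auto simp: sieve_def pull_sieve_def simp flip: E_assoc)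
  ultimately show "pull_sieve E h S \<in> epi_topology C J (Dom E h)"
    by (simp add: epi_topology_def jointly_epi_def)
next
  fix F S R assume F: "F \<in> Ob E" and S: "S \<in> epi_topology C J F"
    and "sieve E F R \<and> (\<forall>s\<in>S. pull_sieve E s R \<in> epi_topology C J (Dom E s))"
  then have R: "sieve E F R" "\<And>s. s \<in> S \<Longrightarrow> jointly_epi C J (pull_sieve E s R) (Dom E s)"
    by (auto simp: epi_topology_def)
  have sieve: "sieve E F S"
    using S by (simp add: epi_topology_def)
  have "locally J c (\<lambda>f. reached C J R (Dom C f) (Rst F f x))"
    if c: "c \<in> Ob C" and x: "x \<in> Sec F c" for c x
  proof (rule locally_bind)
    show "locally J c (\<lambda>f. reached C J S (Dom C f) (Rst F f x))"
      using S c x by (simp add: epi_topology_def jointly_epi_def)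
    fix f assume f: "f \<in> Arr C" "Cod C f = c"
      and "reached C J S (Dom C f) (Rst F f x)"
    then obtain s y where s: "s \<in> S" "y \<in> Sec (Dom E s) (Dom C f)"
      "component s (Dom C f) y = Rst F f x"
      by blast
    have s': "s \<in> sh_arrows C J" "Cod E s = F"
      using sieve s by (auto simp: sieve_def)
    have "locally J (Dom C f) (\<lambda>g. reached C J (pull_sieve E s R) (Dom C g) (Rst (Dom E s) g y))"
      using R(2)[OF s(1)] f s(2) by (simp add: jointly_epi_def)
    then show "locally J (Dom C f) (\<lambda>g. reached C J R (Dom C (f \<cdot> g)) (Rst F (f \<cdot> g) x))"
    proof (rule locally_mono)
      fix g assume g: "g \<in> Arr C" "Cod C g = Dom C f"
        and "reached C J (pull_sieve E s R) (Dom C g) (Rst (Dom E s) g y)"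
      then obtain r z where r: "r \<in> sh_arrows C J" "Cod E r = Dom E s" "s \<cdot>\<^bsub>E\<^esub> r \<in> R"
          "z \<in> Sec (Dom E r) (Dom C g)" "component r (Dom C g) z = Rst (Dom E s) g y"
        by (auto simp: pull_sieve_def)
      have "component (s \<cdot>\<^bsub>E\<^esub> r) (Dom C g) z = Rst F g (Rst F f x)"
        using r s s' g arrow_natural[of s C J g y] by (simp add: component_Comp)
      also have "\<dots> = Rst F (f \<cdot> g) x"
        using F f g x presheaf_Comp[OF presheaf_object, of F C J f g x] by simp
      finally show "reached C J R (Dom C (f \<cdot> g)) (Rst F (f \<cdot> g) x)"
        using r s' f g by (intro bexI[of _ "s \<cdot>\<^bsub>E\<^esub> r"] bexI[of _ z]) simp_all
    qed (use f in auto)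
  qed (use c in auto)
  then show "R \<in> epi_topology C J F"
    using R(1) by (simp add: epi_topology_def jointly_epi_def)
qed

text \<open>Arrows out of \<open>F\<close> may be glued along a jointly epimorphic sieve. Single-valuedness of the glued
  map is where representables enter: an equality \<open>s z = s' z'\<close> of sections is an equality of two
  composites through a representable, to which the matching condition applies.\<close>

lemma epi_topology_subcanonical: "subcanonical E (epi_topology C J)"
  unfolding subcanonical_def sheaf_def
proof (intro conjI ballI allI impI)
  fix G assume "G \<in> Ob E"
  then have G: "G \<in> sh_objects C J"
    by simp
  show "presheaf E (yo E G)"
    using E.presheaf_yo .
  fix F S t assume "F \<in> Ob E" and S: "S \<in> epi_topology C J F"
    and t: "matching_family E (yo E G) S t"
  then have F: "F \<in> sh_objects C J"
    by simp
  have S_arr: "s \<in> sh_arrows C J \<and> Cod E s = F" if "s \<in> S" for s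
    using S that by (auto simp: epi_topology_def sieve_def)
  have t_arr: "t s \<in> sh_arrows C J" "Dom E (t s) = Dom E s" "Cod E (t s) = G" if "s \<in> S" for s
    using t that by (auto simp: matching_family_def yo_def Hom_def)
  have t_Comp: "t (s \<cdot>\<^bsub>E\<^esub> r) = t s \<cdot>\<^bsub>E\<^esub> r" if "s \<in> S" "r \<in> sh_arrows C J"
    "Cod E r = Dom E s" for s r
    using t that by (auto simp: matching_family_def yo_def)
  define V where "V d r v \<longleftrightarrow> (\<exists>s\<in>S. \<exists>z\<in>Sec (Dom E s) d. component s d z = r \<and>
    v = component (t s) d z)"
    for d r v
  have local: "locally J c (\<lambda>f. reached C J S (Dom C f) (Rst F f x))"
    if "c \<in> Ob C" "x \<in> Sec F c" for c x
    using S that by (auto simp: epi_topology_def jointly_epi_def)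
  obtain \<alpha> where \<alpha>: "nat_trans C F G \<alpha>"
    "\<And>d r v. d \<in> Ob C \<Longrightarrow> r \<in> Sec F d \<Longrightarrow> V d r v \<Longrightarrow> \<alpha> d r = v"
  proof (rule glue_nat_trans[OF presheaf_object[OF F] sheaf_object[OF G], of V])
    show "v \<in> Sec G d" if d: "d \<in> Ob C" and v: "V d r v" for d r v
    proof -
      obtain s z where "s \<in> S" "z \<in> Sec (Dom E s) d" "v = component (t s) d z"
        using v unfolding V_def by blast
      then show ?thesis
        using t_arr[of s] arrow_closed[of "t s" C J d z] d by simp
    qed
    show "v = v'" if d: "d \<in> Ob C" and v: "V d r v" "V d r v'" for d r v v'
    proof -
      obtain s z s' z' where sz: "s \<in> S" "z \<in> Sec (Dom E s) d" "v = component (t s) d z"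
          "s' \<in> S" "z' \<in> Sec (Dom E s') d" "v' = component (t s') d z'"
          "component s d z = component s' d z'"
        using v unfolding V_def by metis
      have "s \<cdot>\<^bsub>E\<^esub> point (Dom E s) d z = s' \<cdot>\<^bsub>E\<^esub> point (Dom E s') d z'"
        using sz d S_arr[of s] S_arr[of s'] by (simp add: Comp_point)
      then have "t s \<cdot>\<^bsub>E\<^esub> point (Dom E s) d z = t s' \<cdot>\<^bsub>E\<^esub> point (Dom E s') d z'"
        using t_Comp[of s "point (Dom E s) d z"] t_Comp[of s' "point (Dom E s') d z'"] sz d
          S_arr[of s] S_arr[of s']
        by simp
      then have "point G d v = point G d v'"
        using Comp_point[of "t s" d z] Comp_point[of "t s'" d z'] sz d t_arr[of s] t_arr[of s']
        by simp
      moreover have "v \<in> Sec G d" "v' \<in> Sec G d"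
        using sz d t_arr[of s] t_arr[of s'] arrow_closed[of "t s" C J d z]
          arrow_closed[of "t s'" C J d z']
        by auto
      ultimately show ?thesis
        using component_point_Id[OF G d] by metis
    qed
    show "V (Dom C f) (Rst F f r) (Rst G f v)" if f: "f \<in> Arr C" and v: "V (Cod C f) r v" for f r v
    proof -
      obtain s z where sz: "s \<in> S" "z \<in> Sec (Dom E s) (Cod C f)" "component s (Cod C f) z = r"
          "v = component (t s) (Cod C f) z"
        using v by (auto simp: V_def)
      then have "component s (Dom C f) (Rst (Dom E s) f z) = Rst F f r"
        "component (t s) (Dom C f) (Rst (Dom E s) f z) = Rst G f v"
        using arrow_natural[of s C J f z] arrow_natural[of "t s" C J f z] S_arr[of s] t_arr[of s] f
        by auto
      moreover have "Rst (Dom E s) f z \<in> Sec (Dom E s) (Dom C f)"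
        using object_closed S_arr[of s] sz f by simp
      ultimately show ?thesis
        using sz(1) unfolding V_def by metis
    qed
    show "locally J c (\<lambda>f. \<exists>v. V (Dom C f) (Rst F f x) v)" if "c \<in> Ob C" "x \<in> Sec F c" for c x
      using local[OF that] that(1) by (rule locally_mono) (auto simp: V_def)
  qed blast
  define a where "a = sh_arrow C F G \<alpha>"
  have "a \<in> Hom E F G"
    unfolding a_def using sh_arrow_Hom[OF category_axioms F G \<alpha>(1)] .
  note a = this Hom_Sh[OF this]
  show "\<exists>!r. r \<in> Sec (yo E G) F \<and> (\<forall>f\<in>S. Rst (yo E G) f r = t f)"
  proof (rule ex1I[of _ a])
    have "a \<cdot>\<^bsub>E\<^esub> s = t s" if s: "s \<in> S" for s
    proof (rule arrow_eqI)
      fix c z assume c: "c \<in> Ob C" and "z \<in> Sec (Dom E (a \<cdot>\<^bsub>E\<^esub> s)) c"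
      then have z: "z \<in> Sec (Dom E s) c"
        using S_arr[OF s] a by simp
      have "component a c (component s c z) = component (t s) c z"
        using \<alpha>(2)[of c "component s c z" "component (t s) c z"] c z s S_arr[OF s]
          arrow_closed[of s C J c z]
        by (auto simp: a_def V_def)
      then show "component (a \<cdot>\<^bsub>E\<^esub> s) c z = component (t s) c z"
        using c z by (simp add: component_Comp)
    qed (use S_arr[OF s] t_arr[OF s] a in auto)
    then show "a \<in> Sec (yo E G) F \<and> (\<forall>f\<in>S. Rst (yo E G) f a = t f)"
      using a by (simp add: yo_def)
    fix b assume "b \<in> Sec (yo E G) F \<and> (\<forall>f\<in>S. Rst (yo E G) f b = t f)"
    then have "b \<in> Hom E F G" and bt: "\<And>s. s \<in> S \<Longrightarrow> b \<cdot>\<^bsub>E\<^esub> s = t s"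
      by (auto simp: yo_def)
    note b = this(1) Hom_Sh[OF this(1)]
    show "b = a"
    proof (rule arrow_eqI)
      fix c x assume c: "c \<in> Ob C" and "x \<in> Sec (Dom E b) c"
      then have x: "x \<in> Sec F c"
        using b by simp
      have "component b c x = \<alpha> c x"
      proof (rule nat_trans_eqI[OF presheaf_object[OF F] sheaf_object[OF G] b(7) \<alpha>(1) _ c x])
        show "locally J c (\<lambda>f. component b (Dom C f) (Rst F f x) = \<alpha> (Dom C f) (Rst F f x))"
        proof (rule locally_mono[OF local[OF c x] c])
          fix f assume f: "f \<in> Arr C" "Cod C f = c"
            and "reached C J S (Dom C f) (Rst F f x)"
          then obtain s y where s: "s \<in> S" "y \<in> Sec (Dom E s) (Dom C f)"
            "component s (Dom C f) y = Rst F f x"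
            by blast
          have "component b (Dom C f) (Rst F f x) = component (t s) (Dom C f) y"
            using bt[OF s(1)] s f component_Comp[of "Dom C f" C y J s b] by simp
          also have "\<dots> = \<alpha> (Dom C f) (Rst F f x)"
          proof (rule \<alpha>(2)[symmetric])
            show "V (Dom C f) (Rst F f x) (component (t s) (Dom C f) y)"
              unfolding V_def using s by (intro bexI[of _ s] bexI[of _ y]) simp_all
          qed (use f c x F in auto)
          finally show "component b (Dom C f) (Rst F f x) = \<alpha> (Dom C f) (Rst F f x)" .
        qed
      qed
      then show "component b c x = component a c x"
        using c x by (simp add: a_def)
    qed (use a b in auto)
  qed
qed

lemma epi_topology_canonical: "epi_topology C J F \<subseteq> canonical_topology E F"
  using epi_topology_grothendieck epi_topology_subcanonical unfolding canonical_topology_def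
  by blast

sublocale K: site E "epi_topology C J"
  by unfold_locales (rule epi_topology_grothendieck)

end

section \<open>Complete lattices and frames\<close>

lemma sup_in:
  assumes "complete_lattice X" "A \<subseteq> carrier X"
  shows "\<Squnion>\<^bsub>X\<^esub> A \<in> carrier X"
proof -
  interpret X: complete_lattice X by fact
  show ?thesis using assms(2) by simp
qed

lemma sup_ub:
  assumes "complete_lattice X" "A \<subseteq> carrier X" "a \<in> A"
  shows "a \<sqsubseteq>\<^bsub>X\<^esub> \<Squnion>\<^bsub>X\<^esub> A"
proof -
  interpret X: complete_lattice X by fact
  show ?thesis using assms(2,3) by (rule X.sup_upper)
qed

lemma sup_least:
  assumes "complete_lattice X" "A \<subseteq> carrier X" "u \<in> carrier X" "\<And>a. a \<in> A \<Longrightarrow> a \<sqsubseteq>\<^bsub>X\<^esub> u"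
  shows "\<Squnion>\<^bsub>X\<^esub> A \<sqsubseteq>\<^bsub>X\<^esub> u"
proof -
  interpret X: complete_lattice X by fact
  show ?thesis using assms(2-4) by (intro X.sup_least) auto
qed

lemma sup_eqI:
  assumes "partial_order X" "A \<subseteq> carrier X" "s \<in> carrier X" "\<And>a. a \<in> A \<Longrightarrow> a \<sqsubseteq>\<^bsub>X\<^esub> s"
    and "\<And>u. u \<in> carrier X \<Longrightarrow> (\<And>a. a \<in> A \<Longrightarrow> a \<sqsubseteq>\<^bsub>X\<^esub> u) \<Longrightarrow> s \<sqsubseteq>\<^bsub>X\<^esub> u"
  shows "\<Squnion>\<^bsub>X\<^esub> A = s"
proof -
  interpret X: partial_order X by fact
  have s: "least X s (Upper X A)"
    using assms(2-4) by (auto simp: least_def Upper_def intro!: assms(5))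
  then have "least X (\<Squnion>\<^bsub>X\<^esub> A) (Upper X A)"
    unfolding sup_def by (rule someI)
  then show ?thesis
    using s X.least_unique by blast
qed

lemma meet_eqI:
  assumes "partial_order X" "x \<in> carrier X" "y \<in> carrier X" "m \<in> carrier X"
    and "m \<sqsubseteq>\<^bsub>X\<^esub> x" "m \<sqsubseteq>\<^bsub>X\<^esub> y"
    and "\<And>u. u \<in> carrier X \<Longrightarrow> u \<sqsubseteq>\<^bsub>X\<^esub> x \<Longrightarrow> u \<sqsubseteq>\<^bsub>X\<^esub> y \<Longrightarrow> u \<sqsubseteq>\<^bsub>X\<^esub> m"
  shows "x \<sqinter>\<^bsub>X\<^esub> y = m"
proof -
  interpret X: partial_order X by fact
  have m: "greatest X m (Lower X {x, y})"
    using assms(2-6) by (auto simp: greatest_def Lower_def intro!: assms(7))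
  then have "greatest X (x \<sqinter>\<^bsub>X\<^esub> y) (Lower X {x, y})"
    unfolding meet_def inf_def by (rule someI)
  then show ?thesis
    using m X.greatest_unique by blast
qed

lemma top_eqI:
  assumes "partial_order X" "t \<in> carrier X" "\<And>u. u \<in> carrier X \<Longrightarrow> u \<sqsubseteq>\<^bsub>X\<^esub> t"
  shows "\<top>\<^bsub>X\<^esub> = t"
proof -
  interpret X: partial_order X by fact
  have t: "greatest X t (carrier X)"
    using assms(2,3) by (auto simp: greatest_def)
  then have "greatest X \<top>\<^bsub>X\<^esub> (carrier X)"
    unfolding top_def by (rule someI)
  then show ?thesis
    using t X.greatest_unique by blast
qed

lemma meet_in:
  assumes "complete_lattice X" "x \<in> carrier X" "y \<in> carrier X"
  shows "x \<sqinter>\<^bsub>X\<^esub> y \<in> carrier X"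
proof -
  interpret X: complete_lattice X by fact
  show ?thesis using assms(2,3) by simp
qed

lemma meet_lower:
  assumes "complete_lattice X" "x \<in> carrier X" "y \<in> carrier X"
  shows "x \<sqinter>\<^bsub>X\<^esub> y \<sqsubseteq>\<^bsub>X\<^esub> x" "x \<sqinter>\<^bsub>X\<^esub> y \<sqsubseteq>\<^bsub>X\<^esub> y"
proof -
  interpret X: complete_lattice X by fact
  show "x \<sqinter>\<^bsub>X\<^esub> y \<sqsubseteq>\<^bsub>X\<^esub> x" "x \<sqinter>\<^bsub>X\<^esub> y \<sqsubseteq>\<^bsub>X\<^esub> y"
    using assms(2,3) by (simp_all add: X.meet_left X.meet_right)
qed

lemma meet_greatest:
  assumes "complete_lattice X" "x \<in> carrier X" "y \<in> carrier X" "u \<in> carrier X"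
    "u \<sqsubseteq>\<^bsub>X\<^esub> x" "u \<sqsubseteq>\<^bsub>X\<^esub> y"
  shows "u \<sqsubseteq>\<^bsub>X\<^esub> x \<sqinter>\<^bsub>X\<^esub> y"
proof -
  interpret X: complete_lattice X by fact
  show ?thesis using assms(2-6) by (intro X.meet_le) auto
qed

lemma le_iff_meet:
  assumes "complete_lattice X" "x \<in> carrier X" "y \<in> carrier X"
  shows "x \<sqsubseteq>\<^bsub>X\<^esub> y \<longleftrightarrow> x \<sqinter>\<^bsub>X\<^esub> y = x"
proof -
  interpret X: complete_lattice X by fact
  show ?thesis using X.le_iff_join[OF assms(2,3)] by metis
qed

lemma top_in:
  assumes "complete_lattice X"
  shows "\<top>\<^bsub>X\<^esub> \<in> carrier X" "x \<in> carrier X \<Longrightarrow> x \<sqsubseteq>\<^bsub>X\<^esub> \<top>\<^bsub>X\<^esub>"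
proof -
  interpret X: complete_lattice X by fact
  show "\<top>\<^bsub>X\<^esub> \<in> carrier X" "x \<in> carrier X \<Longrightarrow> x \<sqsubseteq>\<^bsub>X\<^esub> \<top>\<^bsub>X\<^esub>"
    by (simp_all add: X.top_closed X.top_higher)
qed

text \<open>Infima are suprema of lower bounds.\<close>

lemma complete_lattice_of_sups:
  assumes "partial_order X"
    and sup: "\<And>A. A \<subseteq> carrier X \<Longrightarrow> \<exists>s\<in>carrier X. (\<forall>a\<in>A. a \<sqsubseteq>\<^bsub>X\<^esub> s) \<and>
      (\<forall>u\<in>carrier X. (\<forall>a\<in>A. a \<sqsubseteq>\<^bsub>X\<^esub> u) \<longrightarrow> s \<sqsubseteq>\<^bsub>X\<^esub> u)"
  shows "complete_lattice X"
proof -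
  interpret X: partial_order X by fact
  show ?thesis
  proof (rule X.complete_latticeI)
    fix A assume A: "A \<subseteq> carrier X"
    obtain s where "s \<in> carrier X" "\<forall>a\<in>A. a \<sqsubseteq>\<^bsub>X\<^esub> s"
        "\<forall>u\<in>carrier X. (\<forall>a\<in>A. a \<sqsubseteq>\<^bsub>X\<^esub> u) \<longrightarrow> s \<sqsubseteq>\<^bsub>X\<^esub> u"
      using sup[OF A] by blast
    moreover have "Upper X A = {u \<in> carrier X. \<forall>a\<in>A. a \<sqsubseteq>\<^bsub>X\<^esub> u}"
      using A by (auto simp: Upper_def)
    ultimately have "least X s (Upper X A)"
      by (simp add: least_def)
    then show "\<exists>s. least X s (Upper X A)" ..
    let ?B = "{u \<in> carrier X. \<forall>a\<in>A. u \<sqsubseteq>\<^bsub>X\<^esub> a}"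
    obtain s where "s \<in> carrier X" "\<forall>b\<in>?B. b \<sqsubseteq>\<^bsub>X\<^esub> s"
        "\<forall>u\<in>carrier X. (\<forall>b\<in>?B. b \<sqsubseteq>\<^bsub>X\<^esub> u) \<longrightarrow> s \<sqsubseteq>\<^bsub>X\<^esub> u"
      using sup[of ?B] by auto
    moreover have "Lower X A = ?B"
      using A by (auto simp: Lower_def)
    ultimately have "greatest X s (Lower X A)"
      using A by (auto simp: greatest_def)
    then show "\<exists>i. greatest X i (Lower X A)" ..
  qed
qed

lemma frame_complete: "frame X \<Longrightarrow> complete_lattice X"
  by (simp add: frame_def)

lemma frame_distrib:
  "frame X \<Longrightarrow> x \<in> carrier X \<Longrightarrow> A \<subseteq> carrier X \<Longrightarrow> x \<sqinter>\<^bsub>X\<^esub> \<Squnion>\<^bsub>X\<^esub> A = \<Squnion>\<^bsub>X\<^esub> ((\<lambda>a. x \<sqinter>\<^bsub>X\<^esub> a) ` A)"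
  by (simp add: frame_def)

lemma order_refl: "partial_order X \<Longrightarrow> x \<in> carrier X \<Longrightarrow> x \<sqsubseteq>\<^bsub>X\<^esub> x"
  by (simp add: partial_order_def weak_partial_order.le_refl)

lemma order_trans:
  "partial_order X \<Longrightarrow> x \<sqsubseteq>\<^bsub>X\<^esub> y \<Longrightarrow> y \<sqsubseteq>\<^bsub>X\<^esub> z \<Longrightarrow> x \<in> carrier X \<Longrightarrow> y \<in> carrier X \<Longrightarrow> z \<in> carrier X \<Longrightarrow> x \<sqsubseteq>\<^bsub>X\<^esub> z"
  unfolding partial_order_def using weak_partial_order.le_trans by metis

lemma order_antisym:
  "partial_order X \<Longrightarrow> x \<sqsubseteq>\<^bsub>X\<^esub> y \<Longrightarrow> y \<sqsubseteq>\<^bsub>X\<^esub> x \<Longrightarrow> x \<in> carrier X \<Longrightarrow> y \<in> carrier X \<Longrightarrow> x = y"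
  using partial_order.le_antisym by metis

lemma frame_hom_closed: "frame_hom X Y h \<Longrightarrow> x \<in> carrier X \<Longrightarrow> h x \<in> carrier Y"
  by (auto simp: frame_hom_def)

lemma frame_hom_sup: "frame_hom X Y h \<Longrightarrow> A \<subseteq> carrier X \<Longrightarrow> h (\<Squnion>\<^bsub>X\<^esub> A) = \<Squnion>\<^bsub>Y\<^esub> (h ` A)"
  by (auto simp: frame_hom_def sup_pres_def)

lemma frame_hom_meet:
  "frame_hom X Y h \<Longrightarrow> x \<in> carrier X \<Longrightarrow> y \<in> carrier X \<Longrightarrow> h (x \<sqinter>\<^bsub>X\<^esub> y) = h x \<sqinter>\<^bsub>Y\<^esub> h y"
  by (auto simp: frame_hom_def meet_pres_def)

lemma frame_hom_top: "frame_hom X Y h \<Longrightarrow> h \<top>\<^bsub>X\<^esub> = \<top>\<^bsub>Y\<^esub>"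
  by (simp add: frame_hom_def)

lemma frame_homI:
  assumes "complete_lattice X" "complete_lattice Y" "\<And>x. x \<in> carrier X \<Longrightarrow> h x \<in> carrier Y"
    and "\<And>A. A \<subseteq> carrier X \<Longrightarrow> h (\<Squnion>\<^bsub>X\<^esub> A) = \<Squnion>\<^bsub>Y\<^esub> (h ` A)"
    and "\<And>x y. x \<in> carrier X \<Longrightarrow> y \<in> carrier X \<Longrightarrow> h (x \<sqinter>\<^bsub>X\<^esub> y) = h x \<sqinter>\<^bsub>Y\<^esub> h y"
    and "h \<top>\<^bsub>X\<^esub> = \<top>\<^bsub>Y\<^esub>"
  shows "frame_hom X Y h"
  using assms by (simp add: frame_hom_def sup_pres_def meet_pres_def complete_lattice_lattice)

section \<open>Order isomorphisms\<close>

locale order_iso =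
  fixes X :: "'v gorder" and Y :: "'w gorder" and \<phi> :: "'v \<Rightarrow> 'w"
  assumes X: "partial_order X" and Y: "partial_order Y"
    and bij: "bij_betw \<phi> (carrier X) (carrier Y)"
    and emb: "x \<in> carrier X \<Longrightarrow> y \<in> carrier X \<Longrightarrow> \<phi> x \<sqsubseteq>\<^bsub>Y\<^esub> \<phi> y \<longleftrightarrow> x \<sqsubseteq>\<^bsub>X\<^esub> y"
begin

lemma closed [simp]: "x \<in> carrier X \<Longrightarrow> \<phi> x \<in> carrier Y"
  using bij by (auto simp: bij_betw_def)

lemma preimage: "y \<in> carrier Y \<Longrightarrow> \<exists>x\<in>carrier X. y = \<phi> x"
  using bij by (auto simp: bij_betw_def)

lemma preimage_set: "B \<subseteq> carrier Y \<Longrightarrow> \<exists>A\<subseteq>carrier X. B = \<phi> ` A"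
  using bij unfolding bij_betw_def by (metis subset_image_iff)

lemma inverse: "order_iso Y X (inv_into (carrier X) \<phi>)"
proof (rule order_iso.intro)
  show "bij_betw (inv_into (carrier X) \<phi>) (carrier Y) (carrier X)"
    using bij by (rule bij_betw_inv_into)
  show "inv_into (carrier X) \<phi> x \<sqsubseteq>\<^bsub>X\<^esub> inv_into (carrier X) \<phi> y \<longleftrightarrow> x \<sqsubseteq>\<^bsub>Y\<^esub> y"
    if "x \<in> carrier Y" "y \<in> carrier Y" for x y
    using preimage[OF that(1)] preimage[OF that(2)] bij_betw_inv_into_left[OF bij] emb by auto
qed (fact X Y)+

context
  assumes complete_X: "complete_lattice X"
begin

lemma iso_sup:
  assumes A: "A \<subseteq> carrier X"
  shows "\<phi> (\<Squnion>\<^bsub>X\<^esub> A) = \<Squnion>\<^bsub>Y\<^esub> (\<phi> ` A)"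
proof (rule sup_eqI[OF Y, symmetric])
  show "\<phi> ` A \<subseteq> carrier Y" "\<phi> (\<Squnion>\<^bsub>X\<^esub> A) \<in> carrier Y"
    using A sup_in[OF complete_X A] by auto
  show "y \<sqsubseteq>\<^bsub>Y\<^esub> \<phi> (\<Squnion>\<^bsub>X\<^esub> A)" if "y \<in> \<phi> ` A" for y
    using that A sup_in[OF complete_X A] sup_ub[OF complete_X A] emb by auto
  show "\<phi> (\<Squnion>\<^bsub>X\<^esub> A) \<sqsubseteq>\<^bsub>Y\<^esub> u" if u: "u \<in> carrier Y" "\<And>y. y \<in> \<phi> ` A \<Longrightarrow> y \<sqsubseteq>\<^bsub>Y\<^esub> u" for u
  proof -
    obtain v where v: "v \<in> carrier X" "u = \<phi> v"
      using preimage[OF u(1)] by blast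
    have "a \<sqsubseteq>\<^bsub>X\<^esub> v" if "a \<in> A" for a
      using u(2)[of "\<phi> a"] that v emb A by auto
    then show ?thesis
      using v emb sup_in[OF complete_X A] sup_least[OF complete_X A v(1)] by simp
  qed
qed

lemma iso_complete: "complete_lattice Y"
proof (rule complete_lattice_of_sups[OF Y])
  fix B assume "B \<subseteq> carrier Y"
  then obtain A where A: "A \<subseteq> carrier X" "B = \<phi> ` A"
    using preimage_set by blast
  show "\<exists>s\<in>carrier Y. (\<forall>a\<in>B. a \<sqsubseteq>\<^bsub>Y\<^esub> s) \<and> (\<forall>u\<in>carrier Y. (\<forall>a\<in>B. a \<sqsubseteq>\<^bsub>Y\<^esub> u) \<longrightarrow> s \<sqsubseteq>\<^bsub>Y\<^esub> u)"
  proof (intro bexI conjI ballI impI)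
    show "\<phi> (\<Squnion>\<^bsub>X\<^esub> A) \<in> carrier Y"
      using sup_in[OF complete_X A(1)] by simp
    show "b \<sqsubseteq>\<^bsub>Y\<^esub> \<phi> (\<Squnion>\<^bsub>X\<^esub> A)" if "b \<in> B" for b
      using that A sup_in[OF complete_X A(1)] sup_ub[OF complete_X A(1)] emb by auto
    show "\<phi> (\<Squnion>\<^bsub>X\<^esub> A) \<sqsubseteq>\<^bsub>Y\<^esub> u" if u: "u \<in> carrier Y" "\<forall>b\<in>B. b \<sqsubseteq>\<^bsub>Y\<^esub> u" for u
    proof -
      obtain v where v: "v \<in> carrier X" "u = \<phi> v"
        using preimage[OF u(1)] by blast
      have "a \<sqsubseteq>\<^bsub>X\<^esub> v" if "a \<in> A" for a
        using bspec[OF u(2), of "\<phi> a"] that v emb[of a v] A by auto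
      then show ?thesis
        using v emb sup_in[OF complete_X A(1)] sup_least[OF complete_X A(1) v(1)] by simp
    qed
  qed
qed

lemma iso_meet:
  assumes x: "x \<in> carrier X" "y \<in> carrier X"
  shows "\<phi> (x \<sqinter>\<^bsub>X\<^esub> y) = \<phi> x \<sqinter>\<^bsub>Y\<^esub> \<phi> y"
proof (rule meet_eqI[OF Y, symmetric])
  show "u \<sqsubseteq>\<^bsub>Y\<^esub> \<phi> (x \<sqinter>\<^bsub>X\<^esub> y)" if "u \<in> carrier Y" "u \<sqsubseteq>\<^bsub>Y\<^esub> \<phi> x" "u \<sqsubseteq>\<^bsub>Y\<^esub> \<phi> y" for u
    using preimage[OF that(1)] that x emb meet_in[OF complete_X x] meet_greatest[OF complete_X x]
    by auto
qed (use x emb meet_in[OF complete_X x] meet_lower[OF complete_X x] in auto)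

lemma iso_top: "\<phi> \<top>\<^bsub>X\<^esub> = \<top>\<^bsub>Y\<^esub>"
proof (rule top_eqI[OF Y, symmetric])
  show "u \<sqsubseteq>\<^bsub>Y\<^esub> \<phi> \<top>\<^bsub>X\<^esub>" if "u \<in> carrier Y" for u
    using preimage[OF that] emb top_in[OF complete_X] by auto
qed (simp add: top_in[OF complete_X])

end

lemma iso_frame:
  assumes "frame X"
  shows "frame Y"
  unfolding frame_def
proof (intro conjI ballI allI impI)
  note complete_X = frame_complete[OF assms]
  show "complete_lattice Y"
    using iso_complete[OF complete_X] .
  fix y B assume "y \<in> carrier Y" "B \<subseteq> carrier Y"
  then obtain x A where x: "x \<in> carrier X" "y = \<phi> x" and A: "A \<subseteq> carrier X" "B = \<phi> ` A"
    using preimage preimage_set by meson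
  have "y \<sqinter>\<^bsub>Y\<^esub> \<Squnion>\<^bsub>Y\<^esub> B = \<phi> (x \<sqinter>\<^bsub>X\<^esub> \<Squnion>\<^bsub>X\<^esub> A)"
    using x A sup_in[OF complete_X A(1)] by (simp add: iso_sup[OF complete_X]
      iso_meet[OF complete_X])
  also have "\<dots> = \<Squnion>\<^bsub>Y\<^esub> (\<phi> ` (\<lambda>a. x \<sqinter>\<^bsub>X\<^esub> a) ` A)"
  proof -
    have "(\<lambda>a. x \<sqinter>\<^bsub>X\<^esub> a) ` A \<subseteq> carrier X"
      using x A meet_in[OF complete_X] by auto
    from iso_sup[OF complete_X this] show ?thesis
      using x A by (simp add: frame_distrib[OF assms])
  qed
  also have "\<phi> ` (\<lambda>a. x \<sqinter>\<^bsub>X\<^esub> a) ` A = (\<lambda>b. y \<sqinter>\<^bsub>Y\<^esub> b) ` B"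
    using x A by (force simp: iso_meet[OF complete_X] image_image)
  finally show "y \<sqinter>\<^bsub>Y\<^esub> \<Squnion>\<^bsub>Y\<^esub> B = \<Squnion>\<^bsub>Y\<^esub> ((\<lambda>b. y \<sqinter>\<^bsub>Y\<^esub> b) ` B)" .
qed

end

lemma frame_hom_transport:
  assumes \<phi>: "order_iso X Y \<phi>" and \<phi>': "order_iso X' Y' \<phi>'" and h: "frame_hom X X' h"
    and k: "\<And>x. x \<in> carrier X \<Longrightarrow> k (\<phi> x) = \<phi>' (h x)"
  shows "frame_hom Y Y' k"
proof -
  interpret \<phi>: order_iso X Y \<phi> by fact
  interpret \<phi>': order_iso X' Y' \<phi>' by fact
  have X: "complete_lattice X" "complete_lattice X'"
    using h by (auto simp: frame_hom_def sup_pres_def)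
  show ?thesis
  proof (rule frame_homI[OF \<phi>.iso_complete[OF X(1)] \<phi>'.iso_complete[OF X(2)]])
    show "k y \<in> carrier Y'" if y: "y \<in> carrier Y" for y
    proof -
      obtain x where x: "x \<in> carrier X" "y = \<phi> x"
        using \<phi>.preimage[OF y] by blast
      then show ?thesis
        using k[OF x(1)] \<phi>'.closed[OF frame_hom_closed[OF h x(1)]] by simp
    qed
    show "k (\<Squnion>\<^bsub>Y\<^esub> B) = \<Squnion>\<^bsub>Y'\<^esub> (k ` B)" if B: "B \<subseteq> carrier Y" for B
    proof -
      obtain A where A: "A \<subseteq> carrier X" "B = \<phi> ` A"
        using \<phi>.preimage_set[OF B] by blast
      have "h ` A \<subseteq> carrier X'"
        using A(1) frame_hom_closed[OF h] by (intro image_subsetI) blast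
      moreover have "\<phi>' ` h ` A = k ` B"
        unfolding A(2) image_image using A(1) k by (intro image_cong) auto
      moreover have "k (\<phi> (\<Squnion>\<^bsub>X\<^esub> A)) = \<phi>' (\<Squnion>\<^bsub>X'\<^esub> (h ` A))"
        using k[OF sup_in[OF X(1) A(1)]] frame_hom_sup[OF h A(1)] by simp
      ultimately show ?thesis
        using \<phi>.iso_sup[OF X(1) A(1)] \<phi>'.iso_sup[OF X(2), of "h ` A"] A(2) by simp
    qed
    show "k (x \<sqinter>\<^bsub>Y\<^esub> y) = k x \<sqinter>\<^bsub>Y'\<^esub> k y" if "x \<in> carrier Y" "y \<in> carrier Y" for x y
    proof -
      obtain v w where "v \<in> carrier X" "w \<in> carrier X" "x = \<phi> v" "y = \<phi> w"
        using \<phi>.preimage \<open>x \<in> carrier Y\<close> \<open>y \<in> carrier Y\<close> by meson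
      then show ?thesis
        using \<phi>.iso_meet[OF X(1), of v w] k[of v] k[of w] k[OF meet_in[OF X(1), of v w]]
          frame_hom_meet[OF h, of v w] \<phi>'.iso_meet[OF X(2), of "h v" "h w"] frame_hom_closed[OF h]
        by simp
    qed
    show "k \<top>\<^bsub>Y\<^esub> = \<top>\<^bsub>Y'\<^esub>"
      using \<phi>.iso_top[OF X(1)] k[OF top_in(1)[OF X(1)]] frame_hom_top[OF h] \<phi>'.iso_top[OF X(2)]
      by simp
  qed
qed

section \<open>Functors into posets\<close>

lemma pos_functor_presheaf: "pos_functor C L \<Longrightarrow> presheaf C (underlying L)"
  by (simp add: pos_functor_def)

lemma pos_functor_order: "pos_functor C L \<Longrightarrow> c \<in> Ob C \<Longrightarrow> partial_order (Fib L c)"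
  by (simp add: pos_functor_def)

lemma Tr_closed:
  "pos_functor C L \<Longrightarrow> f \<in> Arr C \<Longrightarrow> x \<in> carrier (Fib L (Cod C f)) \<Longrightarrow>
    Tr L f x \<in> carrier (Fib L (Dom C f))"
  using presheaf_closed[OF pos_functor_presheaf, of C L f x] by (simp add: underlying_def)

lemma Tr_mono:
  "pos_functor C L \<Longrightarrow> f \<in> Arr C \<Longrightarrow> x \<in> carrier (Fib L (Cod C f)) \<Longrightarrow> y \<in> carrier (Fib L (Cod C f)) \<Longrightarrow>
    x \<sqsubseteq>\<^bsub>Fib L (Cod C f)\<^esub> y \<Longrightarrow> Tr L f x \<sqsubseteq>\<^bsub>Fib L (Dom C f)\<^esub> Tr L f y"
  by (simp add: pos_functor_def isotone_def)

lemma Tr_Comp: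
  "pos_functor C L \<Longrightarrow> f \<in> Arr C \<Longrightarrow> g \<in> Arr C \<Longrightarrow> Cod C g = Dom C f \<Longrightarrow> x \<in> carrier (Fib L (Cod C f)) \<Longrightarrow>
    Tr L (f \<cdot>\<^bsub>C\<^esub> g) x = Tr L g (Tr L f x)"
  using presheaf_Comp[OF pos_functor_presheaf, of C L f g x] by (simp add: underlying_def)

text \<open>The condition \<open>frame_functor\<close> without the size condition, which would refer to the type of the
  elements of the frames and hence is not invariant under a change of this type.\<close>

definition frame_valued :: "('o, 'a) cat \<Rightarrow> ('o, 'a, 'v) pos_psh \<Rightarrow> bool" where
  "frame_valued C L \<longleftrightarrow> pos_functor C L \<and> (\<forall>c\<in>Ob C. frame (Fib L c)) \<and>
     (\<forall>f\<in>Arr C. frame_hom (Fib L (Cod C f)) (Fib L (Dom C f)) (Tr L f))"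

lemma frame_functor_iff:
  "frame_functor C (L :: ('o, 'a, 'v) pos_psh) \<longleftrightarrow>
     frame_valued C L \<and> (\<forall>c\<in>Ob C. small TYPE('v) (carrier (Fib L c)))"
  by (auto simp: frame_functor_def frame_valued_def)

lemma left_adjoint_closed:
  "left_adjoints C L ex \<Longrightarrow> a \<in> Arr C \<Longrightarrow> x \<in> carrier (Fib L (Dom C a)) \<Longrightarrow>
    ex a x \<in> carrier (Fib L (Cod C a))"
  using connection.lower_closed[OF galois_connection.axioms(1)]
  by (fastforce simp: left_adjoints_def)

lemma left_adjoint_iff:
  assumes "left_adjoints C L ex" "a \<in> Arr C" "x \<in> carrier (Fib L (Dom C a))"
    "y \<in> carrier (Fib L (Cod C a))"
  shows "ex a x \<sqsubseteq>\<^bsub>Fib L (Cod C a)\<^esub> y \<longleftrightarrow> x \<sqsubseteq>\<^bsub>Fib L (Dom C a)\<^esub> Tr L a y"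
proof -
  interpret galois_connection
    "\<lparr>orderA = Fib L (Dom C a), orderB = Fib L (Cod C a), lower = ex a, upper = Tr L a\<rparr>"
    using assms by (simp add: left_adjoints_def)
  show ?thesis
    using galois_property[of x y] assms by simp
qed

lemma left_adjoint_unit:
  assumes "left_adjoints C L ex" "category C" "pos_functor C L" "a \<in> Arr C"
    "x \<in> carrier (Fib L (Dom C a))"
  shows "x \<sqsubseteq>\<^bsub>Fib L (Dom C a)\<^esub> Tr L a (ex a x)"
proof -
  interpret category C by fact
  show ?thesis
    using left_adjoint_iff[OF assms(1,4,5) left_adjoint_closed[OF assms(1,4,5)]]
      order_refl[OF pos_functor_order[OF assms(3)] left_adjoint_closed[OF assms(1,4,5)]] assms(4)
    by simp
qed

lemma left_adjointsI:
  assumes "category C" "pos_functor C L"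
    and "\<And>a x. a \<in> Arr C \<Longrightarrow> x \<in> carrier (Fib L (Dom C a)) \<Longrightarrow> ex a x \<in> carrier (Fib L (Cod C a))"
    and "\<And>a x y. a \<in> Arr C \<Longrightarrow> x \<in> carrier (Fib L (Dom C a)) \<Longrightarrow> y \<in> carrier (Fib L (Cod C a)) \<Longrightarrow>
      ex a x \<sqsubseteq>\<^bsub>Fib L (Cod C a)\<^esub> y \<longleftrightarrow> x \<sqsubseteq>\<^bsub>Fib L (Dom C a)\<^esub> Tr L a y"
  shows "left_adjoints C L ex"
proof -
  interpret category C by fact
  show ?thesis
    unfolding left_adjoints_def
    by (intro ballI galois_connection.intro connection.intro galois_connection_axioms.intro)
      (use assms in \<open>auto simp: pos_functor_order Tr_closed\<close>)
qed

text \<open>The order of a frame is determined by its meets, which frame homomorphisms preserve, so that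
  a family of arrows that separates elements also detects the order.\<close>

lemma order_detected:
  assumes "frame_valued C L" "c \<in> Ob C" "x \<in> carrier (Fib L c)" "y \<in> carrier (Fib L c)"
    and S: "\<And>f. f \<in> S \<Longrightarrow> f \<in> Arr C \<and> Cod C f = c"
    and sep: "\<And>z w. z \<in> carrier (Fib L c) \<Longrightarrow> w \<in> carrier (Fib L c) \<Longrightarrow>
      (\<And>f. f \<in> S \<Longrightarrow> Tr L f z = Tr L f w) \<Longrightarrow> z = w"
    and le: "\<And>f. f \<in> S \<Longrightarrow> Tr L f x \<sqsubseteq>\<^bsub>Fib L (Dom C f)\<^esub> Tr L f y"
    and Dom: "\<And>f. f \<in> S \<Longrightarrow> Dom C f \<in> Ob C"
  shows "x \<sqsubseteq>\<^bsub>Fib L c\<^esub> y"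
proof -
  have pos: "pos_functor C L" and fr: "\<And>c. c \<in> Ob C \<Longrightarrow> frame (Fib L c)"
    using assms(1) by (auto simp: frame_valued_def)
  note complete = frame_complete[OF fr]
  have "x \<sqinter>\<^bsub>Fib L c\<^esub> y = x"
  proof (rule sep)
    fix f assume f: "f \<in> S"
    then have "Tr L f (x \<sqinter>\<^bsub>Fib L c\<^esub> y) = Tr L f x \<sqinter>\<^bsub>Fib L (Dom C f)\<^esub> Tr L f y"
      using S[OF f] assms(1,3,4) frame_hom_meet[of "Fib L c" "Fib L (Dom C f)" "Tr L f" x y]
      by (auto simp: frame_valued_def)
    also have "\<dots> = Tr L f x"
      using le[OF f] le_iff_meet[OF complete[OF Dom[OF f]]] Tr_closed[OF pos] S[OF f] assms(3,4)
      by auto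
    finally show "Tr L f (x \<sqinter>\<^bsub>Fib L c\<^esub> y) = Tr L f x" .
  qed (use assms(3,4) meet_in[OF complete[OF assms(2)]] in auto)
  then show ?thesis
    using le_iff_meet[OF complete[OF assms(2)]] assms(3,4) by blast
qed

section \<open>Transport along isomorphisms of functors into posets\<close>

locale pos_iso = category C for C :: "('o, 'a) cat" (structure) +
  fixes L :: "('o, 'a, 'v) pos_psh" and L' :: "('o, 'a, 'w) pos_psh" and \<phi> :: "'o \<Rightarrow> 'v \<Rightarrow> 'w"
  assumes L: "pos_functor C L" and L': "pos_functor C L'"
    and nat: "nat_trans C (underlying L) (underlying L') \<phi>"
    and iso: "c \<in> Ob C \<Longrightarrow> order_iso (Fib L c) (Fib L' c) (\<phi> c)"
begin

lemma Tr_iso: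
  "f \<in> Arr C \<Longrightarrow> x \<in> carrier (Fib L (Cod C f)) \<Longrightarrow> Tr L' f (\<phi> (Cod C f) x) = \<phi> (Dom C f) (Tr L f x)"
  using nat_trans_natural[OF nat, of f x] by (simp add: underlying_def)

lemma iso_closed [simp]: "c \<in> Ob C \<Longrightarrow> x \<in> carrier (Fib L c) \<Longrightarrow> \<phi> c x \<in> carrier (Fib L' c)"
  using order_iso.closed[OF iso] .

lemma iso_preimage: "c \<in> Ob C \<Longrightarrow> y \<in> carrier (Fib L' c) \<Longrightarrow> \<exists>x\<in>carrier (Fib L c). y = \<phi> c x"
  using order_iso.preimage[OF iso] .

lemma iso_le:
  "c \<in> Ob C \<Longrightarrow> x \<in> carrier (Fib L c) \<Longrightarrow> y \<in> carrier (Fib L c) \<Longrightarrow>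
    \<phi> c x \<sqsubseteq>\<^bsub>Fib L' c\<^esub> \<phi> c y \<longleftrightarrow> x \<sqsubseteq>\<^bsub>Fib L c\<^esub> y"
  using order_iso.emb[OF iso] .

lemma inverse: "pos_iso C L' L (\<lambda>c. inv_into (carrier (Fib L c)) (\<phi> c))"
proof (intro pos_iso.intro pos_iso_axioms.intro)
  show "nat_trans C (underlying L') (underlying L) (\<lambda>c. inv_into (carrier (Fib L c)) (\<phi> c))"
    using nat_trans_inverse[OF nat category_axioms pos_functor_presheaf[OF L]] order_iso.bij[OF iso]
    by (simp add: underlying_def)
qed (use L L' order_iso.inverse[OF iso] category_axioms in auto)

lemma frame_valued_iso:
  assumes "frame_valued C L"
  shows "frame_valued C L'"
  unfolding frame_valued_def
proof (intro conjI ballI)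
  show "frame (Fib L' c)" if "c \<in> Ob C" for c
    using order_iso.iso_frame[OF iso[OF that]] assms that by (simp add: frame_valued_def)
  show "frame_hom (Fib L' (Cod C f)) (Fib L' (Dom C f)) (Tr L' f)" if "f \<in> Arr C" for f
  proof (rule frame_hom_transport[OF iso iso])
    show "frame_hom (Fib L (Cod C f)) (Fib L (Dom C f)) (Tr L f)"
      using assms that by (simp add: frame_valued_def)
  qed (use that Tr_iso in auto)
qed (fact L')

definition ex_iso :: "('a \<Rightarrow> 'v \<Rightarrow> 'v) \<Rightarrow> 'a \<Rightarrow> 'w \<Rightarrow> 'w" where
  "ex_iso ex a y = \<phi> (Cod C a) (ex a (inv_into (carrier (Fib L (Dom C a))) (\<phi> (Dom C a)) y))"

lemma ex_iso:
  "a \<in> Arr C \<Longrightarrow> x \<in> carrier (Fib L (Dom C a)) \<Longrightarrow> ex_iso ex a (\<phi> (Dom C a) x) = \<phi> (Cod C a) (ex a x)"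
  using bij_betw_inv_into_left[OF order_iso.bij[OF iso]] by (simp add: ex_iso_def)

context
  fixes ex assumes adj: "left_adjoints C L ex"
begin

lemma left_adjoints_iso: "left_adjoints C L' (ex_iso ex)"
proof (rule left_adjointsI[OF category_axioms L'])
  show "ex_iso ex a y \<in> carrier (Fib L' (Cod C a))" if "a \<in> Arr C"
    "y \<in> carrier (Fib L' (Dom C a))" for a y
    using iso_preimage[OF _ that(2)] that left_adjoint_closed[OF adj] by (auto simp: ex_iso)
  show "ex_iso ex a x \<sqsubseteq>\<^bsub>Fib L' (Cod C a)\<^esub> y \<longleftrightarrow> x \<sqsubseteq>\<^bsub>Fib L' (Dom C a)\<^esub> Tr L' a y"
    if a: "a \<in> Arr C" and xy: "x \<in> carrier (Fib L' (Dom C a))"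
      "y \<in> carrier (Fib L' (Cod C a))" for a x y
  proof -
    obtain v w where "v \<in> carrier (Fib L (Dom C a))" "x = \<phi> (Dom C a) v"
        "w \<in> carrier (Fib L (Cod C a))" "y = \<phi> (Cod C a) w"
      using iso_preimage[OF Dom_Ob[OF a] xy(1)] iso_preimage[OF Cod_Ob[OF a] xy(2)] by blast
    then show ?thesis
      using a left_adjoint_iff[OF adj a, of v w] left_adjoint_closed[OF adj a, of v]
        Tr_closed[OF L a, of w]
      by (simp add: ex_iso Tr_iso iso_le)
  qed
qed

lemma frobenius_iso:
  assumes "frame_valued C L" "frobenius C L ex"
  shows "frobenius C L' (ex_iso ex)"
  unfolding frobenius_def
proof (intro ballI)
  fix a x y assume a: "a \<in> Arr C" and xy: "x \<in> carrier (Fib L' (Dom C a))"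
    "y \<in> carrier (Fib L' (Cod C a))"
  obtain v w where vw: "v \<in> carrier (Fib L (Dom C a))" "x = \<phi> (Dom C a) v"
      "w \<in> carrier (Fib L (Cod C a))" "y = \<phi> (Cod C a) w"
    using iso_preimage[OF Dom_Ob[OF a] xy(1)] iso_preimage[OF Cod_Ob[OF a] xy(2)] by blast
  have complete: "complete_lattice (Fib L c)" if "c \<in> Ob C" for c
    using assms(1) that by (simp add: frame_valued_def frame_complete)
  have "ex_iso ex a (Tr L' a y \<sqinter>\<^bsub>Fib L' (Dom C a)\<^esub> x)
    = \<phi> (Cod C a) (ex a (Tr L a w \<sqinter>\<^bsub>Fib L (Dom C a)\<^esub> v))"
    using a vw Tr_closed[OF L a] complete
    by (simp add: Tr_iso ex_iso meet_in flip: order_iso.iso_meet[OF iso complete])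
  also have "\<dots> = \<phi> (Cod C a) (ex a v \<sqinter>\<^bsub>Fib L (Cod C a)\<^esub> w)"
    using assms(2) a vw by (simp add: frobenius_def)
  also have "\<dots> = ex_iso ex a x \<sqinter>\<^bsub>Fib L' (Cod C a)\<^esub> y"
    using a vw complete left_adjoint_closed[OF adj a]
    by (simp add: ex_iso order_iso.iso_meet[OF iso])
  finally show "ex_iso ex a (Tr L' a y \<sqinter>\<^bsub>Fib L' (Dom C a)\<^esub> x)
    = ex_iso ex a x \<sqinter>\<^bsub>Fib L' (Cod C a)\<^esub> y" .
qed

lemma beck_chevalley_iso:
  assumes "beck_chevalley C L ex"
  shows "beck_chevalley C L' (ex_iso ex)"
  unfolding beck_chevalley_def
proof (intro allI impI ballI)
  fix a b c d y assume pb: "is_pullback C a b c d" and y: "y \<in> carrier (Fib L' (Dom C c))"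
  then have arr: "a \<in> Arr C" "b \<in> Arr C" "c \<in> Arr C" "d \<in> Arr C" "Dom C a = Dom C b"
    "Cod C a = Dom C c"
      "Cod C b = Dom C d" "Cod C c = Cod C d"
    by (auto simp: is_pullback_def spans_def)
  obtain x where x: "x \<in> carrier (Fib L (Dom C c))" "y = \<phi> (Dom C c) x"
    using iso_preimage[OF _ y] arr by auto
  have "ex_iso ex b (Tr L' a y) = \<phi> (Cod C b) (ex b (Tr L a x))"
    using Tr_iso[of a x] ex_iso[of b "Tr L a x"] Tr_closed[OF L, of a x] arr x by simp
  also have "\<dots> = \<phi> (Dom C d) (Tr L d (ex c x))"
    using assms pb x arr by (simp add: beck_chevalley_def)
  also have "\<dots> = Tr L' d (ex_iso ex c y)"
    using Tr_iso[of d "ex c x"] ex_iso[of c x] left_adjoint_closed[OF adj, of c x] arr x by simp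
  finally show "ex_iso ex b (Tr L' a y) = Tr L' d (ex_iso ex c y)" .
qed

lemma relative_beck_chevalley_iso:
  assumes "frame_valued C L" "relative_beck_chevalley C L ex"
  shows "relative_beck_chevalley C L' (ex_iso ex)"
  unfolding relative_beck_chevalley_def
proof (intro ballI impI)
  fix c d y assume cd: "c \<in> Arr C" "d \<in> Arr C" "Cod C c = Cod C d"
    and y: "y \<in> carrier (Fib L' (Dom C c))"
  obtain x where x: "x \<in> carrier (Fib L (Dom C c))" "y = \<phi> (Dom C c) x"
    using iso_preimage[OF _ y] cd by auto
  have complete: "complete_lattice (Fib L (Dom C d))"
    using assms(1) cd by (simp add: frame_valued_def frame_complete)
  have span: "ex b (Tr L a x) \<in> carrier (Fib L (Dom C d)) \<and>
      ex_iso ex b (Tr L' a y) = \<phi> (Dom C d) (ex b (Tr L a x))" if "(a, b) \<in> spans C c d" for a b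
  proof -
    have arr: "a \<in> Arr C" "b \<in> Arr C" "Dom C a = Dom C b" "Cod C a = Dom C c" "Cod C b = Dom C d"
      using that by (auto simp: spans_def)
    show ?thesis
      using Tr_iso[of a x] ex_iso[of b "Tr L a x"] Tr_closed[OF L, of a x]
        left_adjoint_closed[OF adj, of b "Tr L a x"] arr x
      by simp
  qed
  have "Tr L' d (ex_iso ex c y) = \<phi> (Dom C d) (Tr L d (ex c x))"
    using Tr_iso[of d "ex c x"] ex_iso[of c x] left_adjoint_closed[OF adj, of c x] cd x by simp
  also have "\<dots> = \<phi> (Dom C d) (\<Squnion>\<^bsub>Fib L (Dom C d)\<^esub> ((\<lambda>(a, b). ex b (Tr L a x)) ` spans C c d))"
    using assms(2) cd x by (simp add: relative_beck_chevalley_def)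
  also have "\<dots> = \<Squnion>\<^bsub>Fib L' (Dom C d)\<^esub> (\<phi> (Dom C d) ` (\<lambda>(a, b). ex b (Tr L a x)) ` spans C c d)"
    using cd span by (intro order_iso.iso_sup[OF iso complete]) auto
  also have "\<phi> (Dom C d) ` (\<lambda>(a, b). ex b (Tr L a x)) ` spans C c d
      = (\<lambda>(a, b). ex_iso ex b (Tr L' a y)) ` spans C c d"
    unfolding image_image using span by (intro image_cong) auto
  finally show "Tr L' d (ex_iso ex c y)
      = \<Squnion>\<^bsub>Fib L' (Dom C d)\<^esub> ((\<lambda>(a, b). ex_iso ex b (Tr L' a y)) ` spans C c d)" .
qed

end

end

lemma pos_functor_iso_iff:
  assumes "category C"
  shows "pos_functor_iso C L L' \<longleftrightarrow> (\<exists>\<phi>. pos_iso C L L' \<phi>)"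
proof
  assume "pos_functor_iso C L L'"
  then obtain \<phi> where "pos_functor C L" "pos_functor C L'"
    "nat_trans C (underlying L) (underlying L') \<phi>"
    "\<And>c. c \<in> Ob C \<Longrightarrow> bij_betw (\<phi> c) (carrier (Fib L c)) (carrier (Fib L' c)) \<and>
      order_emb (Fib L c) (Fib L' c) (\<phi> c)"
    unfolding pos_functor_iso_def by blast
  then have "pos_iso C L L' \<phi>"
    by (auto simp: pos_iso_def pos_iso_axioms_def order_iso_def pos_functor_order order_emb_def assms)
  then show "\<exists>\<phi>. pos_iso C L L' \<phi>"
    by (intro exI[of _ \<phi>])
next
  assume "\<exists>\<phi>. pos_iso C L L' \<phi>"
  then obtain \<phi> where "pos_iso C L L' \<phi>"
    by (rule exE)
  then interpret pos_iso C L L' \<phi> .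
  have "order_emb (Fib L c) (Fib L' c) (\<phi> c)" if "c \<in> Ob C" for c
    using iso[OF that] that by (auto simp: order_iso_def order_emb_def partial_order_def)
  then show "pos_functor_iso C L L'"
    using L L' nat order_iso.bij[OF iso] unfolding pos_functor_iso_def by blast
qed

lemma pos_iso_compose:
  assumes "pos_iso C L L' \<phi>" "pos_iso C L' L'' \<psi>"
  shows "pos_iso C L L'' (\<lambda>c x. \<psi> c (\<phi> c x))"
proof -
  interpret \<phi>: pos_iso C L L' \<phi> by fact
  interpret \<psi>: pos_iso C L' L'' \<psi> by fact
  show ?thesis
  proof (intro pos_iso.intro pos_iso_axioms.intro)
    show "nat_trans C (underlying L) (underlying L'') (\<lambda>c x. \<psi> c (\<phi> c x))"
      using \<phi>.nat \<psi>.nat by (auto simp: nat_trans_def Pi_iff)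
    fix c assume c: "c \<in> Ob C"
    show "order_iso (Fib L c) (Fib L'' c) (\<lambda>x. \<psi> c (\<phi> c x))"
    proof (rule order_iso.intro)
      show "bij_betw (\<lambda>x. \<psi> c (\<phi> c x)) (carrier (Fib L c)) (carrier (Fib L'' c))"
        using bij_betw_trans[OF order_iso.bij[OF \<phi>.iso[OF c]] order_iso.bij[OF \<psi>.iso[OF c]]]
        by (simp add: comp_def)
    qed (use c pos_functor_order[OF \<phi>.L c] pos_functor_order[OF \<psi>.L' c]
      in \<open>auto simp: \<phi>.iso_le \<psi>.iso_le\<close>)
  qed (fact \<phi>.L \<psi>.L' \<phi>.category_axioms)+
qed

lemma pos_functor_precompose:
  assumes "pos_functor E M" "category C" "is_functor C E F"
  shows "pos_functor C (precompose M F)"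
proof -
  interpret C: category C by fact
  have F: "FOb F c \<in> Ob E" if "c \<in> Ob C" for c
    using assms(3) that by (simp add: is_functor_def)
  have F_arr: "FArr F f \<in> Arr E" "Dom E (FArr F f) = FOb F (Dom C f)"
    "Cod E (FArr F f) = FOb F (Cod C f)"
    if "f \<in> Arr C" for f
    using assms(3) that by (auto simp: is_functor_def Hom_def)
  have "presheaf C (underlying (precompose M F))"
    unfolding presheaf_def
  proof (intro conjI ballI impI Pi_I)
    fix f x assume "f \<in> Arr C" "x \<in> Sec (underlying (precompose M F)) (Cod C f)"
    then show "Rst (underlying (precompose M F)) f x \<in> Sec (underlying (precompose M F)) (Dom C f)"
      using Tr_closed[OF assms(1) F_arr(1), of f x] F_arr
      by (simp add: underlying_def precompose_def)
  next
    fix c x assume c: "c \<in> Ob C" and "x \<in> Sec (underlying (precompose M F)) c"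
    then show "Rst (underlying (precompose M F)) (Id C c) x = x"
      using presheaf_Id[OF pos_functor_presheaf[OF assms(1)] F[OF c]] assms(3)
      by (simp add: is_functor_def underlying_def precompose_def)
  next
    fix f g x assume "f \<in> Arr C" "g \<in> Arr C" "Cod C g = Dom C f"
      and "x \<in> Sec (underlying (precompose M F)) (Cod C f)"
    then show "Rst (underlying (precompose M F)) (f \<cdot>\<^bsub>C\<^esub> g) x
        = Rst (underlying (precompose M F)) g (Rst (underlying (precompose M F)) f x)"
      using Tr_Comp[OF assms(1) F_arr(1) F_arr(1), of f g x] assms(3) F_arr
      by (simp add: is_functor_def underlying_def precompose_def)
  qed
  moreover have "isotone (Fib (precompose M F) (Cod C f)) (Fib (precompose M F) (Dom C f)) (Tr (precompose M F) f)"
    if "f \<in> Arr C" for f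
  proof -
    have "isotone (Fib M (Cod E (FArr F f))) (Fib M (Dom E (FArr F f))) (Tr M (FArr F f))"
      using assms(1) F_arr(1)[OF that] by (simp add: pos_functor_def)
    then show ?thesis
      using F_arr[OF that] by (simp add: precompose_def)
  qed
  ultimately show ?thesis
    using pos_functor_order[OF assms(1) F] by (simp add: pos_functor_def) (simp add: precompose_def)
qed

lemma pos_iso_precompose:
  assumes "pos_iso E M M' \<phi>" "category C" "is_functor C E F"
  shows "pos_iso C (precompose M F) (precompose M' F) (\<lambda>c. \<phi> (FOb F c))"
proof -
  interpret pos_iso E M M' \<phi> by fact
  interpret C: category C by fact
  have F: "FOb F c \<in> Ob E" if "c \<in> Ob C" for c
    using assms(3) that by (simp add: is_functor_def)
  have F_arr: "FArr F f \<in> Arr E" "Dom E (FArr F f) = FOb F (Dom C f)"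
    "Cod E (FArr F f) = FOb F (Cod C f)"
    if "f \<in> Arr C" for f
    using assms(3) that by (auto simp: is_functor_def Hom_def)
  show ?thesis
  proof (intro pos_iso.intro pos_iso_axioms.intro)
    show "nat_trans C (underlying (precompose M F)) (underlying (precompose M' F)) (\<lambda>c. \<phi> (FOb F c))"
      unfolding nat_trans_def
    proof (intro conjI ballI Pi_I)
      fix c x assume "c \<in> Ob C" "x \<in> Sec (underlying (precompose M F)) c"
      then show "\<phi> (FOb F c) x \<in> Sec (underlying (precompose M' F)) c"
        using iso_closed[OF F] by (simp add: underlying_def precompose_def)
    next
      fix f x assume "f \<in> Arr C" "x \<in> Sec (underlying (precompose M F)) (Cod C f)"
      then show "\<phi> (FOb F (Dom C f)) (Rst (underlying (precompose M F)) f x)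
          = Rst (underlying (precompose M' F)) f (\<phi> (FOb F (Cod C f)) x)"
        using Tr_iso[OF F_arr(1), of f x] F_arr by (simp add: underlying_def precompose_def)
    qed
    show "order_iso (Fib (precompose M F) c) (Fib (precompose M' F) c) (\<phi> (FOb F c))"
      if "c \<in> Ob C" for c
      using iso[OF F[OF that]] by (simp add: precompose_def)
  qed (use pos_functor_precompose[OF _ assms(2,3)] L L' C.category_axioms in auto)
qed

lemma encode_pos_functor:
  fixes N :: "('o, 'a, 'v) pos_psh"
  assumes "category C" "pos_functor C N" "\<And>c. c \<in> Ob C \<Longrightarrow> small TYPE('u) (carrier (Fib N c))"
  obtains M :: "('o, 'a, 'u) pos_psh" and \<phi> where "pos_iso C N M \<phi>"
    "\<And>c. c \<in> Ob C \<Longrightarrow> small TYPE('u) (carrier (Fib M c))"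
proof -
  interpret category C by fact
  have "\<forall>c\<in>Ob C. \<exists>g :: 'v \<Rightarrow> 'u. inj_on g (carrier (Fib N c))"
    using small_embedding[OF assms(3)] by metis
  then obtain \<epsilon> :: "'o \<Rightarrow> 'v \<Rightarrow> 'u" where \<epsilon>: "\<And>c. c \<in> Ob C \<Longrightarrow> inj_on (\<epsilon> c) (carrier (Fib N c))"
    by metis
  define \<delta> where "\<delta> c = inv_into (carrier (Fib N c)) (\<epsilon> c)" for c
  have \<delta>\<epsilon> [simp]: "\<delta> c (\<epsilon> c x) = x" if "c \<in> Ob C" "x \<in> carrier (Fib N c)" for c x
    using \<epsilon> that by (simp add: \<delta>_def)
  define M where "M = \<lparr>Fib = (\<lambda>c. \<lparr>carrier = \<epsilon> c ` carrier (Fib N c), eq = (=),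
      le = (\<lambda>x y. \<delta> c x \<sqsubseteq>\<^bsub>Fib N c\<^esub> \<delta> c y)\<rparr>),
    Tr = (\<lambda>f y. \<epsilon> (Dom C f) (Tr N f (\<delta> (Cod C f) y)))\<rparr>"
  have nat: "nat_trans C (underlying N) (underlying M) \<epsilon>"
    using assms(2) by (auto simp: nat_trans_def underlying_def M_def)
  have order: "partial_order (Fib M c)" if c: "c \<in> Ob C" for c
  proof -
    interpret N: partial_order "Fib N c"
      using pos_functor_order[OF assms(2) c] .
    show ?thesis
      by unfold_locales (auto simp: M_def c intro: N.le_trans arg_cong[OF N.le_antisym])
  qed
  have iso: "order_iso (Fib N c) (Fib M c) (\<epsilon> c)" if c: "c \<in> Ob C" for c
    using pos_functor_order[OF assms(2) c] order[OF c] \<epsilon>[OF c] c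
    by (auto simp: order_iso_def M_def bij_betw_def)
  have "presheaf C (underlying M)"
    using pos_functor_presheaf[OF assms(2)]
    by (auto simp: presheaf_def underlying_def M_def Pi_iff)
  moreover have "isotone (Fib M (Cod C f)) (Fib M (Dom C f)) (Tr M f)" if "f \<in> Arr C" for f
    using order[of "Cod C f"] order[of "Dom C f"] that Tr_mono[OF assms(2) that]
      Tr_closed[OF assms(2) that]
    by (auto simp: isotone_def partial_order_def M_def)
  ultimately have "pos_functor C M"
    using order by (simp add: pos_functor_def)
  then have "pos_iso C N M \<epsilon>"
    using assms(2) nat iso category_axioms by (intro pos_iso.intro pos_iso_axioms.intro) auto
  moreover have "small TYPE('u) (carrier (Fib M c))" if "c \<in> Ob C" for c
    using small_image[OF assms(3)[OF that]] by (simp add: M_def)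
  ultimately show thesis
    using that by blast
qed

section \<open>Restricting a sheaf on the topos along the canonical functor\<close>

definition restrict_along :: "('o, 'a, 'p, 'b) func \<Rightarrow> ('p, 'b, 's) psh \<Rightarrow> ('o, 'a, 's) psh" where
  "restrict_along F Q = \<lparr>Sec = (\<lambda>c. Sec Q (FOb F c)), Rst = (\<lambda>f. Rst Q (FArr F f))\<rparr>"

lemma underlying_precompose: "underlying (precompose M F) = restrict_along F (underlying M)"
  by (simp add: underlying_def precompose_def restrict_along_def)

context canonical_site
begin

text \<open>A jointly epimorphic family generates a jointly epimorphic sieve, and so is a cover.\<close>

lemma generated_cover:
  assumes F: "F \<in> sh_objects C J" and A: "\<And>e. e \<in> A \<Longrightarrow> e \<in> sh_arrows C J \<and> Cod E e = F"
    and epi: "jointly_epi C J A F"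
  shows "locally (epi_topology C J) F (\<lambda>s. \<exists>e\<in>A. \<exists>u\<in>sh_arrows C J. Cod E u = Dom E e \<and>
    s = e \<cdot>\<^bsub>E\<^esub> u)"
proof -
  define S where "S = {e \<cdot>\<^bsub>E\<^esub> u | e u. e \<in> A \<and> u \<in> sh_arrows C J \<and> Cod E u = Dom E e}"
  have "sieve E F S"
    unfolding sieve_def
  proof (intro conjI ballI subsetI impI)
    fix s assume "s \<in> S"
    then obtain e u where s: "s = e \<cdot>\<^bsub>E\<^esub> u" "e \<in> A" "u \<in> sh_arrows C J" "Cod E u = Dom E e"
      unfolding S_def by blast
    note e = A[OF s(2)]
    show "s \<in> Arr E" "Cod E s = F"
      using s e by simp_all
    fix g assume g: "g \<in> Arr E" "Cod E g = Dom E s"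
    have "s \<cdot>\<^bsub>E\<^esub> g = e \<cdot>\<^bsub>E\<^esub> (u \<cdot>\<^bsub>E\<^esub> g)" "u \<cdot>\<^bsub>E\<^esub> g \<in> sh_arrows C J" "Cod E (u \<cdot>\<^bsub>E\<^esub> g) = Dom E e"
      using s e g by (simp_all add: E_assoc)
    then show "s \<cdot>\<^bsub>E\<^esub> g \<in> S"
      unfolding S_def using s(2) by blast
  qed
  moreover have "A \<subseteq> S"
  proof
    fix e assume e: "e \<in> A"
    then have "e = e \<cdot>\<^bsub>E\<^esub> Id E (Dom E e)" "Id E (Dom E e) \<in> sh_arrows C J"
      "Cod E (Id E (Dom E e)) = Dom E e"
      using A[OF e] by simp_all
    then show "e \<in> S"
      unfolding S_def using e by blast
  qed
  then have "jointly_epi C J S F"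
    unfolding jointly_epi_def
  proof (intro ballI)
    fix c x assume c: "c \<in> Ob C" and x: "x \<in> Sec F c" and AS: "A \<subseteq> S"
    have "locally J c (\<lambda>f. reached C J A (Dom C f) (Rst F f x))"
      using epi c x by (simp add: jointly_epi_def)
    then show "locally J c (\<lambda>f. reached C J S (Dom C f) (Rst F f x))"
      using c by (rule locally_mono) (use AS in blast)
  qed
  ultimately have "S \<in> epi_topology C J F"
    by (simp add: epi_topology_def)
  then show ?thesis
    unfolding locally_def by (rule bexI[rotated]) (auto simp: S_def)
qed

lemma jointly_epi_separated:
  assumes Q: "sheaf E (epi_topology C J) Q" and F: "F \<in> sh_objects C J"
    and A: "\<And>e. e \<in> A \<Longrightarrow> e \<in> sh_arrows C J \<and> Cod E e = F" and epi: "jointly_epi C J A F"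
    and xy: "x \<in> Sec Q F" "y \<in> Sec Q F" and eq: "\<And>e. e \<in> A \<Longrightarrow> Rst Q e x = Rst Q e y"
  shows "x = y"
proof (rule K.sheaf_separated[OF Q _ xy])
  have preQ: "presheaf E Q"
    using Q unfolding sheaf_def by blast
  show "locally (epi_topology C J) F (\<lambda>f. Rst Q f x = Rst Q f y)"
  proof (rule K.locally_mono[OF generated_cover[OF F A epi]])
    fix s assume "\<exists>e\<in>A. \<exists>u\<in>sh_arrows C J. Cod E u = Dom E e \<and> s = e \<cdot>\<^bsub>E\<^esub> u"
    then obtain e u where s: "s = e \<cdot>\<^bsub>E\<^esub> u" "e \<in> A" "u \<in> sh_arrows C J" "Cod E u = Dom E e"
      by blast
    then show "Rst Q s x = Rst Q s y"
      using presheaf_Comp[OF preQ, of e u x] presheaf_Comp[OF preQ, of e u y] A[OF s(2)] eq[OF s(2)]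
        xy by simp
  qed (use F in auto)
qed (use F in auto)

lemma points_jointly_epi:
  assumes F: "F \<in> sh_objects C J"
    and W: "\<And>c x. c \<in> Ob C \<Longrightarrow> x \<in> Sec F c \<Longrightarrow> locally J c (\<lambda>f. W (Dom C f) (Rst F f x))"
  shows "jointly_epi C J {point F d y | d y. d \<in> Ob C \<and> y \<in> Sec F d \<and> W d y} F"
  unfolding jointly_epi_def
proof (intro ballI)
  fix c x assume c: "c \<in> Ob C" and x: "x \<in> Sec F c"
  let ?A = "{point F d y | d y. d \<in> Ob C \<and> y \<in> Sec F d \<and> W d y}"
  show "locally J c (\<lambda>f. reached C J ?A (Dom C f) (Rst F f x))"
  proof (rule locally_mono[OF W[OF c x] c])
    fix f assume f: "f \<in> Arr C" "Cod C f = c" "W (Dom C f) (Rst F f x)"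
    have xf: "Rst F f x \<in> Sec F (Dom C f)"
      using F f x by simp
    then have "point F (Dom C f) (Rst F f x) \<in> ?A"
      using f(3) Dom_Ob[OF f(1)] by blast
    moreover have "\<eta> (Dom C f) (Dom C f) (Id C (Dom C f))
      \<in> Sec (Dom E (point F (Dom C f) (Rst F f x))) (Dom C f)"
      "component (point F (Dom C f) (Rst F f x)) (Dom C f) (\<eta> (Dom C f) (Dom C f) (Id C (Dom C f)))
        = Rst F f x"
      using F f xf component_point_Id[OF F, of "Dom C f" "Rst F f x"] by simp_all
    ultimately show "reached C J ?A (Dom C f) (Rst F f x)"
      by blast
  qed
qed

text \<open>The points of a locally exhaustive class of sections form a jointly epimorphic family. The
  condition \<open>W\<close> serves to restrict to sections of a convenient form, such as those that come from
  arrows of the site.\<close>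

lemma points_separated:
  assumes Q: "sheaf E (epi_topology C J) Q" and F: "F \<in> sh_objects C J"
    and xy: "x \<in> Sec Q F" "y \<in> Sec Q F"
    and W: "\<And>c z. c \<in> Ob C \<Longrightarrow> z \<in> Sec F c \<Longrightarrow> locally J c (\<lambda>f. W (Dom C f) (Rst F f z))"
    and eq: "\<And>d z. d \<in> Ob C \<Longrightarrow> z \<in> Sec F d \<Longrightarrow> W d z \<Longrightarrow> Rst Q (point F d z) x = Rst Q (point F d z) y"
  shows "x = y"
  by (rule jointly_epi_separated[OF Q F _ points_jointly_epi[OF F W] xy]) (use F eq in auto)

definition spanned ::
    "'a \<Rightarrow> 'a \<Rightarrow> ('o, 'a, 'u) sh_arr \<Rightarrow> ('o, 'a, 'u) sh_arr \<Rightarrow> 'o \<Rightarrow> 'u \<Rightarrow> bool" where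
  "spanned f g u w d z \<longleftrightarrow> (\<exists>p q. (p, q) \<in> spans C f g \<and> Dom C p = d \<and>
     component u d z = \<eta> (Dom C f) d p \<and> component w d z = \<eta> (Dom C g) d q)"

text \<open>A commutative square over representables consists, locally, of spans in the site. This is what
  replaces pullbacks, which the site need not have.\<close>

lemma locally_spanned:
  assumes f: "f \<in> Arr C" and g: "g \<in> Arr C" and fg: "Cod C f = Cod C g"
    and u: "u \<in> sh_arrows C J" and w: "w \<in> sh_arrows C J" and Dom: "Dom E u = H" "Dom E w = H"
    and Cod_u: "Cod E u = FOb l (Dom C f)" and Cod_w: "Cod E w = FOb l (Dom C g)"
    and square: "FArr l f \<cdot>\<^bsub>E\<^esub> u = FArr l g \<cdot>\<^bsub>E\<^esub> w"
    and d: "d \<in> Ob C" and z: "z \<in> Sec H d"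
  shows "locally J d (\<lambda>k. spanned f g u w (Dom C k) (Rst H k z))"
proof (rule locally_bind)
  have H: "H \<in> sh_objects C J"
    using E_Dom[OF u] Dom by simp
  let ?P = "\<lambda>f u k. \<exists>p. p \<in> Arr C \<and> Cod C p = Dom C f \<and> Dom C p = Dom C k \<and>
      Rst (FOb l (Dom C f)) k (component u d z) = \<eta> (Dom C f) (Dom C k) p"
  show "locally J d (\<lambda>k. ?P f u k \<and> ?P g w k)"
    using d z f g u w Cod_u Cod_w Dom arrow_closed[of u C J d z] arrow_closed[of w C J d z]
    by (intro locally_conj \<eta>_locally_surjective) simp_all
  fix k assume k: "k \<in> Arr C" "Cod C k = d" and "?P f u k \<and> ?P g w k"
  then obtain p q where p: "p \<in> Arr C" "Cod C p = Dom C f" "Dom C p = Dom C k"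
      "Rst (FOb l (Dom C f)) k (component u d z) = \<eta> (Dom C f) (Dom C k) p"
    and q: "q \<in> Arr C" "Cod C q = Dom C g" "Dom C q = Dom C k"
      "Rst (FOb l (Dom C g)) k (component w d z) = \<eta> (Dom C g) (Dom C k) q"
    by blast
  have zk: "Rst H k z \<in> Sec H (Dom C k)"
    using object_closed[OF H, of k z] k z by simp
  have uk: "component u (Dom C k) (Rst H k z) = \<eta> (Dom C f) (Dom C k) p"
    using arrow_natural[of u C J k z] u Cod_u Dom k z p by simp
  have wk: "component w (Dom C k) (Rst H k z) = \<eta> (Dom C g) (Dom C k) q"
    using arrow_natural[of w C J k z] w Cod_w Dom k z q by simp
  have "component (FArr l f \<cdot>\<^bsub>E\<^esub> u) (Dom C k) (Rst H k z) = \<eta> (Cod C f) (Dom C k) (f \<cdot> p)"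
    using zk Dom uk p f l_\<eta>'[of f p "Dom C k"] k
      component_Comp[of "Dom C k" C "Rst H k z" J u "FArr l f"] by simp
  moreover have "component (FArr l g \<cdot>\<^bsub>E\<^esub> w) (Dom C k) (Rst H k z) = \<eta> (Cod C f) (Dom C k) (g \<cdot> q)"
    using zk Dom wk q g fg l_\<eta>'[of g q "Dom C k"] k
      component_Comp[of "Dom C k" C "Rst H k z" J w "FArr l g"] by simp
  ultimately have "locally J (Dom C k) (\<lambda>m. f \<cdot> p \<cdot> m = g \<cdot> q \<cdot> m)"
    using f g fg p q square by (intro \<eta>_locally_injective[of _ _ "Cod C f"]) simp_all
  then show "locally J (Dom C k) (\<lambda>m. spanned f g u w (Dom C (k \<cdot> m)) (Rst H (k \<cdot> m) z))"
  proof (rule locally_mono)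
    fix m assume m: "m \<in> Arr C" "Cod C m = Dom C k" "f \<cdot> p \<cdot> m = g \<cdot> q \<cdot> m"
    have zm: "Rst H (k \<cdot> m) z = Rst H m (Rst H k z)"
      using presheaf_Comp[OF presheaf_object[OF H], of k m z] k m z by simp
    have "component u (Dom C m) (Rst H (k \<cdot> m) z) = \<eta> (Dom C f) (Dom C m) (p \<cdot> m)"
      using arrow_natural[of u C J m "Rst H k z"] u f Cod_u Dom m zk uk p zm
      by (simp add: \<eta>_restrict)
    moreover have "component w (Dom C m) (Rst H (k \<cdot> m) z) = \<eta> (Dom C g) (Dom C m) (q \<cdot> m)"
      using arrow_natural[of w C J m "Rst H k z"] w g Cod_w Dom m zk wk q zm
      by (simp add: \<eta>_restrict)
    moreover have "(p \<cdot> m, q \<cdot> m) \<in> spans C f g"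
      using m f g p q by (simp add: spans_def Comp_assoc)
    ultimately show "spanned f g u w (Dom C (k \<cdot> m)) (Rst H (k \<cdot> m) z)"
      unfolding spanned_def using m p q k by (intro exI[of _ "p \<cdot> m"] exI[of _ "q \<cdot> m"]) simp
  qed (use k in auto)
qed (use d in auto)

lemma spanned_point:
  assumes "spanned f g u w d z" and d: "d \<in> Ob C"
    and u: "u \<in> sh_arrows C J" and w: "w \<in> sh_arrows C J" and Dom: "Dom E u = H" "Dom E w = H"
    and Cod: "Cod E u = FOb l (Dom C f)" "Cod E w = FOb l (Dom C g)" and z: "z \<in> Sec H d"
  shows "\<exists>p q. (p, q) \<in> spans C f g \<and> u \<cdot>\<^bsub>E\<^esub> point H d z = FArr l p \<and> w \<cdot>\<^bsub>E\<^esub> point H d z = FArr l q"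
proof -
  obtain p q where pq: "(p, q) \<in> spans C f g" "Dom C p = d"
      "component u d z = \<eta> (Dom C f) d p" "component w d z = \<eta> (Dom C g) d q"
    using assms(1) unfolding spanned_def by blast
  have "u \<cdot>\<^bsub>E\<^esub> point H d z = FArr l p" "w \<cdot>\<^bsub>E\<^esub> point H d z = FArr l q"
    using Comp_point[of u d z] Comp_point[of w d z] point_\<eta>[of p] point_\<eta>[of q] pq d z u w Dom Cod
    by (auto simp: spans_def)
  then show ?thesis
    using pq(1) by blast
qed

text \<open>A cover \<open>S\<close> of \<open>c\<close> becomes a jointly epimorphic family over \<open>l c\<close>. A matching family on \<open>S\<close>
  extends to the sieve that this family generates: the value along \<open>l f \<circ> u\<close> is the restriction of
  \<open>x f\<close> along \<open>u\<close>. This does not depend on the factorisation, because two factorisations agree locally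
  on spans in \<open>C\<close>, where the original family matches.\<close>

lemma sheaf_restrict_along:
  assumes Q: "sheaf E (epi_topology C J) Q"
  shows "sheaf C J (restrict_along l Q)"
proof (rule sheafI)
  have preQ: "presheaf E Q"
    using Q unfolding sheaf_def by blast
  note Q_closed = presheaf_closed[OF preQ, simplified]
    and Q_Comp = presheaf_Comp[OF preQ, simplified]
  show "presheaf C (restrict_along l Q)"
    unfolding presheaf_def
  proof (intro conjI ballI impI Pi_I)
    show "Rst (restrict_along l Q) f x \<in> Sec (restrict_along l Q) (Dom C f)"
      if "f \<in> Arr C" "x \<in> Sec (restrict_along l Q) (Cod C f)" for f x
      using that Q_closed[of "FArr l f" x] by (simp add: restrict_along_def)
    show "Rst (restrict_along l Q) (Id C c) x = x"
      if "c \<in> Ob C" "x \<in> Sec (restrict_along l Q) c" for c x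
      using that presheaf_Id[OF preQ, of "FOb l c" x] by (simp add: restrict_along_def l_Id)
    show "Rst (restrict_along l Q) (f \<cdot> g) x = Rst (restrict_along l Q) g (Rst (restrict_along l Q) f x)"
      if "f \<in> Arr C" "g \<in> Arr C" "Cod C g = Dom C f"
        "x \<in> Sec (restrict_along l Q) (Cod C f)" for f g x
      using that Q_Comp[of "FArr l f" "FArr l g" x] by (simp add: restrict_along_def l_Comp)
  qed
  show "x = y" if c: "c \<in> Ob C" and xy: "x \<in> Sec (restrict_along l Q) c"
    "y \<in> Sec (restrict_along l Q) c"
    and loc: "locally J c (\<lambda>f. Rst (restrict_along l Q) f x = Rst (restrict_along l Q) f y)"
      for c x y
  proof (rule points_separated[OF Q, of "FOb l c" x y
        "\<lambda>d z. \<exists>g\<in>Arr C. Cod C g = c \<and> Dom C g = d \<and> z = \<eta> c d g \<and>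
          Rst Q (FArr l g) x = Rst Q (FArr l g) y"])
    show "locally J d (\<lambda>f. \<exists>g\<in>Arr C. Cod C g = c \<and> Dom C g = Dom C f \<and>
      Rst (FOb l c) f z = \<eta> c (Dom C f) g \<and>
        Rst Q (FArr l g) x = Rst Q (FArr l g) y)" if d: "d \<in> Ob C"
          and z: "z \<in> Sec (FOb l c) d" for d z
    proof (rule locally_bind[OF \<eta>_locally_surjective[OF c d z] d])
      fix f assume f: "f \<in> Arr C" "Cod C f = d"
        and "\<exists>g. g \<in> Arr C \<and> Cod C g = c \<and> Dom C g = Dom C f \<and> Rst (FOb l c) f z = \<eta> c (Dom C f) g"
      then obtain g where g: "g \<in> Arr C" "Cod C g = c" "Dom C g = Dom C f"
        "Rst (FOb l c) f z = \<eta> c (Dom C f) g"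
        by blast
      have "locally J (Dom C f) (\<lambda>k. Rst Q (FArr l (g \<cdot> k)) x = Rst Q (FArr l (g \<cdot> k)) y)"
        using locally_pull'[OF loc g(1-3)] by (simp add: restrict_along_def)
      then show "locally J (Dom C f) (\<lambda>k. \<exists>g\<in>Arr C. Cod C g = c \<and> Dom C g = Dom C (f \<cdot> k) \<and>
          Rst (FOb l c) (f \<cdot> k) z = \<eta> c (Dom C (f \<cdot> k)) g \<and>
            Rst Q (FArr l g) x = Rst Q (FArr l g) y)"
      proof (rule locally_mono)
        fix k assume k: "k \<in> Arr C" "Cod C k = Dom C f"
          "Rst Q (FArr l (g \<cdot> k)) x = Rst Q (FArr l (g \<cdot> k)) y"
        have "Rst (FOb l c) (f \<cdot> k) z = \<eta> c (Dom C k) (g \<cdot> k)"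
          using presheaf_Comp[OF presheaf_object[OF l_obj[OF c]], of f k z] f g k z
          by (simp add: \<eta>_restrict)
        then show "\<exists>g\<in>Arr C. Cod C g = c \<and> Dom C g = Dom C (f \<cdot> k) \<and>
            Rst (FOb l c) (f \<cdot> k) z = \<eta> c (Dom C (f \<cdot> k)) g \<and>
              Rst Q (FArr l g) x = Rst Q (FArr l g) y"
          using f g k by (intro bexI[of _ "g \<cdot> k"]) simp_all
      qed (use f in auto)
    qed
  qed (use c xy point_\<eta> in \<open>auto simp: restrict_along_def\<close>)
  show "\<exists>t\<in>Sec (restrict_along l Q) c. \<forall>f\<in>S. Rst (restrict_along l Q) f t = x f"
    if c: "c \<in> Ob C" and S: "S \<in> J c" and x: "matching_family C (restrict_along l Q) S x" for c S x
  proof -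
    have S_arr: "f \<in> Arr C \<and> Cod C f = c" if "f \<in> S" for f
      using cover_arr[OF c S that] .
    have x_Sec: "x f \<in> Sec Q (FOb l (Dom C f))" if "f \<in> S" for f
      using x that by (simp add: matching_family_def restrict_along_def)
    have x_Comp: "x (f \<cdot> g) = Rst Q (FArr l g) (x f)" if "f \<in> S" "g \<in> Arr C"
      "Cod C g = Dom C f" for f g
      using x that by (simp add: matching_family_def restrict_along_def)
    define V where "V s v \<longleftrightarrow> (\<exists>f\<in>S. \<exists>u\<in>sh_arrows C J. Cod E u = FOb l (Dom C f) \<and>
      s = FArr l f \<cdot>\<^bsub>E\<^esub> u \<and> v = Rst Q u (x f))" for s v
    obtain t where t: "t \<in> Sec Q (FOb l c)"
      "\<And>s v. s \<in> Arr E \<Longrightarrow> Cod E s = FOb l c \<Longrightarrow> V s v \<Longrightarrow> Rst Q s t = v"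
    proof (rule K.sheaf_glue[OF Q, of "FOb l c" V])
      show "v \<in> Sec Q (Dom E s)" if v: "V s v" for s v
      proof -
        obtain f u where "f \<in> S" "u \<in> sh_arrows C J" "Cod E u = FOb l (Dom C f)"
            "s = FArr l f \<cdot>\<^bsub>E\<^esub> u" "v = Rst Q u (x f)"
          using v unfolding V_def by blast
        then show ?thesis
          using Q_closed[of u "x f"] x_Sec[of f] S_arr[of f] by simp
      qed
      show "v = v'" if v: "V s v" "V s v'" for s v v'
      proof -
        obtain f u where f: "f \<in> S" "u \<in> sh_arrows C J" "Cod E u = FOb l (Dom C f)"
            "s = FArr l f \<cdot>\<^bsub>E\<^esub> u" "v = Rst Q u (x f)"
          using v(1) unfolding V_def by blast
        obtain g w where g: "g \<in> S" "w \<in> sh_arrows C J" "Cod E w = FOb l (Dom C g)"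
            "s = FArr l g \<cdot>\<^bsub>E\<^esub> w" "v' = Rst Q w (x g)"
          using v(2) unfolding V_def by blast
        note f' = S_arr[OF f(1)] x_Sec[OF f(1)] and g' = S_arr[OF g(1)] x_Sec[OF g(1)]
        define H where "H = Dom E s"
        have Dom: "Dom E u = H" "Dom E w = H"
          unfolding H_def using f g f' g' E_Comp(2)[of "FArr l f" u] E_Comp(2)[of "FArr l g" w]
          by auto
        have square: "FArr l f \<cdot>\<^bsub>E\<^esub> u = FArr l g \<cdot>\<^bsub>E\<^esub> w"
          using f(4) g(4) by simp
        have H: "H \<in> sh_objects C J"
          using E_Dom[OF f(2)] Dom by simp
        show ?thesis
        proof (rule points_separated[OF Q H, of v v' "spanned f g u w"])
          show "v \<in> Sec Q H" "v' \<in> Sec Q H"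
            using f(2,3,5) g(2,3,5) f' g' Dom Q_closed[of u "x f"] Q_closed[of w "x g"] by simp_all
          show "locally J d (\<lambda>k. spanned f g u w (Dom C k) (Rst H k z))"
            if "d \<in> Ob C" "z \<in> Sec H d" for d z
            using locally_spanned[OF _ _ _ f(2) g(2) Dom f(3) g(3) square that] f' g' by simp
          fix d z assume d: "d \<in> Ob C" and z: "z \<in> Sec H d" and "spanned f g u w d z"
          then obtain p q where pq: "(p, q) \<in> spans C f g"
            and p: "u \<cdot>\<^bsub>E\<^esub> point H d z = FArr l p" and q: "w \<cdot>\<^bsub>E\<^esub> point H d z = FArr l q"
            using spanned_point[OF _ d f(2) g(2) Dom f(3) g(3) z] by blast
          have "Rst Q (point H d z) v = Rst Q (FArr l p) (x f)"
            using Q_Comp[of u "point H d z" "x f"] f(2,3,5) f' Dom H d z p by simp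
          also have "\<dots> = Rst Q (FArr l q) (x g)"
            using x_Comp[of f p] x_Comp[of g q] f(1) g(1) pq by (auto simp: spans_def)
          also have "\<dots> = Rst Q (point H d z) v'"
            using Q_Comp[of w "point H d z" "x g"] g(2,3,5) g' Dom H d z q by simp
          finally show "Rst Q (point H d z) v = Rst Q (point H d z) v'" .
        qed
      qed
      show "V (s \<cdot>\<^bsub>E\<^esub> r) (Rst Q r v)" if "r \<in> Arr E" "Cod E r = Dom E s" "V s v" for s r v
      proof -
        obtain f u where f: "f \<in> S" "u \<in> sh_arrows C J" "Cod E u = FOb l (Dom C f)"
            "s = FArr l f \<cdot>\<^bsub>E\<^esub> u" "v = Rst Q u (x f)"
          using \<open>V s v\<close> unfolding V_def by blast
        have "s \<cdot>\<^bsub>E\<^esub> r = FArr l f \<cdot>\<^bsub>E\<^esub> (u \<cdot>\<^bsub>E\<^esub> r)" "Rst Q r v = Rst Q (u \<cdot>\<^bsub>E\<^esub> r) (x f)"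
          "u \<cdot>\<^bsub>E\<^esub> r \<in> sh_arrows C J" "Cod E (u \<cdot>\<^bsub>E\<^esub> r) = FOb l (Dom C f)"
          using f \<open>r \<in> Arr E\<close> \<open>Cod E r = Dom E s\<close> S_arr[OF f(1)] x_Sec[OF f(1)] Q_Comp[of u r "x f"]
          by (simp_all add: E_assoc)
        then show ?thesis
          unfolding V_def using f(1) by blast
      qed
      have "jointly_epi C J (FArr l ` S) (FOb l c)"
        unfolding jointly_epi_def
      proof (intro ballI)
        fix d z assume d: "d \<in> Ob C" and z: "z \<in> Sec (FOb l c) d"
        let ?Z = "\<lambda>k. reached C J (FArr l ` S) (Dom C k) (Rst (FOb l c) k z)"
        show "locally J d ?Z"
        proof (rule locally_bind[OF \<eta>_locally_surjective[OF c d z] d])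
          fix k assume k: "k \<in> Arr C" "Cod C k = d"
            and "\<exists>g. g \<in> Arr C \<and> Cod C g = c \<and> Dom C g = Dom C k \<and>
              Rst (FOb l c) k z = \<eta> c (Dom C k) g"
          then obtain g where g: "g \<in> Arr C" "Cod C g = c" "Dom C g = Dom C k"
            "Rst (FOb l c) k z = \<eta> c (Dom C k) g"
            by blast
          have "locally J c (\<lambda>f. f \<in> S)"
            using S by (auto simp: locally_def)
          then have "locally J (Dom C k) (\<lambda>m. g \<cdot> m \<in> S)"
            using g by (intro locally_pull'[of c]) simp_all
          then show "locally J (Dom C k) (\<lambda>m. ?Z (k \<cdot> m))"
          proof (rule locally_mono)
            fix m assume m: "m \<in> Arr C" "Cod C m = Dom C k" "g \<cdot> m \<in> S"
            have "Rst (FOb l c) (k \<cdot> m) z = \<eta> c (Dom C m) (g \<cdot> m)"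
              using presheaf_Comp[OF presheaf_object[OF l_obj[OF c]], of k m z] k m z g
              by (simp add: \<eta>_restrict)
            then have "component (FArr l (g \<cdot> m)) (Dom C m) (\<eta> (Dom C m) (Dom C m) (Id C (Dom C m)))
                = Rst (FOb l c) (k \<cdot> m) z"
              using l_\<eta>'[of "g \<cdot> m" "Id C (Dom C m)" "Dom C m" c "Dom C m"] g m by simp
            then show "?Z (k \<cdot> m)"
              using m g k by (intro bexI[of _ "FArr l (g \<cdot> m)"]
                bexI[of _ "\<eta> (Dom C m) (Dom C m) (Id C (Dom C m))"]) simp_all
          qed (use k in auto)
        qed
      qed
      moreover have "e \<in> sh_arrows C J \<and> Cod E e = FOb l c" if "e \<in> FArr l ` S" for e
        using that by (elim imageE) (use S_arr in simp)
      ultimately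
      have "locally (epi_topology C J) (FOb l c) (\<lambda>s. \<exists>e\<in>FArr l ` S. \<exists>u\<in>sh_arrows C J. Cod E u
        = Dom E e \<and> s = e \<cdot>\<^bsub>E\<^esub> u)"
        using generated_cover[OF l_obj[OF c]] by blast
      then show "locally (epi_topology C J) (FOb l c) (\<lambda>s. \<exists>v. V s v)"
        by (rule K.locally_mono) (use c S_arr in \<open>auto simp: V_def\<close>)
    qed (use c in auto)
    have "Rst Q (FArr l f) t = x f" if f: "f \<in> S" for f
    proof (rule t(2))
      have "FArr l f = FArr l f \<cdot>\<^bsub>E\<^esub> Id E (FOb l (Dom C f))"
        "x f = Rst Q (Id E (FOb l (Dom C f))) (x f)"
        "Id E (FOb l (Dom C f)) \<in> sh_arrows C J" "Cod E (Id E (FOb l (Dom C f))) = FOb l (Dom C f)"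
        using S_arr[OF f] x_Sec[OF f] presheaf_Id[OF preQ, of "FOb l (Dom C f)" "x f"] by simp_all
      then show "V (FArr l f) (x f)"
        unfolding V_def using f by blast
    qed (use S_arr[OF f] in auto)
    then show ?thesis
      using t(1) by (auto simp: restrict_along_def)
  qed
qed

section \<open>Pullbacks of sheaves\<close>

text \<open>The pullback is the sheaf of pairs of sections with a common image, encoded in \<open>'u\<close>.\<close>

lemma pullback_exists:
  assumes c: "c \<in> sh_arrows C J" and d: "d \<in> sh_arrows C J" and cd: "Cod E c = Cod E d"
  obtains a b where "is_pullback E a b c d"
proof -
  define V where "V = Dom E c"
  define W where "W = Dom E d"
  have obj: "V \<in> sh_objects C J" "W \<in> sh_objects C J"
    using c d by (simp_all add: V_def W_def)
  note pre = presheaf_object[OF obj(1)] presheaf_object[OF obj(2)]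
  note c_nat = arrow_natural[OF c, folded V_def] and d_nat = arrow_natural[OF d, folded W_def cd]
  define P where "P = \<lparr>Sec = (\<lambda>x. {(v, w). v \<in> Sec V x \<and> w \<in> Sec W x \<and>
    component c x v = component d x w}),
    Rst = (\<lambda>f (v, w). (Rst V f v, Rst W f w))\<rparr>"
  have Sec_P: "y \<in> Sec P x \<longleftrightarrow> fst y \<in> Sec V x \<and> snd y \<in> Sec W x \<and>
    component c x (fst y) = component d x (snd y)" for x y
    by (auto simp: P_def)
  have Rst_P: "fst (Rst P f y) = Rst V f (fst y)" "snd (Rst P f y) = Rst W f (snd y)" for f y
    by (simp_all add: P_def case_prod_unfold)
  have "sheaf C J P"
  proof (rule sheafI)
    show "presheaf C P"
      unfolding presheaf_def
      using presheaf_closed[OF pre(1)] presheaf_closed[OF pre(2)] presheaf_Id[OF pre(1)]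
        presheaf_Id[OF pre(2)]
        presheaf_Comp[OF pre(1)] presheaf_Comp[OF pre(2)] c_nat d_nat
      by (intro conjI ballI impI Pi_I) (simp_all add: Sec_P Rst_P prod_eq_iff)
    show "y = z" if x: "x \<in> Ob C" "y \<in> Sec P x" "z \<in> Sec P x"
      and loc: "locally J x (\<lambda>f. Rst P f y = Rst P f z)" for x y z
    proof (rule prod_eqI)
      show "fst y = fst z"
        by (rule sheaf_separated[OF sheaf_object[OF obj(1)] x(1) _ _ locally_mono[OF loc x(1)]])
          (use x Sec_P Rst_P in metis)+
      show "snd y = snd z"
        by (rule sheaf_separated[OF sheaf_object[OF obj(2)] x(1) _ _ locally_mono[OF loc x(1)]])
          (use x Sec_P Rst_P in metis)+
    qed
    show "\<exists>t\<in>Sec P x. \<forall>f\<in>S. Rst P f t = m f"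
      if x: "x \<in> Ob C" and S: "S \<in> J x" and m: "matching_family C P S m" for x S m
    proof -
      have mS: "m f \<in> Sec P (Dom C f)" if "f \<in> S" for f
        using m that by (simp add: matching_family_def)
      have "matching_family C V S (\<lambda>f. fst (m f))" "matching_family C W S (\<lambda>f. snd (m f))"
        using m by (simp_all add: matching_family_def Sec_P Rst_P)
      then obtain v w where v: "v \<in> Sec V x" "\<And>f. f \<in> S \<Longrightarrow> Rst V f v = fst (m f)"
        and w: "w \<in> Sec W x" "\<And>f. f \<in> S \<Longrightarrow> Rst W f w = snd (m f)"
        using sheaf_object[OF obj(1)] sheaf_object[OF obj(2)] x S unfolding sheaf_def by metis
      have "component c x v = component d x w"
      proof (rule sheaf_separated[OF sheaf_object[OF E_Cod[OF c]] x])
        show "component c x v \<in> Sec (Cod E c) x" "component d x w \<in> Sec (Cod E c) x"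
          using arrow_closed[OF c x, folded V_def] arrow_closed[OF d x, folded W_def cd] v w by auto
        have "locally J x (\<lambda>f. f \<in> S)"
          using S by (auto simp: locally_def)
        then show "locally J x (\<lambda>f. Rst (Cod E c) f (component c x v)
          = Rst (Cod E c) f (component d x w))"
        proof (rule locally_mono[OF _ x])
          fix f assume f: "f \<in> Arr C" "Cod C f = x" "f \<in> S"
          then show "Rst (Cod E c) f (component c x v) = Rst (Cod E c) f (component d x w)"
            using c_nat[of f v] d_nat[of f w] v w mS[OF f(3)] by (simp add: Sec_P)
        qed
      qed
      then have "(v, w) \<in> Sec P x" "\<forall>f\<in>S. Rst P f (v, w) = m f"
        using v w by (simp_all add: Sec_P Rst_P prod_eq_iff)
      then show ?thesis by blast
    qed
  qed
  moreover have "small TYPE('u) (Sec P x)" if x: "x \<in> Ob C" for x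
  proof (rule small_subset)
    show "small TYPE('u) (Sec V x \<times> Sec W x)"
      using small_Sigma[OF universe small_object[OF obj(1) x] small_object[OF obj(2) x]] .
  qed (auto simp: P_def)
  ultimately obtain F :: "('o, 'a, 'u) psh" and \<phi> where F: "F \<in> sh_objects C J" "nat_trans C P F \<phi>"
      "\<And>x. x \<in> Ob C \<Longrightarrow> bij_betw (\<phi> x) (Sec P x) (Sec F x)"
    using object_representing by blast
  define \<psi> where "\<psi> x = inv_into (Sec P x) (\<phi> x)" for x
  have "presheaf C P"
    using \<open>sheaf C J P\<close> unfolding sheaf_def by blast
  then have \<psi>: "nat_trans C F P \<psi>"
    unfolding \<psi>_def using nat_trans_inverse[OF F(2) category_axioms _ F(3)] by blast
  have \<psi>\<phi>: "\<psi> x (\<phi> x y) = y" if "x \<in> Ob C" "y \<in> Sec P x" for x y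
    unfolding \<psi>_def using bij_betw_inv_into_left[OF F(3)] that by blast
  have \<phi>\<psi>: "\<phi> x (\<psi> x y) = y" if "x \<in> Ob C" "y \<in> Sec F x" for x y
    unfolding \<psi>_def using bij_betw_inv_into_right[OF F(3)] that by blast
  have \<psi>_P: "\<psi> x y \<in> Sec P x" if "x \<in> Ob C" "y \<in> Sec F x" for x y
    using nat_trans_closed[OF \<psi> that] .
  define a where "a = sh_arrow C F V (\<lambda>x y. fst (\<psi> x y))"
  define b where "b = sh_arrow C F W (\<lambda>x y. snd (\<psi> x y))"
  have "nat_trans C F V (\<lambda>x y. fst (\<psi> x y))" "nat_trans C F W (\<lambda>x y. snd (\<psi> x y))"
    using \<psi>_P nat_trans_natural[OF \<psi>] unfolding nat_trans_def by (auto simp: Sec_P Rst_P)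
  then have ab: "a \<in> Hom E F V" "b \<in> Hom E F W"
    unfolding a_def b_def using sh_arrow_Hom[OF category_axioms F(1)] obj by blast+
  note a = Hom_Sh[OF ab(1)] and b = Hom_Sh[OF ab(2)]
  have a_comp: "component a x y = fst (\<psi> x y)" and b_comp: "component b x y = snd (\<psi> x y)"
    if "x \<in> Ob C" "y \<in> Sec F x" for x y
    using that by (simp_all add: a_def b_def)
  have "c \<cdot>\<^bsub>E\<^esub> a = d \<cdot>\<^bsub>E\<^esub> b"
  proof (rule arrow_eqI)
    fix x y assume x: "x \<in> Ob C" and "y \<in> Sec (Dom E (c \<cdot>\<^bsub>E\<^esub> a)) x"
    then have "y \<in> Sec F x"
      using a c by (simp add: V_def)
    then show "component (c \<cdot>\<^bsub>E\<^esub> a) x y = component (d \<cdot>\<^bsub>E\<^esub> b) x y"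
      using x a b \<psi>_P[of x y] by (simp add: component_Comp a_comp b_comp Sec_P)
  qed (use a b c d cd in \<open>simp_all add: V_def W_def\<close>)
  then have span: "(a, b) \<in> spans E c d"
    using a b by (simp add: spans_def V_def W_def)
  have "\<exists>!u. u \<in> Hom E (Dom E p) (Dom E a) \<and> a \<cdot>\<^bsub>E\<^esub> u = p \<and>
    b \<cdot>\<^bsub>E\<^esub> u = q" if "(p, q) \<in> spans E c d" for p q
  proof -
    have p: "p \<in> sh_arrows C J" "Cod E p = V" and q: "q \<in> sh_arrows C J" "Cod E q = W"
      "Dom E q = Dom E p"
      and pq: "c \<cdot>\<^bsub>E\<^esub> p = d \<cdot>\<^bsub>E\<^esub> q"
      using that by (auto simp: spans_def V_def W_def)
    define H where "H = Dom E p"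
    have H: "H \<in> sh_objects C J" "Dom E p = H" "Dom E q = H"
      using p q by (simp_all add: H_def)
    have pq_P: "(component p x z, component q x z) \<in> Sec P x" if "x \<in> Ob C" "z \<in> Sec H x" for x z
      using arrow_closed[OF p(1) that(1), of z] arrow_closed[OF q(1) that(1), of z] p q H that
        component_Comp[of x C z J p c] component_Comp[of x C z J q d] pq
      by (simp add: Sec_P)
    have "nat_trans C H F (\<lambda>x z. \<phi> x (component p x z, component q x z))"
      unfolding nat_trans_def
    proof (intro conjI ballI Pi_I)
      show "\<phi> x (component p x z, component q x z) \<in> Sec F x" if "x \<in> Ob C" "z \<in> Sec H x" for x z
        using nat_trans_closed[OF F(2)] pq_P that by blast
      fix f z assume f: "f \<in> Arr C" and z: "z \<in> Sec H (Cod C f)"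
      have "Rst P f (component p (Cod C f) z, component q (Cod C f) z)
          = (component p (Dom C f) (Rst H f z), component q (Dom C f) (Rst H f z))"
        using arrow_natural[OF p(1) f, of z] arrow_natural[OF q(1) f, of z] p q H z
        by (simp add: prod_eq_iff Rst_P)
      then show "\<phi> (Dom C f) (component p (Dom C f) (Rst H f z), component q (Dom C f) (Rst H f z))
          = Rst F f (\<phi> (Cod C f) (component p (Cod C f) z, component q (Cod C f) z))"
        using nat_trans_natural[OF F(2) f pq_P[OF _ z]] f by simp
    qed
    then have u: "sh_arrow C H F (\<lambda>x z. \<phi> x (component p x z, component q x z)) \<in> Hom E H F" (is "?u
      \<in> _")
      using sh_arrow_Hom[OF category_axioms H(1) F(1)] by blast
    have u_comp: "component ?u x z = \<phi> x (component p x z, component q x z)" if "x \<in> Ob C"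
      "z \<in> Sec H x" for x z
      using that by simp
    note u' = Hom_Sh[OF u]
    show ?thesis
    proof (rule ex1I[of _ ?u])
      have "a \<cdot>\<^bsub>E\<^esub> ?u = p" "b \<cdot>\<^bsub>E\<^esub> ?u = q"
      proof -
        have \<phi>_F: "\<phi> x (component p x z, component q x z) \<in> Sec F x" if "x \<in> Ob C"
          "z \<in> Sec H x" for x z
          using nat_trans_closed[OF F(2)] pq_P that by blast
        show "a \<cdot>\<^bsub>E\<^esub> ?u = p"
        proof (rule arrow_eqI)
          fix x z assume x: "x \<in> Ob C" and "z \<in> Sec (Dom E (a \<cdot>\<^bsub>E\<^esub> ?u)) x"
          then have z: "z \<in> Sec H x"
            using a u' by simp
          show "component (a \<cdot>\<^bsub>E\<^esub> ?u) x z = component p x z"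
            using component_Comp[of x C z J ?u a] a_comp[OF x \<phi>_F[OF x z]] u_comp[OF x z]
              \<psi>\<phi>[OF x pq_P[OF x z]] u' x z
            by simp
        qed (use a u' p H in simp_all)
        show "b \<cdot>\<^bsub>E\<^esub> ?u = q"
        proof (rule arrow_eqI)
          fix x z assume x: "x \<in> Ob C" and "z \<in> Sec (Dom E (b \<cdot>\<^bsub>E\<^esub> ?u)) x"
          then have z: "z \<in> Sec H x"
            using b u' by simp
          show "component (b \<cdot>\<^bsub>E\<^esub> ?u) x z = component q x z"
            using component_Comp[of x C z J ?u b] b_comp[OF x \<phi>_F[OF x z]] u_comp[OF x z]
              \<psi>\<phi>[OF x pq_P[OF x z]] u' x z
            by simp
        qed (use b u' q H in simp_all)
      qed
      then show "?u \<in> Hom E (Dom E p) (Dom E a) \<and> a \<cdot>\<^bsub>E\<^esub> ?u = p \<and> b \<cdot>\<^bsub>E\<^esub> ?u = q"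
        using u a H by simp
      fix t assume t: "t \<in> Hom E (Dom E p) (Dom E a) \<and> a \<cdot>\<^bsub>E\<^esub> t = p \<and> b \<cdot>\<^bsub>E\<^esub> t = q"
      then have tH: "t \<in> Hom E H F"
        using a H by simp
      note t' = Hom_Sh[OF tH]
      show "t = ?u"
      proof (rule arrow_eqI)
        fix x z assume x: "x \<in> Ob C" and "z \<in> Sec (Dom E t) x"
        then have z: "z \<in> Sec H x"
          using t' by simp
        have tz: "component t x z \<in> Sec F x"
          using nat_trans_closed[OF t'(6) x z] .
        have "component p x z = fst (\<psi> x (component t x z))"
          "component q x z = snd (\<psi> x (component t x z))"
          using t component_Comp[of x C z J t a] component_Comp[of x C z J t b] a_comp[OF x tz]
            b_comp[OF x tz] x z t'
          by auto
        then show "component t x z = component ?u x z"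
          using u_comp[OF x z] \<phi>\<psi>[OF x tz] by simp
      qed (use t' u' in simp_all)
    qed
  qed
  then have "\<forall>(p, q)\<in>spans E c d. \<exists>!u. u \<in> Hom E (Dom E p) (Dom E a) \<and> a \<cdot>\<^bsub>E\<^esub> u = p \<and> b \<cdot>\<^bsub>E\<^esub> u = q"
    unfolding case_prod_beta by (metis prod.collapse)
  then have "is_pullback E a b c d"
    unfolding is_pullback_def using span c d cd by (simp only: Sh_simps)
  then show thesis
    using that by blast
qed

end

section \<open>From an internal locale to an existential functor\<close>

lemma precompose_simps [simp]:
  "Fib (precompose M F) c = Fib M (FOb F c)" "Tr (precompose M F) f = Tr M (FArr F f)"
  by (simp_all add: precompose_def)

context canonical_site
begin

lemma frame_valued_precompose:
  assumes "frame_valued E M"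
  shows "frame_valued C (precompose M l)"
proof -
  have M: "pos_functor E M" "\<And>F. F \<in> Ob E \<Longrightarrow> frame (Fib M F)"
    "\<And>s. s \<in> Arr E \<Longrightarrow> frame_hom (Fib M (Cod E s)) (Fib M (Dom E s)) (Tr M s)"
    using assms by (simp_all add: frame_valued_def)
  have "frame_hom (Fib M (FOb l (Cod C f))) (Fib M (FOb l (Dom C f))) (Tr M (FArr l f))"
    if "f \<in> Arr C" for f
    using M(3)[of "FArr l f"] that by simp
  then show ?thesis
    using pos_functor_precompose[OF M(1) category_axioms l_functor] M(2)
    by (simp add: frame_valued_def)
qed

lemma left_adjoints_precompose:
  assumes "pos_functor E M" "left_adjoints E M ex"
  shows "left_adjoints C (precompose M l) (\<lambda>a. ex (FArr l a))"
proof (rule left_adjointsI[OF category_axioms pos_functor_precompose[OF assms(1) category_axioms l_functor]])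
  show "ex (FArr l a) x \<in> carrier (Fib (precompose M l) (Cod C a))"
    if "a \<in> Arr C" "x \<in> carrier (Fib (precompose M l) (Dom C a))" for a x
    using left_adjoint_closed[OF assms(2), of "FArr l a" x] that by simp
  show "ex (FArr l a) x \<sqsubseteq>\<^bsub>Fib (precompose M l) (Cod C a)\<^esub> y
      \<longleftrightarrow> x \<sqsubseteq>\<^bsub>Fib (precompose M l) (Dom C a)\<^esub> Tr (precompose M l) a y"
    if "a \<in> Arr C" "x \<in> carrier (Fib (precompose M l) (Dom C a))"
      "y \<in> carrier (Fib (precompose M l) (Cod C a))"
    for a x y
    using left_adjoint_iff[OF assms(2), of "FArr l a" x y] that by simp
qed

lemma frobenius_precompose:
  assumes "frobenius E M ex"
  shows "frobenius C (precompose M l) (\<lambda>a. ex (FArr l a))"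
  unfolding frobenius_def
proof (intro ballI)
  fix a x y assume "a \<in> Arr C" "x \<in> carrier (Fib (precompose M l) (Dom C a))"
    "y \<in> carrier (Fib (precompose M l) (Cod C a))"
  then show "ex (FArr l a) (Tr (precompose M l) a y \<sqinter>\<^bsub>Fib (precompose M l) (Dom C a)\<^esub> x)
      = ex (FArr l a) x \<sqinter>\<^bsub>Fib (precompose M l) (Cod C a)\<^esub> y"
    using assms[unfolded frobenius_def, rule_format, of "FArr l a" x y] by simp
qed

text \<open>The pullback in the topos of a cospan coming from the site is covered by the spans of the site
  over that cospan, and an inequality in a sheaf of frames may be checked on a cover. Hence the
  Beck--Chevalley condition for the pullback becomes a supremum over spans.\<close>

lemma relative_beck_chevalley_precompose:
  assumes M: "frame_valued E M" and M_sheaf: "sheaf E (epi_topology C J) (underlying M)"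
    and adj: "left_adjoints E M ex" and bc: "beck_chevalley E M ex"
  shows "relative_beck_chevalley C (precompose M l) (\<lambda>a. ex (FArr l a))"
  unfolding relative_beck_chevalley_def
proof (intro ballI impI)
  fix c d t assume cd: "c \<in> Arr C" "d \<in> Arr C" "Cod C c = Cod C d"
    and "t \<in> carrier (Fib (precompose M l) (Dom C c))"
  then have t: "t \<in> carrier (Fib M (FOb l (Dom C c)))"
    by simp
  have pos: "pos_functor E M"
    using M by (simp add: frame_valued_def)
  note M_closed = Tr_closed[OF pos, simplified] and M_Comp = Tr_Comp[OF pos, simplified]
    and ex_closed = left_adjoint_closed[OF adj, simplified]
      and M_order = pos_functor_order[OF pos, simplified]
  have "Cod E (FArr l c) = Cod E (FArr l d)"
    using cd by simp
  with pullback_exists[OF l_arr(1)[OF cd(1)] l_arr(1)[OF cd(2)]]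
  obtain a b where pb: "is_pullback E a b (FArr l c) (FArr l d)"
    by blast
  then have ab: "a \<in> sh_arrows C J" "b \<in> sh_arrows C J" "Dom E b = Dom E a"
    "Cod E a = FOb l (Dom C c)"
      "Cod E b = FOb l (Dom C d)" "FArr l c \<cdot>\<^bsub>E\<^esub> a = FArr l d \<cdot>\<^bsub>E\<^esub> b"
    using cd by (auto simp: is_pullback_def spans_def)
  define s where "s = Tr M (FArr l d) (ex (FArr l c) t)"
  have ct: "ex (FArr l c) t \<in> carrier (Fib M (FOb l (Cod C d)))"
    using ex_closed[of "FArr l c" t] t cd by simp
  have s: "s \<in> carrier (Fib M (FOb l (Dom C d)))"
    using M_closed[of "FArr l d"] ct cd by (simp add: s_def)
  have s_bc: "s = ex b (Tr M a t)"
    unfolding s_def using bc[unfolded beck_chevalley_def, rule_format, OF pb, of t] t cd by simp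
  have span: "p \<in> Arr C" "q \<in> Arr C" "Dom C q = Dom C p" "Cod C p = Dom C c" "Cod C q = Dom C d"
    "c \<cdot> p = d \<cdot> q"
      "Tr M (FArr l p) t \<in> carrier (Fib M (FOb l (Dom C p)))"
    if "(p, q) \<in> spans C c d" for p q
    using that M_closed[of "FArr l p" t] t by (auto simp: spans_def)
  have "\<Squnion>\<^bsub>Fib M (FOb l (Dom C d))\<^esub> ((\<lambda>(p, q). ex (FArr l q) (Tr M (FArr l p) t)) ` spans C c d) = s"
  proof (rule sup_eqI[OF M_order])
    show "(\<lambda>(p, q). ex (FArr l q) (Tr M (FArr l p) t)) ` spans C c d
      \<subseteq> carrier (Fib M (FOb l (Dom C d)))"
    proof (clarify)
      fix p q assume pq: "(p, q) \<in> spans C c d"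
      show "ex (FArr l q) (Tr M (FArr l p) t) \<in> carrier (Fib M (FOb l (Dom C d)))"
        using ex_closed[of "FArr l q" "Tr M (FArr l p) t"] span[OF pq] by simp
    qed
    show "x \<sqsubseteq>\<^bsub>Fib M (FOb l (Dom C d))\<^esub> s"
      if x: "x \<in> (\<lambda>(p, q). ex (FArr l q) (Tr M (FArr l p) t)) ` spans C c d" for x
    proof -
      obtain p q where pq: "(p, q) \<in> spans C c d" "x = ex (FArr l q) (Tr M (FArr l p) t)"
        using x by auto
      note pq' = span[OF pq(1)]
      have "t \<sqsubseteq>\<^bsub>Fib M (FOb l (Dom C c))\<^esub> Tr M (FArr l c) (ex (FArr l c) t)"
        using left_adjoint_unit[OF adj E.category_axioms pos, of "FArr l c" t] t cd by simp
      then have "Tr M (FArr l p) t \<sqsubseteq>\<^bsub>Fib M (FOb l (Dom C p))\<^esub> Tr M (FArr l p) (Tr M (FArr l c) (ex (FArr l c) t))"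
        using Tr_mono[OF pos, of "FArr l p" t "Tr M (FArr l c) (ex (FArr l c) t)"] t cd pq' ct
          M_closed[of "FArr l c" "ex (FArr l c) t"] by simp
      also have "Tr M (FArr l p) (Tr M (FArr l c) (ex (FArr l c) t))
        = Tr M (FArr l (c \<cdot> p)) (ex (FArr l c) t)"
        using M_Comp[of "FArr l c" "FArr l p"] l_Comp[of c p] cd pq' ct by simp
      also have "\<dots> = Tr M (FArr l q) s"
        using M_Comp[of "FArr l d" "FArr l q"] l_Comp[of d q] cd pq' ct by (simp add: s_def)
      finally show ?thesis
        using left_adjoint_iff[OF adj, of "FArr l q" "Tr M (FArr l p) t" s] pq pq' s by simp
    qed
    show "s \<sqsubseteq>\<^bsub>Fib M (FOb l (Dom C d))\<^esub> u" if u: "u \<in> carrier (Fib M (FOb l (Dom C d)))"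
      and ub: "\<And>x. x \<in> (\<lambda>(p, q). ex (FArr l q) (Tr M (FArr l p) t)) ` spans C c d \<Longrightarrow>
        x \<sqsubseteq>\<^bsub>Fib M (FOb l (Dom C d))\<^esub> u" for u
    proof -
      define P where "P = Dom E a"
      have P: "P \<in> sh_objects C J" "Dom E a = P" "Dom E b = P"
        using ab by (simp_all add: P_def)
      define S where "S = {point P e y | e y. e \<in> Ob C \<and> y \<in> Sec P e \<and> spanned c d a b e y}"
      have S_arr: "f \<in> sh_arrows C J \<and> Cod E f = P" if "f \<in> S" for f
        using that P(1) by (auto simp: S_def)
      have "jointly_epi C J S P"
        unfolding S_def
        by (rule points_jointly_epi[OF P(1)])
          (use locally_spanned[OF cd(1,2,3) ab(1,2) P(2,3) ab(4,5,6)] in blast)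
      note sep = jointly_epi_separated[OF M_sheaf P(1) S_arr this]
      have at: "Tr M a t \<in> carrier (Fib M P)" "Tr M b u \<in> carrier (Fib M P)"
        using M_closed[of a t] M_closed[of b u] ab P t u by simp_all
      have "Tr M a t \<sqsubseteq>\<^bsub>Fib M P\<^esub> Tr M b u"
      proof (rule order_detected[OF M _ at])
        show "P \<in> Ob E" "\<And>f. f \<in> S \<Longrightarrow> f \<in> Arr E \<and> Cod E f = P" "\<And>f. f \<in> S \<Longrightarrow> Dom E f \<in> Ob E"
          using P S_arr by simp_all
        show "z = w" if "z \<in> carrier (Fib M P)" "w \<in> carrier (Fib M P)"
          "\<And>f. f \<in> S \<Longrightarrow> Tr M f z = Tr M f w" for z w
          using sep[of z w] that by (simp add: underlying_def)
        fix f assume "f \<in> S"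
        then obtain e y where f: "f = point P e y"
          and e: "e \<in> Ob C" "y \<in> Sec P e" "spanned c d a b e y"
          unfolding S_def by blast
        obtain p q where pq: "(p, q) \<in> spans C c d" "a \<cdot>\<^bsub>E\<^esub> f = FArr l p" "b \<cdot>\<^bsub>E\<^esub> f = FArr l q"
          using spanned_point[OF e(3,1) ab(1,2) P(2,3) ab(4,5) e(2)] f by blast
        note pq' = span[OF pq(1)]
        have f_arr: "f \<in> sh_arrows C J" "Cod E f = P" "Dom E f = FOb l e"
          using f e P by simp_all
        have "Dom E (FArr l p) = Dom E f"
          using pq(2)[symmetric] ab f_arr P by simp
        then have Dom: "FOb l (Dom C p) = Dom E f"
          using pq' by simp
        have "Tr M (FArr l p) t \<sqsubseteq>\<^bsub>Fib M (FOb l (Dom C p))\<^esub> Tr M (FArr l q) u"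
        proof -
          have "ex (FArr l q) (Tr M (FArr l p) t) \<sqsubseteq>\<^bsub>Fib M (FOb l (Dom C d))\<^esub> u"
            by (rule ub) (use pq(1) in force)
          then show ?thesis
            using left_adjoint_iff[OF adj, of "FArr l q" "Tr M (FArr l p) t" u] pq' u by simp
        qed
        moreover have "Tr M f (Tr M a t) = Tr M (FArr l p) t"
          using M_Comp[of a f t] ab f_arr P t pq(2) by simp
        moreover have "Tr M f (Tr M b u) = Tr M (FArr l q) u"
          using M_Comp[of b f u] ab f_arr P u pq(3) by simp
        ultimately show "Tr M f (Tr M a t) \<sqsubseteq>\<^bsub>Fib M (Dom E f)\<^esub> Tr M f (Tr M b u)"
          using Dom by simp
      qed
      then show ?thesis
        using left_adjoint_iff[OF adj, of b "Tr M a t" u] ab P at u by (simp add: s_bc)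
    qed
  qed (use s cd in auto)
  then show "Tr (precompose M l) d (ex (FArr l c) t)
      = \<Squnion>\<^bsub>Fib (precompose M l) (Dom C d)\<^esub> ((\<lambda>(p, q). ex (FArr l q) (Tr (precompose M l) p t)) ` spans C c d)"
    by (simp add: s_def)
qed

lemma existential_of_internal_locale:
  fixes L :: "('o, 'a, 'u) pos_psh" and M :: "(('o, 'a, 'u) psh, ('o, 'a, 'u) sh_arr, 'u) pos_psh"
  assumes M: "internal_locale E M" and iso: "pos_functor_iso C L (precompose M l)"
  shows "frame_functor C L" "sheaf C J (underlying L)" "existential C L"
proof -
  obtain \<phi> where "pos_iso C L (precompose M l) \<phi>"
    using iso pos_functor_iso_iff[OF category_axioms] by blast
  from pos_iso.inverse[OF this] obtain \<psi> where \<psi>: "pos_iso C (precompose M l) L \<psi>"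
    by blast
  interpret pos_iso C "precompose M l" L \<psi> by fact
  have M_frame: "frame_valued E M" and small_M: "\<And>F. F \<in> Ob E \<Longrightarrow> small TYPE('u) (carrier (Fib M F))"
    and M_canonical: "sheaf E (canonical_topology E) (underlying M)"
    using M by (simp_all add: internal_locale_def frame_functor_iff)
  have pos: "pos_functor E M"
    using M_frame by (simp add: frame_valued_def)
  obtain ex where ex: "left_adjoints E M ex" "beck_chevalley E M ex" "frobenius E M ex"
    using M by (auto simp: internal_locale_def)
  have M_sheaf: "sheaf E (epi_topology C J) (underlying M)"
    using sheaf_subtopology[OF M_canonical epi_topology_canonical] .
  have "small TYPE('u) (carrier (Fib L c))" if c: "c \<in> Ob C" for c
  proof -
    have "carrier (Fib L c) = \<psi> c ` carrier (Fib M (FOb l c))"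
      using order_iso.bij[OF iso[OF c]] by (simp add: bij_betw_def)
    then show ?thesis
      using small_image[OF small_M[of "FOb l c"]] c by simp
  qed
  then show "frame_functor C L"
    using frame_valued_iso[OF frame_valued_precompose[OF M_frame]] by (simp add: frame_functor_iff)
  show "sheaf C J (underlying L)"
  proof (rule sheaf_transport)
    show "sheaf C J (underlying (precompose M l))"
      unfolding underlying_precompose using sheaf_restrict_along[OF M_sheaf] .
    show "nat_trans C (underlying (precompose M l)) (underlying L) \<psi>"
      using nat .
    show "bij_betw (\<psi> c) (Sec (underlying (precompose M l)) c) (Sec (underlying L) c)"
      if "c \<in> Ob C" for c
      using order_iso.bij[OF iso[OF that]] by (simp add: underlying_def)
  qed
  note adj = left_adjoints_precompose[OF pos ex(1)]
  show "existential C L"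
    unfolding existential_def
    using left_adjoints_iso[OF adj] frobenius_iso[OF adj frame_valued_precompose[OF M_frame]
      frobenius_precompose[OF ex(3)]]
      relative_beck_chevalley_iso[OF adj frame_valued_precompose[OF M_frame]
        relative_beck_chevalley_precompose[OF M_frame M_sheaf ex(1,2)]]
    by blast
qed

end

section \<open>From an existential functor to an internal locale\<close>

locale existential_site = canonical_site C J U D l \<eta>
  for C :: "('o, 'a) cat" (structure) and J and U :: "'u itself" and D and l and \<eta> +
  fixes L :: "('o, 'a, 'u) pos_psh" and ex :: "'a \<Rightarrow> 'u \<Rightarrow> 'u"
  assumes L_frame_functor: "frame_functor C L"
    and L_sheaf: "sheaf C J (underlying L)"
    and adj: "left_adjoints C L ex"
    and rbc: "relative_beck_chevalley C L ex"
    and frob: "frobenius C L ex"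
begin

lemma L_frame_valued: "frame_valued C L"
  using L_frame_functor by (simp add: frame_functor_iff)

lemma L_pos: "pos_functor C L"
  using L_frame_valued by (simp add: frame_valued_def)

lemma L_frame [simp]: "c \<in> Ob C \<Longrightarrow> frame (Fib L c)"
  using L_frame_valued by (simp add: frame_valued_def)

lemma L_complete [simp]: "c \<in> Ob C \<Longrightarrow> complete_lattice (Fib L c)"
  by (simp add: frame_complete)

lemma L_order [simp]: "c \<in> Ob C \<Longrightarrow> partial_order (Fib L c)"
  using pos_functor_order[OF L_pos] .

lemma L_hom: "f \<in> Arr C \<Longrightarrow> frame_hom (Fib L (Cod C f)) (Fib L (Dom C f)) (Tr L f)"
  using L_frame_valued by (simp add: frame_valued_def)

definition Lhat :: "('o, 'a, 'u) psh" where
  "Lhat = normalise C (underlying L)"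

lemma Lhat_object [simp]: "Lhat \<in> sh_objects C J"
  unfolding Lhat_def using L_frame_functor
  by (intro normalise_object L_sheaf) (simp add: frame_functor_iff underlying_def)

lemma Sec_Lhat [simp]: "c \<in> Ob C \<Longrightarrow> Sec Lhat c = carrier (Fib L c)"
  by (simp add: Lhat_def underlying_def)

lemma Rst_Lhat [simp]: "f \<in> Arr C \<Longrightarrow> x \<in> carrier (Fib L (Cod C f)) \<Longrightarrow> Rst Lhat f x = Tr L f x"
  by (simp add: Lhat_def underlying_def)

text \<open>The value at \<open>F\<close> of the internal locale is the set of arrows from \<open>F\<close> to the sheaf \<open>L\<close>, ordered
  pointwise. Its underlying presheaf is thus representable, hence a sheaf for the canonical
  topology.\<close>

definition N :: "(('o, 'a, 'u) psh, ('o, 'a, 'u) sh_arr, ('o, 'a, 'u) sh_arr) pos_psh" where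
  "N = \<lparr>Fib = (\<lambda>F. \<lparr>carrier = Hom E F Lhat, eq = (=),
          le = (\<lambda>s t. \<forall>c\<in>Ob C. \<forall>x\<in>Sec F c. component s c x \<sqsubseteq>\<^bsub>Fib L c\<^esub> component t c x)\<rparr>),
        Tr = (\<lambda>e s. s \<cdot>\<^bsub>E\<^esub> e)\<rparr>"

lemma carrier_N [simp]: "carrier (Fib N F) = Hom E F Lhat"
  by (simp add: N_def)

lemma le_N: "s \<sqsubseteq>\<^bsub>Fib N F\<^esub> t \<longleftrightarrow> (\<forall>c\<in>Ob C. \<forall>x\<in>Sec F c. component s c x \<sqsubseteq>\<^bsub>Fib L c\<^esub> component t c x)"
  by (simp add: N_def)

lemma Tr_N [simp]: "Tr N e s = s \<cdot>\<^bsub>E\<^esub> e"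
  by (simp add: N_def)

lemma underlying_N: "underlying N = yo E Lhat"
  by (simp add: underlying_def yo_def N_def)

lemma N_closed: "s \<in> Hom E F Lhat \<Longrightarrow> c \<in> Ob C \<Longrightarrow> x \<in> Sec F c \<Longrightarrow> component s c x \<in> carrier (Fib L c)"
  using nat_trans_closed[OF Hom_Sh(6), of s C J F Lhat c x] by simp

lemma N_natural:
  "s \<in> Hom E F Lhat \<Longrightarrow> f \<in> Arr C \<Longrightarrow> x \<in> Sec F (Cod C f) \<Longrightarrow>
    component s (Dom C f) (Rst F f x) = Tr L f (component s (Cod C f) x)"
  using nat_trans_natural[OF Hom_Sh(6), of s C J F Lhat f x] N_closed[of s F "Cod C f" x] by simp

lemma N_eqI:
  assumes "s \<in> Hom E F Lhat" "t \<in> Hom E F Lhat"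
    "\<And>c x. c \<in> Ob C \<Longrightarrow> x \<in> Sec F c \<Longrightarrow> component s c x = component t c x"
  shows "s = t"
  using Hom_Sh[OF assms(1)] Hom_Sh[OF assms(2)] assms(3) by (intro arrow_eqI) auto

lemma N_arrow:
  assumes F: "F \<in> sh_objects C J"
    and "\<And>c x. c \<in> Ob C \<Longrightarrow> x \<in> Sec F c \<Longrightarrow> \<beta> c x \<in> carrier (Fib L c)"
    and "\<And>f x. f \<in> Arr C \<Longrightarrow> x \<in> Sec F (Cod C f) \<Longrightarrow> \<beta> (Dom C f) (Rst F f x) = Tr L f (\<beta> (Cod C f) x)"
  shows "sh_arrow C F Lhat \<beta> \<in> Hom E F Lhat"
  using assms by (intro sh_arrow_Hom[OF category_axioms F Lhat_object]) (simp add: nat_trans_def)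

lemma component_Tr_N:
  "e \<in> sh_arrows C J \<Longrightarrow> c \<in> Ob C \<Longrightarrow> x \<in> Sec (Dom E e) c \<Longrightarrow>
    component (s \<cdot>\<^bsub>E\<^esub> e) c x = component s c (component e c x)"
  by (rule component_Comp)

lemma eq_N: "(.=\<^bsub>Fib N F\<^esub>) = (=)"
  by (simp add: N_def)

lemma N_order: "partial_order (Fib N F)"
proof -
  have refl_N: "s \<sqsubseteq>\<^bsub>Fib N F\<^esub> s" if "s \<in> Hom E F Lhat" for s
    unfolding le_N using N_closed[OF that] by (simp add: order_refl)
  have antisym_N: "s = t" if "s \<sqsubseteq>\<^bsub>Fib N F\<^esub> t" "t \<sqsubseteq>\<^bsub>Fib N F\<^esub> s" "s \<in> Hom E F Lhat"
    "t \<in> Hom E F Lhat" for s t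
    using that N_closed[OF that(3)] N_closed[OF that(4)] unfolding le_N
    by (intro N_eqI[OF that(3,4)] order_antisym[OF L_order]) auto
  have trans_N: "s \<sqsubseteq>\<^bsub>Fib N F\<^esub> r" if "s \<sqsubseteq>\<^bsub>Fib N F\<^esub> t" "t \<sqsubseteq>\<^bsub>Fib N F\<^esub> r" "s \<in> Hom E F Lhat"
    "t \<in> Hom E F Lhat" "r \<in> Hom E F Lhat" for s t r
    unfolding le_N
  proof (intro ballI)
    fix c x assume c: "c \<in> Ob C" "x \<in> Sec F c"
    show "component s c x \<sqsubseteq>\<^bsub>Fib L c\<^esub> component r c x"
      by (rule order_trans[OF L_order, of _ _ "component t c x"])
        (use that(1,2) N_closed[OF that(3)] N_closed[OF that(4)] N_closed[OF that(5)] c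
          in \<open>simp_all add: le_N\<close>)
  qed
  show ?thesis
    by (unfold_locales, unfold eq_N carrier_N) (blast intro: refl_N antisym_N trans_N)+
qed

definition N_sup :: "('o, 'a, 'u) psh \<Rightarrow> ('o, 'a, 'u) sh_arr set \<Rightarrow> ('o, 'a, 'u) sh_arr" where
  "N_sup F A = sh_arrow C F Lhat (\<lambda>c x. \<Squnion>\<^bsub>Fib L c\<^esub> ((\<lambda>s. component s c x) ` A))"

definition N_meet :: "('o, 'a, 'u) psh \<Rightarrow> ('o, 'a, 'u) sh_arr \<Rightarrow> ('o, 'a, 'u) sh_arr \<Rightarrow>
  ('o, 'a, 'u) sh_arr" where
  "N_meet F s t = sh_arrow C F Lhat (\<lambda>c x. component s c x \<sqinter>\<^bsub>Fib L c\<^esub> component t c x)"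

context
  fixes F :: "('o, 'a, 'u) psh"
  assumes F: "F \<in> sh_objects C J"
begin

lemma components_in:
  "A \<subseteq> Hom E F Lhat \<Longrightarrow> c \<in> Ob C \<Longrightarrow> x \<in> Sec F c \<Longrightarrow> (\<lambda>s. component s c x) ` A \<subseteq> carrier (Fib L c)"
  using N_closed by blast

lemma N_sup_Hom:
  assumes A: "A \<subseteq> Hom E F Lhat"
  shows "N_sup F A \<in> Hom E F Lhat"
  unfolding N_sup_def
proof (rule N_arrow[OF F])
  show "\<Squnion>\<^bsub>Fib L c\<^esub> ((\<lambda>s. component s c x) ` A) \<in> carrier (Fib L c)" if "c \<in> Ob C"
    "x \<in> Sec F c" for c x
    using sup_in[OF L_complete[OF that(1)] components_in[OF A that]] .
  fix f x assume f: "f \<in> Arr C" and x: "x \<in> Sec F (Cod C f)"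
  have "Tr L f (\<Squnion>\<^bsub>Fib L (Cod C f)\<^esub> ((\<lambda>s. component s (Cod C f) x) ` A))
      = \<Squnion>\<^bsub>Fib L (Dom C f)\<^esub> (Tr L f ` (\<lambda>s. component s (Cod C f) x) ` A)"
    using frame_hom_sup[OF L_hom[OF f] components_in[OF A _ x]] f by simp
  also have "Tr L f ` (\<lambda>s. component s (Cod C f) x) ` A
    = (\<lambda>s. component s (Dom C f) (Rst F f x)) ` A"
    unfolding image_image using N_natural f x A by (intro image_cong) auto
  finally show "\<Squnion>\<^bsub>Fib L (Dom C f)\<^esub> ((\<lambda>s. component s (Dom C f) (Rst F f x)) ` A)
      = Tr L f (\<Squnion>\<^bsub>Fib L (Cod C f)\<^esub> ((\<lambda>s. component s (Cod C f) x) ` A))" by simp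
qed

lemma component_N_sup:
  "c \<in> Ob C \<Longrightarrow> x \<in> Sec F c \<Longrightarrow> component (N_sup F A) c x = \<Squnion>\<^bsub>Fib L c\<^esub> ((\<lambda>s. component s c x) ` A)"
  by (simp add: N_sup_def)

lemma N_sup_upper: "A \<subseteq> Hom E F Lhat \<Longrightarrow> s \<in> A \<Longrightarrow> s \<sqsubseteq>\<^bsub>Fib N F\<^esub> N_sup F A"
  unfolding le_N using sup_ub[OF L_complete components_in] by (simp add: component_N_sup)

lemma N_sup_least:
  "A \<subseteq> Hom E F Lhat \<Longrightarrow> t \<in> Hom E F Lhat \<Longrightarrow> (\<And>s. s \<in> A \<Longrightarrow> s \<sqsubseteq>\<^bsub>Fib N F\<^esub> t) \<Longrightarrow> N_sup F A \<sqsubseteq>\<^bsub>Fib N F\<^esub> t"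
  unfolding le_N by (auto simp: component_N_sup intro!: sup_least components_in N_closed)

lemma N_complete: "complete_lattice (Fib N F)"
proof (rule complete_lattice_of_sups[OF N_order])
  fix A assume "A \<subseteq> carrier (Fib N F)"
  then have A: "A \<subseteq> Hom E F Lhat"
    by simp
  show "\<exists>s\<in>carrier (Fib N F). (\<forall>a\<in>A. a \<sqsubseteq>\<^bsub>Fib N F\<^esub> s) \<and>
      (\<forall>u\<in>carrier (Fib N F). (\<forall>a\<in>A. a \<sqsubseteq>\<^bsub>Fib N F\<^esub> u) \<longrightarrow> s \<sqsubseteq>\<^bsub>Fib N F\<^esub> u)"
    using N_sup_Hom[OF A] N_sup_upper[OF A] N_sup_least[OF A]
    by (intro bexI[of _ "N_sup F A"]) simp_all
qed

lemma N_sup_eq: "A \<subseteq> Hom E F Lhat \<Longrightarrow> \<Squnion>\<^bsub>Fib N F\<^esub> A = N_sup F A"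
  using N_sup_Hom N_sup_upper N_sup_least by (intro sup_eqI[OF N_order]) simp_all

lemma N_meet_Hom:
  assumes "s \<in> Hom E F Lhat" "t \<in> Hom E F Lhat"
  shows "N_meet F s t \<in> Hom E F Lhat"
  unfolding N_meet_def
proof (rule N_arrow[OF F])
  show "component s (Dom C f) (Rst F f x) \<sqinter>\<^bsub>Fib L (Dom C f)\<^esub> component t (Dom C f) (Rst F f x)
      = Tr L f (component s (Cod C f) x \<sqinter>\<^bsub>Fib L (Cod C f)\<^esub> component t (Cod C f) x)"
    if "f \<in> Arr C" "x \<in> Sec F (Cod C f)" for f x
    using frame_hom_meet[OF L_hom[OF that(1)]] N_natural[OF assms(1) that]
      N_natural[OF assms(2) that]
      N_closed[OF assms(1)] N_closed[OF assms(2)] that by simp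
qed (use N_closed[OF assms(1)] N_closed[OF assms(2)] in \<open>simp_all add: meet_in\<close>)

lemma component_N_meet:
  "c \<in> Ob C \<Longrightarrow> x \<in> Sec F c \<Longrightarrow> component (N_meet F s t) c x
    = component s c x \<sqinter>\<^bsub>Fib L c\<^esub> component t c x"
  by (simp add: N_meet_def)

lemma N_meet_eq:
  assumes s: "s \<in> Hom E F Lhat" and t: "t \<in> Hom E F Lhat"
  shows "s \<sqinter>\<^bsub>Fib N F\<^esub> t = N_meet F s t"
proof (rule meet_eqI[OF N_order])
  show "N_meet F s t \<sqsubseteq>\<^bsub>Fib N F\<^esub> s" "N_meet F s t \<sqsubseteq>\<^bsub>Fib N F\<^esub> t"
    unfolding le_N using meet_lower[OF L_complete] N_closed[OF s] N_closed[OF t]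
    by (simp_all add: component_N_meet)
  show "u \<sqsubseteq>\<^bsub>Fib N F\<^esub> N_meet F s t"
    if "u \<in> carrier (Fib N F)" "u \<sqsubseteq>\<^bsub>Fib N F\<^esub> s" "u \<sqsubseteq>\<^bsub>Fib N F\<^esub> t" for u
    using that(2,3) N_closed[of u F] that(1) N_closed[OF s] N_closed[OF t] unfolding le_N
    by (simp add: component_N_meet meet_greatest)
qed (use s t N_meet_Hom in simp_all)

lemma component_N_top:
  assumes "c \<in> Ob C" "x \<in> Sec F c"
  shows "component \<top>\<^bsub>Fib N F\<^esub> c x = \<top>\<^bsub>Fib L c\<^esub>"
proof -
  have T: "sh_arrow C F Lhat (\<lambda>c x. \<top>\<^bsub>Fib L c\<^esub>) \<in> Hom E F Lhat" (is "?T \<in> _")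
    using frame_hom_top[OF L_hom] by (intro N_arrow[OF F]) (simp_all add: top_in)
  moreover have "u \<sqsubseteq>\<^bsub>Fib N F\<^esub> ?T" if "u \<in> carrier (Fib N F)" for u
    using N_closed[of u F] that by (simp add: le_N top_in)
  ultimately have "\<top>\<^bsub>Fib N F\<^esub> = ?T"
    by (intro top_eqI[OF N_order]) simp_all
  then show ?thesis
    using assms by simp
qed

lemma N_frame: "frame (Fib N F)"
  unfolding frame_def
proof (intro conjI ballI allI impI N_complete)
  fix s A assume "s \<in> carrier (Fib N F)" and "A \<subseteq> carrier (Fib N F)"
  then have s: "s \<in> Hom E F Lhat" and A: "A \<subseteq> Hom E F Lhat"
    by simp_all
  have sA: "(\<lambda>a. s \<sqinter>\<^bsub>Fib N F\<^esub> a) ` A = N_meet F s ` A"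
    using s A by (intro image_cong) (auto simp: N_meet_eq)
  have sA': "N_meet F s ` A \<subseteq> Hom E F Lhat"
    using s A N_meet_Hom by blast
  have "N_meet F s (N_sup F A) = N_sup F (N_meet F s ` A)"
  proof (rule N_eqI[OF N_meet_Hom[OF s N_sup_Hom[OF A]] N_sup_Hom[OF sA']])
    fix c x assume c: "c \<in> Ob C" and x: "x \<in> Sec F c"
    have "component s c x \<sqinter>\<^bsub>Fib L c\<^esub> \<Squnion>\<^bsub>Fib L c\<^esub> ((\<lambda>t. component t c x) ` A)
        = \<Squnion>\<^bsub>Fib L c\<^esub> ((\<lambda>y. component s c x \<sqinter>\<^bsub>Fib L c\<^esub> y) ` (\<lambda>t. component t c x) ` A)"
      using frame_distrib[OF L_frame[OF c] N_closed[OF s c x] components_in[OF A c x]] .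
    then show "component (N_meet F s (N_sup F A)) c x = component (N_sup F (N_meet F s ` A)) c x"
      using c x by (simp add: component_N_meet component_N_sup image_image)
  qed
  then show "s \<sqinter>\<^bsub>Fib N F\<^esub> \<Squnion>\<^bsub>Fib N F\<^esub> A = \<Squnion>\<^bsub>Fib N F\<^esub> ((\<lambda>a. s \<sqinter>\<^bsub>Fib N F\<^esub> a) ` A)"
    using s A sA sA' N_sup_Hom[OF A] by (simp add: N_sup_eq N_meet_eq)
qed

end

lemma N_Tr_closed:
  assumes "e \<in> sh_arrows C J" "s \<in> Hom E (Cod E e) Lhat"
  shows "s \<cdot>\<^bsub>E\<^esub> e \<in> Hom E (Dom E e) Lhat"
  using Hom_Sh[OF assms(2)] assms(1) by (simp add: Hom_def)

lemma N_frame_hom: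
  assumes e: "e \<in> sh_arrows C J"
  shows "frame_hom (Fib N (Cod E e)) (Fib N (Dom E e)) (Tr N e)"
proof -
  have obj: "Cod E e \<in> sh_objects C J" "Dom E e \<in> sh_objects C J"
    using e by simp_all
  note ec = arrow_closed[OF e]
  show ?thesis
  proof (rule frame_homI[OF N_complete[OF obj(1)] N_complete[OF obj(2)]])
    show "Tr N e s \<in> carrier (Fib N (Dom E e))" if "s \<in> carrier (Fib N (Cod E e))" for s
      using N_Tr_closed[OF e] that by simp
    fix A assume "A \<subseteq> carrier (Fib N (Cod E e))"
    then have A: "A \<subseteq> Hom E (Cod E e) Lhat"
      by simp
    have eA: "Tr N e ` A \<subseteq> Hom E (Dom E e) Lhat"
      using A N_Tr_closed[OF e] by auto
    have "N_sup (Cod E e) A \<cdot>\<^bsub>E\<^esub> e = N_sup (Dom E e) (Tr N e ` A)"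
    proof (rule N_eqI[OF N_Tr_closed[OF e N_sup_Hom[OF obj(1) A]] N_sup_Hom[OF obj(2) eA]])
      fix c x assume c: "c \<in> Ob C" and x: "x \<in> Sec (Dom E e) c"
      show "component (N_sup (Cod E e) A \<cdot>\<^bsub>E\<^esub> e) c x = component (N_sup (Dom E e) (Tr N e ` A)) c x"
        using c x ec by (simp add: component_Tr_N[OF e] component_N_sup[OF obj(1)]
          component_N_sup[OF obj(2)] image_image)
    qed
    then show "Tr N e (\<Squnion>\<^bsub>Fib N (Cod E e)\<^esub> A) = \<Squnion>\<^bsub>Fib N (Dom E e)\<^esub> (Tr N e ` A)"
      using N_sup_eq[OF obj(1) A] N_sup_eq[OF obj(2) eA] by simp
  next
    fix s t assume "s \<in> carrier (Fib N (Cod E e))" "t \<in> carrier (Fib N (Cod E e))"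
    then have st: "s \<in> Hom E (Cod E e) Lhat" "t \<in> Hom E (Cod E e) Lhat"
      by simp_all
    note est = N_Tr_closed[OF e st(1)] N_Tr_closed[OF e st(2)]
    have "N_meet (Cod E e) s t \<cdot>\<^bsub>E\<^esub> e = N_meet (Dom E e) (s \<cdot>\<^bsub>E\<^esub> e) (t \<cdot>\<^bsub>E\<^esub> e)"
    proof (rule N_eqI[OF N_Tr_closed[OF e N_meet_Hom[OF obj(1) st]] N_meet_Hom[OF obj(2) est]])
      fix c x assume c: "c \<in> Ob C" and x: "x \<in> Sec (Dom E e) c"
      show "component (N_meet (Cod E e) s t \<cdot>\<^bsub>E\<^esub> e) c x
        = component (N_meet (Dom E e) (s \<cdot>\<^bsub>E\<^esub> e) (t \<cdot>\<^bsub>E\<^esub> e)) c x"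
        using c x ec by (simp add: component_Tr_N[OF e] component_N_meet[OF obj(1)]
          component_N_meet[OF obj(2)])
    qed
    then show "Tr N e (s \<sqinter>\<^bsub>Fib N (Cod E e)\<^esub> t) = Tr N e s \<sqinter>\<^bsub>Fib N (Dom E e)\<^esub> Tr N e t"
      using N_meet_eq[OF obj(1) st] N_meet_eq[OF obj(2) est] by simp
  next
    have top: "\<top>\<^bsub>Fib N F\<^esub> \<in> Hom E F Lhat" if "F \<in> sh_objects C J" for F
      using top_in(1)[OF N_complete[OF that]] by simp
    have "\<top>\<^bsub>Fib N (Cod E e)\<^esub> \<cdot>\<^bsub>E\<^esub> e = \<top>\<^bsub>Fib N (Dom E e)\<^esub>"
    proof (rule N_eqI[OF N_Tr_closed[OF e top[OF obj(1)]] top[OF obj(2)]])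
      fix c x assume c: "c \<in> Ob C" and x: "x \<in> Sec (Dom E e) c"
      show "component (\<top>\<^bsub>Fib N (Cod E e)\<^esub> \<cdot>\<^bsub>E\<^esub> e) c x = component \<top>\<^bsub>Fib N (Dom E e)\<^esub> c x"
        using c x ec by (simp add: component_Tr_N[OF e] component_N_top[OF obj(1)]
          component_N_top[OF obj(2)])
    qed
    then show "Tr N e \<top>\<^bsub>Fib N (Cod E e)\<^esub> = \<top>\<^bsub>Fib N (Dom E e)\<^esub>"
      by simp
  qed
qed

lemma N_pos: "pos_functor E N"
  unfolding pos_functor_def
proof (intro conjI ballI)
  show "presheaf E (underlying N)"
    unfolding underlying_N using E.presheaf_yo .
  fix e assume "e \<in> Arr E"
  then have e: "e \<in> sh_arrows C J"
    by simp
  show "isotone (Fib N (Cod E e)) (Fib N (Dom E e)) (Tr N e)"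
    unfolding isotone_def
  proof (intro conjI ballI impI)
    show "weak_partial_order (Fib N (Cod E e))" "weak_partial_order (Fib N (Dom E e))"
      using N_order by (simp_all add: partial_order_def)
    show "Tr N e s \<sqsubseteq>\<^bsub>Fib N (Dom E e)\<^esub> Tr N e t" if "s \<sqsubseteq>\<^bsub>Fib N (Cod E e)\<^esub> t" for s t
      using that arrow_closed[OF e] by (simp add: le_N component_Tr_N[OF e])
  qed
qed (rule N_order)

lemma N_frame_valued: "frame_valued E N"
  unfolding frame_valued_def using N_pos N_frame N_frame_hom by simp

text \<open>The left adjoint along \<open>e\<close> at a section \<open>y\<close> is the join of the values along all the ways of
  lifting a restriction of \<open>y\<close> through \<open>e\<close>: the left Kan extension formula. The relative
  Beck--Chevalley condition makes this natural in \<open>y\<close>.\<close>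

definition lifts :: "('o, 'a, 'u) sh_arr \<Rightarrow> ('o, 'a, 'u) sh_arr \<Rightarrow> 'o \<Rightarrow> 'u \<Rightarrow> 'u set" where
  "lifts e s c y = {ex g (component s (Dom C g) x) | g x. g \<in> Arr C \<and> Cod C g = c \<and>
     x \<in> Sec (Dom E e) (Dom C g) \<and> component e (Dom C g) x = Rst (Cod E e) g y}"

definition exN :: "('o, 'a, 'u) sh_arr \<Rightarrow> ('o, 'a, 'u) sh_arr \<Rightarrow> ('o, 'a, 'u) sh_arr" where
  "exN e s = sh_arrow C (Cod E e) Lhat (\<lambda>c y. \<Squnion>\<^bsub>Fib L c\<^esub> (lifts e s c y))"

lemma ex_closed: "g \<in> Arr C \<Longrightarrow> x \<in> carrier (Fib L (Dom C g)) \<Longrightarrow> ex g x \<in> carrier (Fib L (Cod C g))"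
  using left_adjoint_closed[OF adj] .

lemma ex_iff:
  "g \<in> Arr C \<Longrightarrow> x \<in> carrier (Fib L (Dom C g)) \<Longrightarrow> y \<in> carrier (Fib L (Cod C g)) \<Longrightarrow>
    ex g x \<sqsubseteq>\<^bsub>Fib L (Cod C g)\<^esub> y \<longleftrightarrow> x \<sqsubseteq>\<^bsub>Fib L (Dom C g)\<^esub> Tr L g y"
  using left_adjoint_iff[OF adj] .

lemma component_exN:
  "c \<in> Ob C \<Longrightarrow> y \<in> Sec (Cod E e) c \<Longrightarrow> component (exN e s) c y = \<Squnion>\<^bsub>Fib L c\<^esub> (lifts e s c y)"
  by (simp add: exN_def)

context
  fixes e s
  assumes e: "e \<in> sh_arrows C J" and s: "s \<in> Hom E (Dom E e) Lhat"
begin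

lemma lifts_in: "lifts e s c y \<subseteq> carrier (Fib L c)"
proof
  fix z assume "z \<in> lifts e s c y"
  then obtain g x where "z = ex g (component s (Dom C g) x)" "g \<in> Arr C" "Cod C g = c"
    "x \<in> Sec (Dom E e) (Dom C g)"
    unfolding lifts_def by blast
  then show "z \<in> carrier (Fib L c)"
    using ex_closed[of g "component s (Dom C g) x"] N_closed[OF s, of "Dom C g" x] by simp
qed

text \<open>For one inequality, the relative Beck--Chevalley condition turns the restriction along \<open>h\<close> of a
  value at a lift into a join of values at lifts of the restricted section. For the other, a lift of
  the restriction of \<open>y\<close> along \<open>h\<close> is also a lift of \<open>y\<close>, and the adjunctions apply.\<close>

lemma lifts_natural:
  assumes h: "h \<in> Arr C" and y: "y \<in> Sec (Cod E e) (Cod C h)"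
  shows "Tr L h (\<Squnion>\<^bsub>Fib L (Cod C h)\<^esub> (lifts e s (Cod C h) y))
    = \<Squnion>\<^bsub>Fib L (Dom C h)\<^esub> (lifts e s (Dom C h) (Rst (Cod E e) h y))"
proof (rule order_antisym[OF L_order])
  have obj: "Dom E e \<in> sh_objects C J" "Cod E e \<in> sh_objects C J"
    using e by simp_all
  let ?T = "\<Squnion>\<^bsub>Fib L (Cod C h)\<^esub> (lifts e s (Cod C h) y)"
  let ?R = "\<Squnion>\<^bsub>Fib L (Dom C h)\<^esub> (lifts e s (Dom C h) (Rst (Cod E e) h y))"
  have T: "?T \<in> carrier (Fib L (Cod C h))"
    using sup_in[OF L_complete lifts_in] h by simp
  show in_L: "Tr L h ?T \<in> carrier (Fib L (Dom C h))" "?R \<in> carrier (Fib L (Dom C h))"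
    using Tr_closed[OF L_pos h T] sup_in[OF L_complete lifts_in] h by simp_all
  have Rst_y: "Rst (Cod E e) q (Rst (Cod E e) h y) = Rst (Cod E e) (h \<cdot> q) y"
    if "q \<in> Arr C" "Cod C q = Dom C h" for q
    using presheaf_Comp[OF presheaf_object[OF obj(2)] h that(1) _ y] that by simp
  have "Tr L h ?T = \<Squnion>\<^bsub>Fib L (Dom C h)\<^esub> (Tr L h ` lifts e s (Cod C h) y)"
    using frame_hom_sup[OF L_hom[OF h] lifts_in] .
  also have "\<dots> \<sqsubseteq>\<^bsub>Fib L (Dom C h)\<^esub> ?R"
  proof (rule sup_least[OF L_complete])
    show "Tr L h ` lifts e s (Cod C h) y \<subseteq> carrier (Fib L (Dom C h))"
      using lifts_in Tr_closed[OF L_pos h] by blast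
    fix z assume "z \<in> Tr L h ` lifts e s (Cod C h) y"
    then obtain g x where z: "z = Tr L h (ex g (component s (Dom C g) x))"
      and g: "g \<in> Arr C" "Cod C g = Cod C h" and x: "x \<in> Sec (Dom E e) (Dom C g)"
        "component e (Dom C g) x = Rst (Cod E e) g y"
      unfolding lifts_def by blast
    have sx: "component s (Dom C g) x \<in> carrier (Fib L (Dom C g))"
      using N_closed[OF s _ x(1)] g by simp
    have "z = \<Squnion>\<^bsub>Fib L (Dom C h)\<^esub> ((\<lambda>(p, q). ex q (Tr L p (component s (Dom C g) x))) ` spans C g h)"
      using rbc g h sx unfolding z relative_beck_chevalley_def by blast
    also have "\<dots> \<sqsubseteq>\<^bsub>Fib L (Dom C h)\<^esub> ?R"
    proof (rule sup_least[OF L_complete _ in_L(2)])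
      have span: "ex q (Tr L p (component s (Dom C g) x)) \<in> lifts e s (Dom C h) (Rst (Cod E e) h y)"
        if pq: "(p, q) \<in> spans C g h" for p q
      proof -
        have arr: "p \<in> Arr C" "q \<in> Arr C" "Dom C p = Dom C q" "Cod C p = Dom C g"
          "Cod C q = Dom C h" "g \<cdot> p = h \<cdot> q"
          using pq by (auto simp: spans_def)
        have "Tr L p (component s (Dom C g) x) = component s (Dom C q) (Rst (Dom E e) p x)"
          using N_natural[OF s arr(1), of x] arr x by simp
        moreover have "Rst (Dom E e) p x \<in> Sec (Dom E e) (Dom C q)"
          using object_closed[OF obj(1) arr(1), of x] arr x by simp
        moreover have "component e (Dom C q) (Rst (Dom E e) p x)
          = Rst (Cod E e) q (Rst (Cod E e) h y)"
        proof -
          have "component e (Dom C q) (Rst (Dom E e) p x) = Rst (Cod E e) p (Rst (Cod E e) g y)"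
            using arrow_natural[OF e arr(1), of x] arr x by simp
          also have "\<dots> = Rst (Cod E e) (g \<cdot> p) y"
            using presheaf_Comp[OF presheaf_object[OF obj(2)] g(1) arr(1), of y] arr g y by simp
          finally show ?thesis
            using Rst_y[of q] arr by simp
        qed
        ultimately show ?thesis
          unfolding lifts_def using arr by auto
      qed
      show "(\<lambda>(p, q). ex q (Tr L p (component s (Dom C g) x))) ` spans C g h
        \<subseteq> carrier (Fib L (Dom C h))"
        using subsetD[OF lifts_in span] by (intro image_subsetI) (auto split: prod.split)
      show "w \<sqsubseteq>\<^bsub>Fib L (Dom C h)\<^esub> ?R"
        if w: "w \<in> (\<lambda>(p, q). ex q (Tr L p (component s (Dom C g) x))) ` spans C g h" for w
      proof -
        have "w \<in> lifts e s (Dom C h) (Rst (Cod E e) h y)"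
          using w span by auto
        then show ?thesis
          using sup_ub[OF L_complete lifts_in] h by simp
      qed
    qed (use h in simp)
    finally show "z \<sqsubseteq>\<^bsub>Fib L (Dom C h)\<^esub> ?R" .
  qed (use h in_L in simp_all)
  finally show "Tr L h ?T \<sqsubseteq>\<^bsub>Fib L (Dom C h)\<^esub> ?R" .
  show "?R \<sqsubseteq>\<^bsub>Fib L (Dom C h)\<^esub> Tr L h ?T"
  proof (rule sup_least[OF L_complete lifts_in in_L(1)])
    fix z assume "z \<in> lifts e s (Dom C h) (Rst (Cod E e) h y)"
    then obtain q x where z: "z = ex q (component s (Dom C q) x)"
      and q: "q \<in> Arr C" "Cod C q = Dom C h" and x: "x \<in> Sec (Dom E e) (Dom C q)"
        "component e (Dom C q) x = Rst (Cod E e) q (Rst (Cod E e) h y)"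
      unfolding lifts_def by blast
    have sx: "component s (Dom C q) x \<in> carrier (Fib L (Dom C q))"
      using N_closed[OF s _ x(1)] q by simp
    have "ex (h \<cdot> q) (component s (Dom C q) x) \<in> lifts e s (Cod C h) y"
      unfolding lifts_def using h q x Rst_y[OF q]
      by (intro CollectI exI[of _ "h \<cdot> q"] exI[of _ x]) simp
    then have "ex (h \<cdot> q) (component s (Dom C q) x) \<sqsubseteq>\<^bsub>Fib L (Cod C h)\<^esub> ?T"
      using sup_ub[OF L_complete lifts_in] h by simp
    then have "component s (Dom C q) x \<sqsubseteq>\<^bsub>Fib L (Dom C q)\<^esub> Tr L (h \<cdot> q) ?T"
      using ex_iff[of "h \<cdot> q" "component s (Dom C q) x" ?T] h q sx T by simp
    also have "Tr L (h \<cdot> q) ?T = Tr L q (Tr L h ?T)"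
      using Tr_Comp[OF L_pos h q T] .
    finally show "z \<sqsubseteq>\<^bsub>Fib L (Dom C h)\<^esub> Tr L h ?T"
      using ex_iff[OF q(1) sx, of "Tr L h ?T"] q in_L z by simp
  qed (use h in simp)
qed (use h in simp)

lemma exN_Hom: "exN e s \<in> Hom E (Cod E e) Lhat"
  unfolding exN_def
  by (rule N_arrow) (use e lifts_natural sup_in[OF L_complete lifts_in] in simp_all)

text \<open>The implication from left to right uses that a section \<open>x\<close> of the domain is, along the identity, a
  lift of its own image under \<open>e\<close>; the other one compares the values at each lift.\<close>

lemma exN_iff:
  assumes t: "t \<in> Hom E (Cod E e) Lhat"
  shows "exN e s \<sqsubseteq>\<^bsub>Fib N (Cod E e)\<^esub> t \<longleftrightarrow> s \<sqsubseteq>\<^bsub>Fib N (Dom E e)\<^esub> t \<cdot>\<^bsub>E\<^esub> e"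
proof
  assume le: "exN e s \<sqsubseteq>\<^bsub>Fib N (Cod E e)\<^esub> t"
  show "s \<sqsubseteq>\<^bsub>Fib N (Dom E e)\<^esub> t \<cdot>\<^bsub>E\<^esub> e"
    unfolding le_N
  proof (intro ballI)
    fix c x assume c: "c \<in> Ob C" and x: "x \<in> Sec (Dom E e) c"
    have ex: "component e c x \<in> Sec (Cod E e) c"
      using arrow_closed[OF e c x] .
    note sx = N_closed[OF s c x] and tx = N_closed[OF t c ex]
    have "ex (Id C c) (component s c x) \<in> lifts e s c (component e c x)"
      unfolding lifts_def using c x presheaf_Id[OF presheaf_object[OF E_Cod[OF e]] c ex]
      by (intro CollectI exI[of _ "Id C c"] exI[of _ x]) simp
    then have "ex (Id C c) (component s c x) \<sqsubseteq>\<^bsub>Fib L c\<^esub> component (exN e s) c (component e c x)"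
      using sup_ub[OF L_complete[OF c] lifts_in] c ex by (simp add: component_exN)
    moreover have "component (exN e s) c (component e c x)
      \<sqsubseteq>\<^bsub>Fib L c\<^esub> component t c (component e c x)"
      using le c ex by (simp add: le_N)
    ultimately have "ex (Id C c) (component s c x) \<sqsubseteq>\<^bsub>Fib L c\<^esub> component t c (component e c x)"
      by (rule order_trans[OF L_order[OF c]])
        (use ex_closed[of "Id C c" "component s c x"] N_closed[OF exN_Hom c ex] sx tx c in simp_all)
    then have "component s c x \<sqsubseteq>\<^bsub>Fib L c\<^esub> Tr L (Id C c) (component t c (component e c x))"
      using ex_iff[of "Id C c" "component s c x" "component t c (component e c x)"] c sx tx by simp
    also have "Tr L (Id C c) (component t c (component e c x)) = component t c (component e c x)"
      using presheaf_Id[OF pos_functor_presheaf[OF L_pos] c, of "component t c (component e c x)"]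
        tx
      by (simp add: underlying_def)
    finally show "component s c x \<sqsubseteq>\<^bsub>Fib L c\<^esub> component (t \<cdot>\<^bsub>E\<^esub> e) c x"
      using component_Tr_N[OF e c x] by simp
  qed
next
  assume le: "s \<sqsubseteq>\<^bsub>Fib N (Dom E e)\<^esub> t \<cdot>\<^bsub>E\<^esub> e"
  show "exN e s \<sqsubseteq>\<^bsub>Fib N (Cod E e)\<^esub> t"
    unfolding le_N
  proof (intro ballI)
    fix c y assume c: "c \<in> Ob C" and y: "y \<in> Sec (Cod E e) c"
    have "\<Squnion>\<^bsub>Fib L c\<^esub> (lifts e s c y) \<sqsubseteq>\<^bsub>Fib L c\<^esub> component t c y"
    proof (rule sup_least[OF L_complete[OF c] lifts_in N_closed[OF t c y]])
      fix z assume "z \<in> lifts e s c y"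
      then obtain g x where z: "z = ex g (component s (Dom C g) x)" and g: "g \<in> Arr C" "Cod C g = c"
        and x: "x \<in> Sec (Dom E e) (Dom C g)" "component e (Dom C g) x = Rst (Cod E e) g y"
        unfolding lifts_def by blast
      have "component s (Dom C g) x \<sqsubseteq>\<^bsub>Fib L (Dom C g)\<^esub> component t (Dom C g) (component e (Dom C g) x)"
        using le[unfolded le_N, rule_format, OF Dom_Ob[OF g(1)] x(1)]
          component_Tr_N[OF e Dom_Ob[OF g(1)] x(1), of t] by simp
      also have "\<dots> = Tr L g (component t c y)"
        using N_natural[OF t g(1), of y] g y x by simp
      finally show "z \<sqsubseteq>\<^bsub>Fib L c\<^esub> component t c y"
        using ex_iff[OF g(1), of "component s (Dom C g) x"
          "component t c y"] z g N_closed[OF s _ x(1)] N_closed[OF t c y]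
        by simp
    qed
    then show "component (exN e s) c y \<sqsubseteq>\<^bsub>Fib L c\<^esub> component t c y"
      using c y by (simp add: component_exN)
  qed
qed

end

lemma N_left_adjoints: "left_adjoints E N exN"
  using exN_Hom exN_iff by (intro left_adjointsI[OF E.category_axioms N_pos]) simp_all

text \<open>The Frobenius condition in the site holds for each lift, and binary meets distribute over the join
  of all the lifts.\<close>

lemma N_frobenius: "frobenius E N exN"
  unfolding frobenius_def
proof (intro ballI)
  fix e s t assume "e \<in> Arr E" "s \<in> carrier (Fib N (Dom E e))" "t \<in> carrier (Fib N (Cod E e))"
  then have e: "e \<in> sh_arrows C J" and s: "s \<in> Hom E (Dom E e) Lhat"
    and t: "t \<in> Hom E (Cod E e) Lhat"
    by simp_all
  have obj: "Dom E e \<in> sh_objects C J" "Cod E e \<in> sh_objects C J"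
    using e by simp_all
  note te = N_Tr_closed[OF e t]
  note m = N_meet_Hom[OF obj(1) te s]
  have "exN e (N_meet (Dom E e) (t \<cdot>\<^bsub>E\<^esub> e) s) = N_meet (Cod E e) (exN e s) t"
  proof (rule N_eqI[OF exN_Hom[OF e m] N_meet_Hom[OF obj(2) exN_Hom[OF e s] t]])
    fix c y assume c: "c \<in> Ob C" and y: "y \<in> Sec (Cod E e) c"
    note ty = N_closed[OF t c y]
    have lift: "ex g (component (N_meet (Dom E e) (t \<cdot>\<^bsub>E\<^esub> e) s) (Dom C g) x)
        = component t c y \<sqinter>\<^bsub>Fib L c\<^esub> ex g (component s (Dom C g) x)"
      if g: "g \<in> Arr C" "Cod C g = c" and x: "x \<in> Sec (Dom E e) (Dom C g)"
        "component e (Dom C g) x = Rst (Cod E e) g y" for g x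
    proof -
      have "component (N_meet (Dom E e) (t \<cdot>\<^bsub>E\<^esub> e) s) (Dom C g) x
          = Tr L g (component t c y) \<sqinter>\<^bsub>Fib L (Dom C g)\<^esub> component s (Dom C g) x"
        using N_natural[OF t g(1), of y] g x y component_Tr_N[OF e, of "Dom C g" x t]
        by (simp add: component_N_meet[OF obj(1)])
      then have "ex g (component (N_meet (Dom E e) (t \<cdot>\<^bsub>E\<^esub> e) s) (Dom C g) x)
          = ex g (component s (Dom C g) x) \<sqinter>\<^bsub>Fib L c\<^esub> component t c y"
        using frob[unfolded frobenius_def, rule_format, OF g(1), of "component s (Dom C g) x"
          "component t c y"]
          N_closed[OF s _ x(1)] ty g by simp
      then show ?thesis
        by (simp add: meet_def insert_commute)
    qed
    have "lifts e (N_meet (Dom E e) (t \<cdot>\<^bsub>E\<^esub> e) s) c y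
      = (\<lambda>z. component t c y \<sqinter>\<^bsub>Fib L c\<^esub> z) ` lifts e s c y"
    proof (intro equalityI subsetI)
      fix z assume "z \<in> lifts e (N_meet (Dom E e) (t \<cdot>\<^bsub>E\<^esub> e) s) c y"
      then obtain g x where z: "z = ex g (component (N_meet (Dom E e) (t \<cdot>\<^bsub>E\<^esub> e) s) (Dom C g) x)"
        and gx: "g \<in> Arr C" "Cod C g = c" "x \<in> Sec (Dom E e) (Dom C g)"
          "component e (Dom C g) x = Rst (Cod E e) g y"
        unfolding lifts_def by blast
      have "ex g (component s (Dom C g) x) \<in> lifts e s c y"
        unfolding lifts_def using gx by blast
      then show "z \<in> (\<lambda>z. component t c y \<sqinter>\<^bsub>Fib L c\<^esub> z) ` lifts e s c y"
        using lift[OF gx] z by blast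
    next
      fix z assume "z \<in> (\<lambda>z. component t c y \<sqinter>\<^bsub>Fib L c\<^esub> z) ` lifts e s c y"
      then obtain g x where z: "z = component t c y \<sqinter>\<^bsub>Fib L c\<^esub> ex g (component s (Dom C g) x)"
        and gx: "g \<in> Arr C" "Cod C g = c" "x \<in> Sec (Dom E e) (Dom C g)"
          "component e (Dom C g) x = Rst (Cod E e) g y"
        unfolding lifts_def by blast
      show "z \<in> lifts e (N_meet (Dom E e) (t \<cdot>\<^bsub>E\<^esub> e) s) c y"
        unfolding z lift[OF gx, symmetric] unfolding lifts_def using gx by blast
    qed
    then have "component (exN e (N_meet (Dom E e) (t \<cdot>\<^bsub>E\<^esub> e) s)) c y
        = component t c y \<sqinter>\<^bsub>Fib L c\<^esub> component (exN e s) c y"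
      using frame_distrib[OF L_frame[OF c] ty lifts_in[OF e s]] c y by (simp add: component_exN)
    then show "component (exN e (N_meet (Dom E e) (t \<cdot>\<^bsub>E\<^esub> e) s)) c y
      = component (N_meet (Cod E e) (exN e s) t) c y"
      using c y by (simp add: component_N_meet[OF obj(2)] meet_def insert_commute)
  qed
  then show "exN e (Tr N e t \<sqinter>\<^bsub>Fib N (Dom E e)\<^esub> s) = exN e s \<sqinter>\<^bsub>Fib N (Cod E e)\<^esub> t"
    using N_meet_eq[OF obj(1) te s] N_meet_eq[OF obj(2) exN_Hom[OF e s] t] by simp
qed

text \<open>Pullbacks of sheaves are computed sectionwise, by testing them on representables.\<close>

lemma pullback_section:
  assumes pb: "is_pullback E a b c d"
    and k: "k \<in> Ob C" and v: "v \<in> Sec (Dom E c) k" and w: "w \<in> Sec (Dom E d) k"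
    and vw: "component c k v = component d k w"
  obtains u where "u \<in> Sec (Dom E a) k" "component a k u = v" "component b k u = w"
proof -
  have arr: "a \<in> sh_arrows C J" "b \<in> sh_arrows C J" "c \<in> sh_arrows C J" "d \<in> sh_arrows C J"
      "Dom E a = Dom E b" "Cod E a = Dom E c" "Cod E b = Dom E d" "Cod E c = Cod E d"
    using pb by (auto simp: is_pullback_def spans_def)
  let ?p = "point (Dom E c) k v" and ?q = "point (Dom E d) k w" and ?i = "\<eta> k k (Id C k)"
  have "c \<cdot>\<^bsub>E\<^esub> ?p = d \<cdot>\<^bsub>E\<^esub> ?q"
    using Comp_point[OF arr(3) k v] Comp_point[OF arr(4) k w] vw arr by simp
  then have span: "(?p, ?q) \<in> spans E c d"
    using arr k v w by (simp add: spans_def)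
  have universal: "\<forall>(p, q)\<in>spans E c d.
      \<exists>!u. u \<in> Hom E (Dom E p) (Dom E a) \<and> a \<cdot>\<^bsub>E\<^esub> u = p \<and> b \<cdot>\<^bsub>E\<^esub> u = q"
    using pb unfolding is_pullback_def by (elim conjE)
  have "\<exists>!u. u \<in> Hom E (Dom E ?p) (Dom E a) \<and> a \<cdot>\<^bsub>E\<^esub> u = ?p \<and> b \<cdot>\<^bsub>E\<^esub> u = ?q"
    using bspec[OF universal span] by (simp only: case_prod_conv)
  then obtain u where u: "u \<in> Hom E (Dom E ?p) (Dom E a)" "a \<cdot>\<^bsub>E\<^esub> u = ?p" "b \<cdot>\<^bsub>E\<^esub> u = ?q"
    by (elim ex1E conjE)
  have i: "?i \<in> Sec (Dom E u) k"
    using Hom_Sh(2)[OF u(1)] arr k v by simp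
  show thesis
  proof
    show "component u k ?i \<in> Sec (Dom E a) k"
      using nat_trans_closed[OF Hom_Sh(6)[OF u(1)] k] i Hom_Sh(2)[OF u(1)] by simp
    show "component a k (component u k ?i) = v"
      using component_Comp[OF k i, of a] u(2) component_point_Id[of "Dom E c" k v] arr k v by simp
    show "component b k (component u k ?i) = w"
      using component_Comp[OF k i, of b] u(3) component_point_Id[of "Dom E d" k w] arr k w by simp
  qed
qed

text \<open>Sections of a pullback are pairs, so that lifts of \<open>w\<close> through \<open>b\<close> are the same as lifts of its
  image \<open>d w\<close> through \<open>c\<close>. Thus the two sides are joins of the same set.\<close>

lemma N_beck_chevalley: "beck_chevalley E N exN"
  unfolding beck_chevalley_def
proof (intro allI impI ballI)
  fix a b c d s assume pb: "is_pullback E a b c d" and "s \<in> carrier (Fib N (Dom E c))"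
  then have s: "s \<in> Hom E (Dom E c) Lhat"
    by simp
  have arr: "a \<in> sh_arrows C J" "b \<in> sh_arrows C J" "c \<in> sh_arrows C J" "d \<in> sh_arrows C J"
      "Dom E a = Dom E b" "Cod E a = Dom E c" "Cod E b = Dom E d" "Cod E c = Cod E d"
        "c \<cdot>\<^bsub>E\<^esub> a = d \<cdot>\<^bsub>E\<^esub> b"
    using pb by (auto simp: is_pullback_def spans_def)
  have sa: "s \<cdot>\<^bsub>E\<^esub> a \<in> Hom E (Dom E b) Lhat"
    using N_Tr_closed[OF arr(1), of s] s arr by simp
  have cs: "exN c s \<in> Hom E (Cod E d) Lhat"
    using exN_Hom[OF arr(3) s] arr by simp
  have "exN b (s \<cdot>\<^bsub>E\<^esub> a) = exN c s \<cdot>\<^bsub>E\<^esub> d"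
  proof (rule N_eqI)
    show "exN b (s \<cdot>\<^bsub>E\<^esub> a) \<in> Hom E (Dom E d) Lhat"
      using exN_Hom[OF arr(2) sa] arr by simp
    show "exN c s \<cdot>\<^bsub>E\<^esub> d \<in> Hom E (Dom E d) Lhat"
      using N_Tr_closed[OF arr(4) cs] .
    fix k w assume k: "k \<in> Ob C" and w: "w \<in> Sec (Dom E d) k"
    have dw: "component d k w \<in> Sec (Cod E c) k"
      using arrow_closed[OF arr(4) k w] arr by simp
    have d_nat: "Rst (Cod E c) g (component d k w) = component d (Dom C g) (Rst (Dom E d) g w)"
      if "g \<in> Arr C" "Cod C g = k" for g
      using arrow_natural[OF arr(4) that(1), of w] that w arr by simp
    have "lifts b (s \<cdot>\<^bsub>E\<^esub> a) k w = lifts c s k (component d k w)"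
    proof (intro equalityI subsetI)
      fix z assume "z \<in> lifts b (s \<cdot>\<^bsub>E\<^esub> a) k w"
      then obtain g u where z: "z = ex g (component (s \<cdot>\<^bsub>E\<^esub> a) (Dom C g) u)"
        and g: "g \<in> Arr C" "Cod C g = k"
        and u: "u \<in> Sec (Dom E b) (Dom C g)" "component b (Dom C g) u = Rst (Cod E b) g w"
        unfolding lifts_def by blast
      have u': "u \<in> Sec (Dom E a) (Dom C g)"
        using u arr by simp
      have "component c (Dom C g) (component a (Dom C g) u)
        = component d (Dom C g) (component b (Dom C g) u)"
        using component_Comp[of "Dom C g" C u J a c] component_Comp[of "Dom C g" C u J b d]
          u u' g arr(9) by simp
      also have "\<dots> = Rst (Cod E c) g (component d k w)"
        using u d_nat[OF g] arr by simp
      finally have "component c (Dom C g) (component a (Dom C g) u)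
        = Rst (Cod E c) g (component d k w)" .
      moreover have "component a (Dom C g) u \<in> Sec (Dom E c) (Dom C g)"
        using arrow_closed[OF arr(1) _ u'] g arr by simp
      moreover have "z = ex g (component s (Dom C g) (component a (Dom C g) u))"
        using z component_Comp[of "Dom C g" C u J a s] u' g by simp
      ultimately show "z \<in> lifts c s k (component d k w)"
        unfolding lifts_def using g by blast
    next
      fix z assume "z \<in> lifts c s k (component d k w)"
      then obtain g v where z: "z = ex g (component s (Dom C g) v)" and g: "g \<in> Arr C" "Cod C g = k"
        and v: "v \<in> Sec (Dom E c) (Dom C g)" "component c (Dom C g) v
          = Rst (Cod E c) g (component d k w)"
        unfolding lifts_def by blast
      have "Rst (Dom E d) g w \<in> Sec (Dom E d) (Dom C g)"
        using object_closed[OF E_Dom[OF arr(4)] g(1), of w] g w by simp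
      then obtain u where u: "u \<in> Sec (Dom E a) (Dom C g)" "component a (Dom C g) u = v"
          "component b (Dom C g) u = Rst (Dom E d) g w"
        using pullback_section[OF pb _ v(1)] v(2) d_nat[OF g] g by (metis Dom_Ob)
      then have "z = ex g (component (s \<cdot>\<^bsub>E\<^esub> a) (Dom C g) u)"
        using z component_Comp[of "Dom C g" C u J a s] g by simp
      moreover have "u \<in> Sec (Dom E b) (Dom C g)" "component b (Dom C g) u = Rst (Cod E b) g w"
        using u arr by simp_all
      ultimately show "z \<in> lifts b (s \<cdot>\<^bsub>E\<^esub> a) k w"
        unfolding lifts_def using g by blast
    qed
    then show "component (exN b (s \<cdot>\<^bsub>E\<^esub> a)) k w = component (exN c s \<cdot>\<^bsub>E\<^esub> d) k w"
      using component_Tr_N[OF arr(4) k w] k w dw arr by (simp add: component_exN)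
  qed
  then show "exN b (Tr N a s) = Tr N d (exN c s)"
    by simp
qed

lemma N_sheaf:
  assumes "grothendieck_topology E K" "subcanonical E K"
  shows "sheaf E K (underlying N)"
  unfolding underlying_N using assms(2) by (simp add: subcanonical_def)

text \<open>By the Yoneda lemma the restriction of \<open>N\<close> along the canonical functor is \<open>L\<close>.\<close>

lemma N_restrict: "pos_iso C L (precompose N l) (point Lhat)"
proof (intro pos_iso.intro pos_iso_axioms.intro)
  show "category C" "pos_functor C L" "pos_functor C (precompose N l)"
    using category_axioms L_pos pos_functor_precompose[OF N_pos category_axioms l_functor] by blast+
  have point_Hom: "point Lhat c x \<in> Hom E (FOb l c) Lhat" if "c \<in> Ob C"
    "x \<in> carrier (Fib L c)" for c x
    using that by (simp add: Hom_def)
  show "nat_trans C (underlying L) (underlying (precompose N l)) (point Lhat)"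
    unfolding nat_trans_def
  proof (intro conjI ballI Pi_I)
    show "point Lhat c x \<in> Sec (underlying (precompose N l)) c" if "c \<in> Ob C"
      "x \<in> Sec (underlying L) c" for c x
      using point_Hom that by (simp add: underlying_def)
    show "point Lhat (Dom C f) (Rst (underlying L) f x)
        = Rst (underlying (precompose N l)) f (point Lhat (Cod C f) x)"
      if "f \<in> Arr C" "x \<in> Sec (underlying L) (Cod C f)" for f x
      using point_restrict[OF Lhat_object, of f x] that by (simp add: underlying_def)
  qed
  fix c assume c: "c \<in> Ob C"
  let ?i = "\<eta> c c (Id C c)"
  have i: "?i \<in> Sec (FOb l c) c"
    using c by simp
  have unit: "component (point Lhat c x) c ?i = x" if "x \<in> carrier (Fib L c)" for x
    using component_point_Id[OF Lhat_object c] that c by simp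
  show "order_iso (Fib L c) (Fib (precompose N l) c) (point Lhat c)"
  proof (rule order_iso.intro)
    show "partial_order (Fib L c)" "partial_order (Fib (precompose N l) c)"
      using c N_order by simp_all
    have "inj_on (point Lhat c) (carrier (Fib L c))"
      using unit by (intro inj_onI) metis
    moreover have "s \<in> point Lhat c ` carrier (Fib L c)" if s: "s \<in> Hom E (FOb l c) Lhat" for s
      using point_unique[of s c Lhat "component s c ?i"] Hom_Sh[OF s] c N_closed[OF s c i] by blast
    ultimately show "bij_betw (point Lhat c) (carrier (Fib L c)) (carrier (Fib (precompose N l) c))"
      using point_Hom[OF c] by (auto simp: bij_betw_def)
    fix x y assume x: "x \<in> carrier (Fib L c)" and y: "y \<in> carrier (Fib L c)"
    note xy = point_Hom[OF c x] point_Hom[OF c y]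
    note m = N_meet_Hom[OF l_obj[OF c] xy]
    have "point Lhat c x \<sqsubseteq>\<^bsub>Fib N (FOb l c)\<^esub> point Lhat c y \<longleftrightarrow> x \<sqsubseteq>\<^bsub>Fib L c\<^esub> y"
    proof
      assume "point Lhat c x \<sqsubseteq>\<^bsub>Fib N (FOb l c)\<^esub> point Lhat c y"
      then show "x \<sqsubseteq>\<^bsub>Fib L c\<^esub> y"
        using unit[OF x] unit[OF y] c i unfolding le_N by metis
    next
      assume "x \<sqsubseteq>\<^bsub>Fib L c\<^esub> y"
      then have "x \<sqinter>\<^bsub>Fib L c\<^esub> y = x"
        using le_iff_meet[OF L_complete[OF c] x y] by blast
      then have "component (N_meet (FOb l c) (point Lhat c x) (point Lhat c y)) c ?i = x"
        using unit[OF x] unit[OF y] c i component_N_meet[OF l_obj[OF c] c i] by simp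
      then have "N_meet (FOb l c) (point Lhat c x) (point Lhat c y) = point Lhat c x"
        using Hom_Sh[OF m] c by (intro point_unique) auto
      then show "point Lhat c x \<sqsubseteq>\<^bsub>Fib N (FOb l c)\<^esub> point Lhat c y"
        using le_iff_meet[OF N_complete[OF l_obj[OF c]], of "point Lhat c x" "point Lhat c y"]
          N_meet_eq[OF l_obj[OF c] xy] xy by simp
    qed
    then show "point Lhat c x \<sqsubseteq>\<^bsub>Fib (precompose N l) c\<^esub> point Lhat c y \<longleftrightarrow> x \<sqsubseteq>\<^bsub>Fib L c\<^esub> y"
      by simp
  qed
qed

end

text \<open>An arrow of the topos is determined by its components over the small dense set of objects.\<close>

lemma (in small_site) small_Hom:
  fixes F G :: "('o, 'a, 'u) psh"
  assumes F: "F \<in> sh_objects C J" and G: "G \<in> sh_objects C J"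
  shows "small TYPE('u) (Hom (Sh C J) F G)"
proof -
  let ?B = "SIGMA d:D. Sec F d \<times> Sec G d"
  define graph where "graph s = {(d, x, y). d \<in> D \<and> x \<in> Sec F d \<and> y = component s d x}"
    for s :: "('o, 'a, 'u) sh_arr"
  have "small TYPE('u) ?B"
    using small_object[OF F] small_object[OF G] D_Ob
    by (intro small_Sigma[OF universe small_D] small_Sigma[OF universe]) auto
  then have "small TYPE('u) (Pow ?B)"
    by (rule small_Pow[OF universe])
  moreover have "inj_on graph (Hom (Sh C J) F G)"
  proof (rule inj_onI)
    fix s t assume s: "s \<in> Hom (Sh C J) F G" and t: "t \<in> Hom (Sh C J) F G"
      and eq: "graph s = graph t"
    have on_D: "component s d x = component t d x" if "d \<in> D" "x \<in> Sec F d" for d x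
      using eq that by (auto simp: graph_def set_eq_iff)
    note s' = Hom_Sh[OF s] and t' = Hom_Sh[OF t]
    show "s = t"
    proof (rule arrow_eqI[OF s'(1) t'(1)])
      fix c x assume c: "c \<in> Ob C" and "x \<in> Sec (Dom (Sh C J) s) c"
      then have x: "x \<in> Sec F c"
        using s' by simp
      show "component s c x = component t c x"
      proof (rule nat_trans_eqI[OF presheaf_object[OF F] sheaf_object[OF G] s'(6) t'(6) _ c x])
        show "locally J c (\<lambda>f. component s (Dom C f) (Rst F f x)
          = component t (Dom C f) (Rst F f x))"
        proof (rule locally_mono[OF locally_dense[OF c] c])
          fix f assume "through_D c f"
          then obtain r g where f: "f = r \<cdot> g" "r \<in> Arr C" "Cod C r = c" "Dom C r \<in> D" "g \<in> Arr C"
            "Cod C g = Dom C r"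
            by blast
          have xr: "Rst F r x \<in> Sec F (Dom C r)"
            using object_closed[OF F f(2)] f x by simp
          have xf: "Rst F f x = Rst F g (Rst F r x)"
            using presheaf_Comp[OF presheaf_object[OF F] f(2,5,6)] f x by simp
          show "component s (Dom C f) (Rst F f x) = component t (Dom C f) (Rst F f x)"
            using nat_trans_natural[OF s'(6) f(5), of "Rst F r x"]
              nat_trans_natural[OF t'(6) f(5), of "Rst F r x"]
              on_D[OF f(4) xr] xr xf f by simp
        qed
      qed
    qed (use s' t' in simp_all)
  qed
  moreover have "graph ` Hom (Sh C J) F G \<subseteq> Pow ?B"
  proof (intro image_subsetI PowI subsetI)
    fix s z assume s: "s \<in> Hom (Sh C J) F G" and "z \<in> graph s"
    then show "z \<in> ?B"
      using nat_trans_closed[OF Hom_Sh(6)[OF s] D_Ob] by (auto simp: graph_def)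
  qed
  ultimately show ?thesis
    by (rule small_inj_on[rotated 2])
qed

context existential_site
begin

text \<open>The representable \<open>N\<close> takes its values in sets of arrows; by \<open>small_Hom\<close> these can be encoded in
  \<open>'u\<close>, and all the structure is transported along the encoding.\<close>

lemma internal_locale_of_existential:
  "\<exists>M :: (('o, 'a, 'u) psh, ('o, 'a, 'u) sh_arr, 'u) pos_psh.
    internal_locale E M \<and> pos_functor_iso C L (precompose M l)"
proof -
  obtain M :: "(('o, 'a, 'u) psh, ('o, 'a, 'u) sh_arr, 'u) pos_psh" and \<phi>
    where M: "pos_iso E N M \<phi>" and small_M: "\<And>F. F \<in> Ob E \<Longrightarrow> small TYPE('u) (carrier (Fib M F))"
    using encode_pos_functor[OF E.category_axioms N_pos] small_Hom[OF _ Lhat_object]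
    by (metis carrier_N Sh_simps(1))
  interpret iso: pos_iso E N M \<phi> by fact
  have M_frame: "frame_functor E M"
    using iso.frame_valued_iso[OF N_frame_valued] small_M by (simp add: frame_functor_iff)
  have sheaf_K: "sheaf E K (underlying M)" if K: "grothendieck_topology E K"
    "subcanonical E K" for K
  proof -
    interpret EK: site E K
      by unfold_locales (rule K(1))
    show ?thesis
      by (rule EK.sheaf_transport[OF N_sheaf[OF K] iso.nat])
        (use order_iso.bij[OF iso.iso] in \<open>simp add: underlying_def\<close>)
  qed
  have "sheaf E (canonical_topology E) (underlying M)"
    unfolding sheaf_def
  proof (intro conjI ballI)
    show "presheaf E (underlying M)"
      using pos_functor_presheaf[OF iso.L'] .
    fix F S assume F: "F \<in> Ob E" and "S \<in> canonical_topology E F"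
    then obtain K where "grothendieck_topology E K" "subcanonical E K" "S \<in> K F"
      unfolding canonical_topology_def by blast
    then show "\<forall>x. matching_family E (underlying M) S x \<longrightarrow>
        (\<exists>!t. t \<in> Sec (underlying M) F \<and> (\<forall>f\<in>S. Rst (underlying M) f t = x f))"
      using sheaf_K F unfolding sheaf_def by blast
  qed
  then have "internal_locale E M"
    unfolding internal_locale_def
    using M_frame iso.left_adjoints_iso[OF N_left_adjoints]
      iso.beck_chevalley_iso[OF N_left_adjoints N_beck_chevalley]
      iso.frobenius_iso[OF N_left_adjoints N_frame_valued N_frobenius]
    by blast
  moreover have "pos_functor_iso C L (precompose M l)"
    using pos_iso_compose[OF N_restrict pos_iso_precompose[OF M category_axioms l_functor]]
      pos_functor_iso_iff[OF category_axioms] by blast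
  ultimately show ?thesis
    by blast
qed

end

theorem proposition5p9:
  fixes C :: "('o, 'a) cat"
    and J :: "'o \<Rightarrow> 'a set set"
    and L :: "('o, 'a, 'u) pos_psh"
  assumes "universe TYPE('u)"
    and "small_generated_site TYPE('u) C J"
  shows "internal_locale_in_Sh C J L \<longleftrightarrow>
    frame_functor C L \<and> sheaf C J (underlying L) \<and> existential C L"
proof -
  obtain D where C: "category C" "grothendieck_topology C J" "locally_small TYPE('u) C"
    and D: "small TYPE('u) D" "J_dense C J D"
    using assms(2) unfolding small_generated_site_def by blast
  interpret small_site C J "TYPE('u)" D
    using C D assms(1) by (intro small_site.intro site.intro site_axioms.intro small_site_axioms.intro)
  let ?l = "l_functor C J :: ('o, 'a, ('o, 'a, 'u) psh, ('o, 'a, 'u) sh_arr) func"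
  have "canonical_functor C J ?l"
    unfolding l_functor_def by (rule someI_ex[OF canonical_functor_exists])
  then have l: "is_functor C (Sh C J) ?l"
    and "\<exists>\<eta>. (\<forall>c\<in>Ob C. sheafification C J (yo C c) (FOb ?l c) (\<eta> c)) \<and>
      (\<forall>h\<in>Arr C. \<forall>d\<in>Ob C. \<forall>g\<in>Hom C d (Dom C h).
         component (FArr ?l h) d (\<eta> (Dom C h) d g) = \<eta> (Cod C h) d (h \<cdot>\<^bsub>C\<^esub> g))"
    unfolding canonical_functor_def by blast+
  then obtain \<eta> where \<eta>: "\<forall>c\<in>Ob C. sheafification C J (yo C c) (FOb ?l c) (\<eta> c)"
    "\<forall>h\<in>Arr C. \<forall>d\<in>Ob C. \<forall>g\<in>Hom C d (Dom C h).
       component (FArr ?l h) d (\<eta> (Dom C h) d g) = \<eta> (Cod C h) d (h \<cdot>\<^bsub>C\<^esub> g)"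
    by (elim exE conjE)
  interpret canonical_site C J "TYPE('u)" D ?l \<eta>
    by (intro canonical_site.intro canonical_site_axioms.intro small_site_axioms l)
      (use \<eta> in blast)+
  show ?thesis
  proof
    assume "internal_locale_in_Sh C J L"
    then obtain M :: "(('o, 'a, 'u) psh, ('o, 'a, 'u) sh_arr, 'u) pos_psh"
      where "internal_locale E M" "pos_functor_iso C L (precompose M ?l)"
      unfolding internal_locale_in_Sh_def by blast
    from existential_of_internal_locale[OF this]
    show "frame_functor C L \<and> sheaf C J (underlying L) \<and> existential C L"
      by blast
  next
    assume L: "frame_functor C L \<and> sheaf C J (underlying L) \<and> existential C L"
    then obtain ex where ex: "left_adjoints C L ex" "relative_beck_chevalley C L ex" "frobenius C L ex"
      unfolding existential_def by blast
    interpret existential_site C J "TYPE('u)" D ?l \<eta> L ex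
      using L ex by (intro existential_site.intro existential_site_axioms.intro canonical_site_axioms) simp_all
    show "internal_locale_in_Sh C J L"
      unfolding internal_locale_in_Sh_def using internal_locale_of_existential .
  qed
qed


end
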